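(* Let $\mathbf{w}=(1^{a_0},m_1^{a_1},\dots,m_k^{a_k})$ with $1<m_1<\cdots<m_k$ (not necessarily divisible), and let $M$ be a 1-generic matrix over $S(\mathbf{w})$ with two rows and profile \[ (1^{a_0-1},m_1^{a_1},\dots,m_{k-1}^{a_{k-1}},m_k^{r_k}). \] Write $M=(M_0\mid M_1\mid\cdots\mid M_k)$, where $M_i$ is the submatrix of columns of degree $m_i$. Then, up to a change of coordinates, (i) $M_0$ is a scroll block; (ii) for each $1\le i\le k-1$, $M_i$ is made up of Jordan blocks and at most one nilpotent block of size one; (iii) $M_k$ is made up of Jordan blocks, scroll blocks and at most one nilpotent block of size one. Furthermore, $I_2(M)$ is prime.
   Context: $\Bbbk$ algebraically closed. $S(\mathbf{w})=\Bbbk[x_{i,j}: 0\le i\le k,\ 1\le j\le a_i]$ with $\deg x_{i,j}=m_i$, $m_0=1$ (exponents in $\mathbf{w}$ denote multiplicities). For a $2\times q$ matrix $M$ with homogeneous entries in which all entries of each column have the same degree, its profile is the multiset of column degrees. A generalized row is a nontrivial $\Bbbk$-linear combination of the rows; $M$ is pseudo 1-generic if the entries of every generalized row form a regular sequence in $S(\mathbf{w})_{(x_{i,j})}$; $M$ is 1-generic if it is pseudo 1-generic and its profile is obtained by deleting entries from $\mathbf{w}$. $I_2(M)$ is the ideal of $2\times2$ minors. Blocks in degree $m_i$: let $x_{i,j_1},\dots,x_{i,j_l}$ be distinct variables of degree $m_i$ and $p_s$ homogeneous polynomials of degree $m_i$ in the variables of degree $<m_i$ (necessarily $0$ when $i=0$).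 A scroll block is the $2\times(l-1)$ matrix with first row $(x_{i,j_1},\dots,x_{i,j_{l-1}})$ and second row $(x_{i,j_2}+p_2,\ x_{i,j_3}+p_3,\dots,x_{i,j_{l-1}}+p_{l-1},\ x_{i,j_l})$. A Jordan block (with $\epsilon\in\Bbbk$) is the $2\times l$ matrix whose $s$-th column is $(x_{i,j_s},\ x_{i,j_{s+1}}+\epsilon x_{i,j_s}+p_s)^T$ for $s<l$ and whose last column is $(x_{i,j_l},\ \epsilon x_{i,j_l}+p_l)^T$. A nilpotent block of size one is a single column $(p_1,\ x_{i,j_1})^T$. "$M_i$ is made up of" such blocks means $M_i$ is a concatenation of them, with the sets of degree-$m_i$ variables in different blocks disjoint. "Up to a change of coordinates" means after applying a graded automorphism of $S(\mathbf{w})$ together with invertible homogeneity-preserving row and column operations (including column permutations) on $M$. *)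

theory Defs
  imports Main "HOL-Library.Poly_Mapping" "HOL-Library.Multiset"
          "HOL-Computational_Algebra.Polynomial"
begin

(* Multivariate polynomials over 'k in the variables x_(i,j), (i,j) :: nat \<times> nat,
   represented as finitely supported maps from monomials (exponent vectors) to coefficients. *)
type_synonym 'k mpoly = "((nat \<times> nat) \<Rightarrow>\<^sub>0 nat) \<Rightarrow>\<^sub>0 'k"

definition alg_closed_field :: "'k::field itself \<Rightarrow> bool" where
  "alg_closed_field _ \<longleftrightarrow> (\<forall>p :: 'k poly. degree p \<ge> 1 \<longrightarrow> (\<exists>x. poly p x = 0))"

definition Var :: "nat \<times> nat \<Rightarrow> 'k::comm_ring_1 mpoly" where
  "Var v = Poly_Mapping.single (Poly_Mapping.single v 1) 1"

definition Const :: "'k::comm_ring_1 \<Rightarrow> 'k mpoly" where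
  "Const c = Poly_Mapping.single 0 c"

definition const_term :: "'k::comm_ring_1 mpoly \<Rightarrow> 'k" where
  "const_term p = Poly_Mapping.lookup p 0"

definition mvars :: "'k::comm_ring_1 mpoly \<Rightarrow> (nat \<times> nat) set" where
  "mvars p = (\<Union>mon \<in> Poly_Mapping.keys p. Poly_Mapping.keys mon)"

definition Vars :: "nat \<Rightarrow> (nat \<Rightarrow> nat) \<Rightarrow> (nat \<times> nat) set" where
  "Vars k a = {(i, j). i \<le> k \<and> 1 \<le> j \<and> j \<le> a i}"

definition Sw :: "nat \<Rightarrow> (nat \<Rightarrow> nat) \<Rightarrow> 'k::comm_ring_1 mpoly set" where
  "Sw k a = {p. mvars p \<subseteq> Vars k a}"

definition wdeg :: "(nat \<Rightarrow> nat) \<Rightarrow> ((nat \<times> nat) \<Rightarrow>\<^sub>0 nat) \<Rightarrow> nat" where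
  "wdeg m mon = (\<Sum>v \<in> Poly_Mapping.keys mon. Poly_Mapping.lookup mon v * m (fst v))"

definition homog :: "(nat \<Rightarrow> nat) \<Rightarrow> nat \<Rightarrow> 'k::comm_ring_1 mpoly \<Rightarrow> bool" where
  "homog m d p \<longleftrightarrow> (\<forall>mon \<in> Poly_Mapping.keys p. wdeg m mon = d)"

definition gen_ideal :: "'k::comm_ring_1 mpoly set \<Rightarrow> 'k mpoly set \<Rightarrow> 'k mpoly set" where
  "gen_ideal R G = {(\<Sum>i<n. c i * g i) | (n::nat) c g. \<forall>i<n. c i \<in> R \<and> g i \<in> G}"

definition prime_ideal_in :: "'k::comm_ring_1 mpoly set \<Rightarrow> 'k mpoly set \<Rightarrow> bool" where
  "prime_ideal_in R I \<longleftrightarrow> 1 \<notin> I \<and>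
     (\<forall>f \<in> R. \<forall>g \<in> R. f * g \<in> I \<longrightarrow> f \<in> I \<or> g \<in> I)"

(* Regular sequence in the localization R_(x) of R at the ideal generated by the variables
   (= the polynomials with zero constant term), written out in terms of R:
   an element u \<in> R is a unit of R_(x) iff const_term u \<noteq> 0, and
   for an ideal J of R and g \<in> R:  g \<in> J R_(x)  iff  \<exists>u \<in> R, const_term u \<noteq> 0, u g \<in> J. *)
definition in_loc_ext :: "'k::comm_ring_1 mpoly set \<Rightarrow> 'k mpoly set \<Rightarrow> 'k mpoly \<Rightarrow> bool" where
  "in_loc_ext R J g \<longleftrightarrow> (\<exists>u \<in> R. const_term u \<noteq> 0 \<and> u * g \<in> J)"

definition regular_seq_loc :: "'k::comm_ring_1 mpoly set \<Rightarrow> 'k mpoly list \<Rightarrow> bool" where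
  "regular_seq_loc R fs \<longleftrightarrow>
     \<not> in_loc_ext R (gen_ideal R (set fs)) 1 \<and>
     (\<forall>i < length fs. \<forall>g \<in> R.
        in_loc_ext R (gen_ideal R (set (take i fs))) (fs ! i * g) \<longrightarrow>
        in_loc_ext R (gen_ideal R (set (take i fs))) g)"

definition homog_matrix ::
  "nat \<Rightarrow> (nat \<Rightarrow> nat) \<Rightarrow> (nat \<Rightarrow> nat) \<Rightarrow> nat \<Rightarrow> (nat \<Rightarrow> nat \<Rightarrow> 'k::comm_ring_1 mpoly)
     \<Rightarrow> (nat \<Rightarrow> nat) \<Rightarrow> bool" where
  "homog_matrix k a m q M cd \<longleftrightarrow>
     (\<forall>r < 2. \<forall>j < q. M r j \<in> Sw k a \<and> homog m (cd j) (M r j))"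

definition profile :: "nat \<Rightarrow> (nat \<Rightarrow> nat) \<Rightarrow> nat multiset" where
  "profile q cd = mset (map cd [0..<q])"

definition weight_mset :: "nat \<Rightarrow> (nat \<Rightarrow> nat) \<Rightarrow> (nat \<Rightarrow> nat) \<Rightarrow> nat multiset" where
  "weight_mset k a m = (\<Sum>i \<le> k. replicate_mset (a i) (m i))"

definition pseudo_1_generic ::
  "nat \<Rightarrow> (nat \<Rightarrow> nat) \<Rightarrow> nat \<Rightarrow> (nat \<Rightarrow> nat \<Rightarrow> 'k::comm_ring_1 mpoly) \<Rightarrow> bool" where
  "pseudo_1_generic k a q M \<longleftrightarrow>
     (\<forall>c0 c1 :: 'k. (c0, c1) \<noteq> (0, 0) \<longrightarrow>
        regular_seq_loc (Sw k a) (map (\<lambda>j. Const c0 * M 0 j + Const c1 * M 1 j) [0..<q]))"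

definition one_generic ::
  "nat \<Rightarrow> (nat \<Rightarrow> nat) \<Rightarrow> (nat \<Rightarrow> nat) \<Rightarrow> nat \<Rightarrow> (nat \<Rightarrow> nat \<Rightarrow> 'k::comm_ring_1 mpoly)
     \<Rightarrow> (nat \<Rightarrow> nat) \<Rightarrow> bool" where
  "one_generic k a m q M cd \<longleftrightarrow>
     pseudo_1_generic k a q M \<and> profile q cd \<subseteq># weight_mset k a m"

definition I2 :: "nat \<Rightarrow> (nat \<Rightarrow> nat) \<Rightarrow> nat \<Rightarrow> (nat \<Rightarrow> nat \<Rightarrow> 'k::comm_ring_1 mpoly) \<Rightarrow> 'k mpoly set" where
  "I2 k a q M = gen_ideal (Sw k a)
     {M 0 j * M 1 l - M 0 l * M 1 j | j l. j < l \<and> l < q}"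

definition subst :: "((nat \<times> nat) \<Rightarrow> 'k::comm_ring_1 mpoly) \<Rightarrow> 'k mpoly \<Rightarrow> 'k mpoly" where
  "subst \<sigma> p = (\<Sum>mon \<in> Poly_Mapping.keys p. Const (Poly_Mapping.lookup p mon) * (\<Prod>v \<in> Poly_Mapping.keys mon. \<sigma> v ^ Poly_Mapping.lookup mon v))"

definition graded_aut ::
  "nat \<Rightarrow> (nat \<Rightarrow> nat) \<Rightarrow> (nat \<Rightarrow> nat) \<Rightarrow> ((nat \<times> nat) \<Rightarrow> 'k::comm_ring_1 mpoly) \<Rightarrow> bool" where
  "graded_aut k a m \<sigma> \<longleftrightarrow>
     (\<forall>v \<in> Vars k a. \<sigma> v \<in> Sw k a \<and> homog m (m (fst v)) (\<sigma> v)) \<and>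
     bij_betw (subst \<sigma>) (Sw k a) (Sw k a)"

(* M' is obtained from M by a change of coordinates: a graded automorphism, an invertible
   (constant) row operation P and an invertible homogeneity-preserving column operation Q
   (entries of Q in S(w), Q j l homogeneous of degree cd' l - cd j, zero if cd j > cd' l;
   this includes column permutations); cd' are the column degrees of M'. *)
definition change_of_coords ::
  "nat \<Rightarrow> (nat \<Rightarrow> nat) \<Rightarrow> (nat \<Rightarrow> nat) \<Rightarrow> nat
    \<Rightarrow> (nat \<Rightarrow> nat \<Rightarrow> 'k::field mpoly) \<Rightarrow> (nat \<Rightarrow> nat)
    \<Rightarrow> (nat \<Rightarrow> nat \<Rightarrow> 'k mpoly) \<Rightarrow> (nat \<Rightarrow> nat) \<Rightarrow> bool" where
  "change_of_coords k a m q M cd M' cd' \<longleftrightarrow>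
     (\<exists>\<sigma> (P :: nat \<Rightarrow> nat \<Rightarrow> 'k) Q Q'.
        graded_aut k a m \<sigma> \<and>
        P 0 0 * P 1 1 - P 0 1 * P 1 0 \<noteq> 0 \<and>
        (\<forall>j < q. \<forall>l < q. Q j l \<in> Sw k a \<and> Q' j l \<in> Sw k a \<and>
           (if cd j \<le> cd' l then homog m (cd' l - cd j) (Q j l) else Q j l = 0) \<and>
           (if cd' j \<le> cd l then homog m (cd l - cd' j) (Q' j l) else Q' j l = 0)) \<and>
        (\<forall>j < q. \<forall>l < q. (\<Sum>t < q. Q j t * Q' t l) = (if j = l then 1 else 0)) \<and>
        (\<forall>j < q. \<forall>l < q. (\<Sum>t < q. Q' j t * Q t l) = (if j = l then 1 else 0)) \<and>
        (\<forall>r < 2. \<forall>l < q. M' r l =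
            (\<Sum>j < q. (\<Sum>s < 2. Const (P r s) * subst \<sigma> (M s j)) * Q j l)))"

definition deg_part ::
  "nat \<Rightarrow> (nat \<Rightarrow> nat \<Rightarrow> 'k::comm_ring_1 mpoly) \<Rightarrow> (nat \<Rightarrow> nat) \<Rightarrow> nat \<Rightarrow> ('k mpoly \<times> 'k mpoly) list" where
  "deg_part q M cd d = map (\<lambda>j. (M 0 j, M 1 j)) (filter (\<lambda>j. cd j = d) [0..<q])"

definition lower_poly ::
  "nat \<Rightarrow> (nat \<Rightarrow> nat) \<Rightarrow> (nat \<Rightarrow> nat) \<Rightarrow> nat \<Rightarrow> 'k::comm_ring_1 mpoly \<Rightarrow> bool" where
  "lower_poly k a m i p \<longleftrightarrow>
     homog m (m i) p \<and> mvars p \<subseteq> {v \<in> Vars k a. m (fst v) < m i}"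

datatype block_kind = Scroll | Jordan | Nilpotent

definition is_block ::
  "nat \<Rightarrow> (nat \<Rightarrow> nat) \<Rightarrow> (nat \<Rightarrow> nat) \<Rightarrow> nat \<Rightarrow> block_kind \<Rightarrow> nat list
     \<Rightarrow> ('k::comm_ring_1 mpoly \<times> 'k mpoly) list \<Rightarrow> bool" where
  "is_block k a m i kind js cols \<longleftrightarrow>
     js \<noteq> [] \<and> distinct js \<and> (\<forall>j \<in> set js. (i, j) \<in> Vars k a) \<and>
     (\<exists>p :: nat \<Rightarrow> 'k mpoly. (\<forall>s. lower_poly k a m i (p s)) \<and>
       (case kind of
          Scroll \<Rightarrow>
            cols = map (\<lambda>s. (Var (i, js ! s),
                              Var (i, js ! (s + 1)) + (if s + 2 < length js then p (s + 1) else 0)))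
                       [0..<length js - 1]
        | Jordan \<Rightarrow> (\<exists>\<epsilon> :: 'k.
            cols = map (\<lambda>s. (Var (i, js ! s),
                              (if s + 1 < length js then Var (i, js ! (s + 1)) else 0)
                              + Const \<epsilon> * Var (i, js ! s) + p s))
                       [0..<length js])
        | Nilpotent \<Rightarrow> length js = 1 \<and> cols = [(p 0, Var (i, js ! 0))]))"

definition made_up_of ::
  "nat \<Rightarrow> (nat \<Rightarrow> nat) \<Rightarrow> (nat \<Rightarrow> nat) \<Rightarrow> nat \<Rightarrow> block_kind set
     \<Rightarrow> ('k::comm_ring_1 mpoly \<times> 'k mpoly) list \<Rightarrow> bool" where
  "made_up_of k a m i K C \<longleftrightarrow>
     (\<exists>bs :: (block_kind \<times> nat list \<times> ('k mpoly \<times> 'k mpoly) list) list.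
        (\<forall>(kind, js, cols) \<in> set bs. kind \<in> K \<and> is_block k a m i kind js cols) \<and>
        distinct (concat (map (\<lambda>b. fst (snd b)) bs)) \<and>
        C = concat (map (\<lambda>b. snd (snd b)) bs) \<and>
        length (filter (\<lambda>b. fst b = Nilpotent) bs) \<le> 1)"

end

(*
Over K[mu], let r_j(mu) = N_0j - mu N_1j run over the generic generalized row of an invertible row transform
N of M. Regularity of all generalized rows says that their syzygies are Koszul; hence S[mu]/(r_j) is torsion
free over K[mu], and the elements of S in (r_j) are exactly I_2(M) (compare top coefficients in mu). If the
linear part of each M_i is generically injective, all variables except the ends of scroll chains can be
eliminated from S[mu]/(r_j) after inverting a polynomial in mu, so that it embeds in a polynomial ring over
K(mu) and I_2(M) is prime.

Generic injectivity is the crux. A relation v(mu) among the linear parts of M_i turns into a polynomial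
h = sum v_j r_j in the lower variables which is nonzero in the fibre over every point of P^1. The part of
degree m_i of the quotient by the lower columns has rank one over K[mu], so h generates it, and it would be a
line bundle on P^1 that is globally generated but of negative degree.

Consequently infinity is not an eigenvalue of any M_i for a general choice of the rows, Kronecker's normal form
needs no nilpotent block, and counting columns leaves one scroll in M_0 and only Jordan blocks in
M_1, ..., M_(k-1).
*)
theory Submission
  imports Defs "HOL-Library.Product_Lexorder"
begin

section \<open>Bases of finitely generated subspaces\<close>

text \<open>Generic injectivity in degree m_n uses elimination of all variables of smaller degree.
  That elimination reads its equations from normal forms of the lower columns, which exist only if
  those columns are already injective, for one common choice of rows. The circle is broken by
  induction over the number n of degrees in \<open>generic_row\<close>, with a shear of the rows at
  each stage; hence the parameter n of \<open>nf_family\<close>, at most k in the regularity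
  argument and k + 1 at the end. The rank one statement comes from the profile: below degree m_n the
  columns number one fewer than the variables, so a single variable of degree 1 survives
  elimination. Only degrees below m_n are counted, so the argument covers the last degree too, where
  the number of columns is not tied to \<open>a k\<close>. Geometry on the projective line is
  replaced by two operations on polynomials in \<mu>: evaluation at a finite point followed by
  division by \<mu> - \<epsilon>, and comparison of top coefficients for the point at infinity. Each
  is one application of the Koszul property, to the generalized rows (1, -\<epsilon>) and (0,
  1).\<close>

context vector_space
begin

lemma spanning_card_independent:
  assumes "finite S" "independent B" "B \<subseteq> span S" "card S \<le> card B"
  shows "independent S"
proof -
  obtain T where T: "T \<subseteq> S" "independent T" "S \<subseteq> span T"
    using maximal_independent_subset[of S] by blast
  have "finite T" using T(1) assms(1) finite_subset by blast
  have "span S \<subseteq> span T" using T(3) by (simp add: span_minimal)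
  then have "card B \<le> card T"
    using independent_span_bound[OF \<open>finite T\<close> assms(2)] assms(3) by auto
  then have "T = S" using assms(1,4) T(1) by (simp add: card_seteq)
  then show ?thesis using T by simp
qed

lemma independent_card_span:
  assumes "finite B" "independent S" "S \<subseteq> span B" "card B \<le> card S"
  shows "span S = span B"
proof -
  have finS: "finite S" and cS: "card S \<le> card B" using independent_span_bound[OF assms(1-3)] by auto
  have "b \<in> span S" if "b \<in> B" for b
  proof (rule ccontr)
    assume b: "b \<notin> span S"
    then have "independent (insert b S)" using assms(2) by (rule independent_insertI)
    moreover have "insert b S \<subseteq> span B" using assms(3) that by (simp add: span_base)
    ultimately have "card (insert b S) \<le> card B" using independent_span_bound[OF assms(1)] by auto
    moreover have "b \<notin> S" using b span_base[of b S] by metis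
    ultimately show False using assms(4) finS by simp
  qed
  then show ?thesis by (metis assms(3) span_eq subsetI)
qed

lemma subspace_finite_basis:
  assumes "finite B" "subspace V" "V \<subseteq> span B"
  obtains C where "finite C" "independent C" "span C = V" "card C \<le> card B"
proof -
  obtain C where C: "C \<subseteq> V" "independent C" "V \<subseteq> span C"
    using maximal_independent_subset[of V] by blast
  have "span C = V" using C assms(2) by (simp add: span_subspace)
  moreover have "finite C" "card C \<le> card B"
    using independent_span_bound[OF assms(1) C(2)] C(1) assms(3) by auto
  ultimately show ?thesis using that C by blast
qed

text \<open>A dependence puts some \<open>g e - g v\<close> with \<open>v \<in> span F\<close> into
  \<open>span A\<close>; the last hypothesis moves \<open>e - v\<close> into \<open>span D\<close>,
  against independence of \<open>D \<union> E\<close>. For scroll chains A holds all vectors, D the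
  domain vectors and E the ends, so the prolonged ends are new modulo \<open>span A\<close>.\<close>

lemma independent_Un_image:
  assumes lin: "Vector_Spaces.linear scale scale g" and A: "independent A" and E: "finite E"
    and indDE: "independent (D \<union> E)" "D \<inter> E = {}"
    and V: "D \<union> E \<subseteq> span A"
    and D: "\<And>v. v \<in> span A \<Longrightarrow> g v \<in> span A \<Longrightarrow> v \<in> span D"
  shows "independent (A \<union> g ` E) \<and> inj_on g E \<and> A \<inter> g ` E = {}"
proof -
  interpret g: Vector_Spaces.linear scale scale g by fact
  have "F \<subseteq> E \<Longrightarrow> independent (A \<union> g ` F) \<and> inj_on g F \<and> A \<inter> g ` F = {}" if "finite F" for F
    using that
  proof (induction F rule: finite_induct)
    case empty
    then show ?case using A by simp
  next
    case (insert e F)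
    have notin: "g e \<notin> span (A \<union> g ` F)"
    proof
      assume "g e \<in> span (A \<union> g ` F)"
      then obtain x y where xy: "g e = x + y" "x \<in> span A" "y \<in> span (g ` F)"
        unfolding span_Un by blast
      then obtain v where v: "v \<in> span F" "y = g v" using g.span_image by auto
      have Fe: "F \<subseteq> span A" "e \<in> span A" using V insert.prems by auto
      then have "v \<in> span A" using v(1) span_minimal[OF Fe(1) subspace_span] by (meson subsetD)
      then have ev: "e - v \<in> span A" using Fe(2) span_diff by blast
      moreover have "g (e - v) = x" using xy v by (simp add: g.diff)
      ultimately have "e - v \<in> span D" using D xy(2) by simp
      then have "e - v \<in> span (D \<union> F)" "v \<in> span (D \<union> F)"
        using v(1) span_mono[of D "D \<union> F"] span_mono[of F "D \<union> F"] by auto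
      then have "(e - v) + v \<in> span (D \<union> F)" by (rule span_add)
      then have "e \<in> span (D \<union> F)" by simp
      moreover have "D \<union> F \<subseteq> (D \<union> E) - {e}" using insert indDE(2) by auto
      ultimately have "e \<in> span ((D \<union> E) - {e})" using span_mono by blast
      then show False using indDE(1) insert.prems unfolding dependent_def by auto
    qed
    have IH: "independent (A \<union> g ` F)" "inj_on g F" "A \<inter> g ` F = {}" using insert by auto
    have "independent (insert (g e) (A \<union> g ` F))" using notin IH(1) by (rule independent_insertI)
    moreover have "g e \<notin> A \<union> g ` F" using notin span_base[of "g e" "A \<union> g ` F"] by metis
    ultimately show ?case using IH insert.hyps(2) by auto
  qed
  then show ?thesis using E by blast
qed

text \<open>\<open>f\<close> is injective on \<open>span S\<close>, so this span meets the kernel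
  only in 0, and subtracting a suitable vector of \<open>span S\<close> from a vector of W leaves a
  kernel vector. This is rank-nullity in the form of an explicit basis, as the lifted Jordan chains
  require.\<close>

lemma kernel_image_basis:
  assumes lin: "Vector_Spaces.linear scale scale f" and W: "subspace W" "S \<subseteq> W"
    and S: "inj_on f S" "independent (f ` S)" "f ` W \<subseteq> span (f ` S)"
    and C: "finite C" "independent C" "C \<subseteq> {v \<in> W. f v = 0}" "{v \<in> W. f v = 0} \<subseteq> span C"
  shows "independent (S \<union> C) \<and> S \<inter> C = {} \<and> span (S \<union> C) = W"
proof -
  interpret f: Vector_Spaces.linear scale scale f by fact
  have inj: "inj_on f (span S)" using S(1,2) f.inj_on_span_iff_independent_image by blast
  have indS: "independent S"
  proof
    assume "dependent S"
    then obtain b where b: "b \<in> S" "b \<in> span (S - {b})" unfolding dependent_def by blast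
    then have "f b \<in> span (f ` (S - {b}))" using f.span_image by blast
    moreover have "f ` (S - {b}) = f ` S - {f b}" using S(1) b(1) unfolding inj_on_def by auto
    ultimately show False using S(2) b(1) unfolding dependent_def by auto
  qed
  have ind: "F \<subseteq> C \<Longrightarrow> independent (S \<union> F)" if "finite F" for F
    using that
  proof (induction F rule: finite_induct)
    case empty
    then show ?case using indS by simp
  next
    case (insert c F)
    have "c \<notin> span (S \<union> F)"
    proof
      assume "c \<in> span (S \<union> F)"
      then obtain x y where xy: "c = x + y" "x \<in> span S" "y \<in> span F"
        unfolding span_Un by blast
      have "f c = 0" using insert.prems C(3) by auto
      moreover have "f y = 0"
        using f.eq_0_on_span[OF _ xy(3)] insert.prems C(3) by blast
      ultimately have "f x = 0" using xy(1) f.add by simp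
      then have "x = 0" using inj xy(2) span_zero unfolding inj_on_def by (metis f.zero)
      then have "c \<in> span F" using xy by simp
      moreover have "F \<subseteq> C - {c}" using insert by auto
      ultimately have "c \<in> span (C - {c})" using span_mono[of F "C - {c}"] by (meson subsetD)
      then show False using C(2) insert.prems unfolding dependent_def by auto
    qed
    then show ?case using insert by (simp add: independent_insertI)
  qed
  have "S \<inter> C = {}"
  proof (rule ccontr)
    assume "S \<inter> C \<noteq> {}"
    then obtain x where "x \<in> S" "f x = 0" using C(3) by auto
    then have "0 \<in> f ` S" by force
    then show False using S(2) dependent_zero by blast
  qed
  moreover have "span (S \<union> C) = W"
  proof (rule span_subspace)
    show "S \<union> C \<subseteq> W" using W C by auto
    show "subspace W" by fact
    show "W \<subseteq> span (S \<union> C)"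
    proof
      fix w assume w: "w \<in> W"
      then have "f w \<in> f ` span S" using S(3) f.span_image by auto
      then obtain v where v: "v \<in> span S" "f w = f v" by auto
      then have "v \<in> W" using W span_minimal by blast
      then have "w - v \<in> {v \<in> W. f v = 0}" using w v W by (simp add: f.diff subspace_diff)
      then have "w - v \<in> span C" using C(4) by blast
      then have "(w - v) + v \<in> span (S \<union> C)"
        using v span_mono[of S "S \<union> C"] span_mono[of C "S \<union> C"] by (intro span_add) auto
      then show "w \<in> span (S \<union> C)" by simp
    qed
  qed
  ultimately show ?thesis using ind C(1) by blast
qed

text \<open>Write p(g) v for \<open>ev p v\<close>. Minimality runs over polynomials and vectors
  together: p has least degree among the nonzero polynomials for which p(g) kills some nonzero
  vector, so splitting off a linear factor leaves a nonzero vector q(g) v, and this is an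
  eigenvector.\<close>

lemma exists_eigenvector:
  assumes alg: "alg_closed_field TYPE('a)" and lin: "Vector_Spaces.linear scale scale g"
    and W: "finite B" "g ` span B \<subseteq> span B" and w: "w \<in> span B" "w \<noteq> 0"
  obtains e v where "v \<in> span B" "v \<noteq> 0" "g v = scale e v"
proof -
  interpret g: Vector_Spaces.linear scale scale g by fact
  define ev where "ev p v = (\<Sum>i\<le>degree p. scale (coeff p i) ((g ^^ i) v))" for p :: "'a poly" and v
  have ev_bound: "ev p v = (\<Sum>i\<le>n. scale (coeff p i) ((g ^^ i) v))" if "degree p \<le> n" for p v n
    unfolding ev_def using that by (intro sum.mono_neutral_left) (auto simp: coeff_eq_0)
  have pw: "(g ^^ i) v \<in> span B" if "v \<in> span B" for i v
    using that W(2) by (induction i) auto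
  have evW: "ev p v \<in> span B" if "v \<in> span B" for p v
    unfolding ev_def by (intro span_sum span_scale pw that)
  have ev_lin: "ev ([:-e, 1:] * q) v = g (ev q v) - scale e (ev q v)" for e q v
  proof -
    define n where "n = degree q"
    have "[:-e, 1:] * q = pCons 0 q - smult e q" by simp
    then have cf: "coeff ([:-e, 1:] * q) i = coeff (pCons 0 q) i - e * coeff q i" for i
      by (simp del: mult_pCons_left)
    have "degree ([:-e, 1:] * q) \<le> Suc n" unfolding n_def
      using degree_mult_le[of "[:-e, 1:]" q] by simp
    then have "ev ([:-e, 1:] * q) v = (\<Sum>i\<le>Suc n. scale (coeff (pCons 0 q) i - e * coeff q i) ((g ^^ i) v))"
      using ev_bound cf by simp
    also have "\<dots> = (\<Sum>i\<le>Suc n. scale (coeff (pCons 0 q) i) ((g ^^ i) v)) - (\<Sum>i\<le>Suc n. scale (e * coeff q i) ((g ^^ i) v))"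
      by (simp only: scale_left_diff_distrib sum_subtractf)
    also have "(\<Sum>i\<le>Suc n. scale (coeff (pCons 0 q) i) ((g ^^ i) v)) = (\<Sum>i\<le>n. scale (coeff q i) ((g ^^ Suc i) v))"
      by (subst sum.atMost_Suc_shift) simp
    also have "\<dots> = g (ev q v)" unfolding ev_def n_def by (simp add: g.sum g.scale)
    also have "(\<Sum>i\<le>Suc n. scale (e * coeff q i) ((g ^^ i) v)) = scale e (ev q v)"
      using ev_bound[of q "Suc n" v] by (simp add: n_def scale_sum_right del: sum.atMost_Suc)
    finally show ?thesis .
  qed
  \<comment> \<open>Dependence is a property of the set of iterates, so a repeated iterate is
    treated separately, with annihilator X^i - X^j.\<close>
  have "\<exists>p. p \<noteq> 0 \<and> ev p w = 0"
  proof (cases "inj_on (\<lambda>i. (g ^^ i) w) {..card B}")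
    case True
    let ?S = "(\<lambda>i. (g ^^ i) w) ` {..card B}"
    have "card ?S = Suc (card B)" using True by (simp add: card_image)
    moreover have "?S \<subseteq> span B" using pw w by auto
    ultimately have "dependent ?S" using independent_span_bound[OF W(1), of ?S] by auto
    then obtain u v where uv: "(\<Sum>v\<in>?S. scale (u v) v) = 0" "v \<in> ?S" "u v \<noteq> 0"
      using dependent_finite by blast
    define p where "p = Poly (map (\<lambda>i. u ((g ^^ i) w)) [0..<Suc (card B)])"
    have cp: "coeff p i = u ((g ^^ i) w)" if "i \<le> card B" for i
      using that unfolding p_def by (simp add: coeff_Poly_eq nth_default_def del: upt_Suc)
    have "degree p \<le> card B"
      by (rule degree_le) (simp add: p_def coeff_Poly_eq nth_default_def del: upt_Suc)
    then have "ev p w = (\<Sum>i\<le>card B. scale (coeff p i) ((g ^^ i) w))" by (rule ev_bound)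
    also have "\<dots> = (\<Sum>v\<in>?S. scale (u v) v)" using True cp by (simp add: sum.reindex)
    finally have "ev p w = 0" using uv by simp
    moreover have "p \<noteq> 0" using uv cp by force
    ultimately show ?thesis by blast
  next
    case False
    then obtain i j where ij: "i \<noteq> j" "(g ^^ i) w = (g ^^ j) w" unfolding inj_on_def by blast
    define p where "p = monom (1::'a) i - monom 1 j"
    have cp: "coeff p l = (if l = i then 1 else 0) - (if l = j then 1 else 0)" for l unfolding p_def by simp
    have "p \<noteq> 0" using cp[of i] ij(1) by auto
    moreover have "degree p \<le> max i j" unfolding p_def
      by (meson degree_diff_le degree_monom_le max.cobounded1 max.cobounded2 order_trans)
    then have "ev p w = (\<Sum>l\<le>max i j. scale (coeff p l) ((g ^^ l) w))" by (rule ev_bound)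
    then have "ev p w = (\<Sum>l\<le>max i j. (if l = i then (g ^^ l) w else 0)) - (\<Sum>l\<le>max i j. (if l = j then (g ^^ l) w else 0))"
      unfolding cp scale_left_diff_distrib sum_subtractf by (simp add: if_distrib[of "\<lambda>x. scale x _"] cong: if_cong)
    then have "ev p w = 0" using ij by simp
    ultimately show ?thesis by blast
  qed
  then have "\<exists>n p v. degree p = n \<and> p \<noteq> 0 \<and> v \<in> span B \<and> v \<noteq> 0 \<and> ev p v = 0" using w by blast
  then obtain n where n: "\<exists>p v. degree p = n \<and> p \<noteq> 0 \<and> v \<in> span B \<and> v \<noteq> 0 \<and> ev p v = 0"
    and min: "\<And>m. m < n \<Longrightarrow> \<not> (\<exists>p v. degree p = m \<and> p \<noteq> 0 \<and> v \<in> span B \<and> v \<noteq> 0 \<and> ev p v = 0)"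
    by (subst (asm) exists_least_iff) blast
  from n obtain p v where p: "degree p = n" "p \<noteq> 0" "v \<in> span B" "v \<noteq> 0" "ev p v = 0" by blast
  have "degree p \<ge> 1"
  proof (rule ccontr)
    assume "\<not> ?thesis"
    then have d0: "degree p = 0" by simp
    then have "ev p v = scale (coeff p 0) v" unfolding ev_def by simp
    moreover have "coeff p 0 \<noteq> 0" using p(2) d0 leading_coeff_neq_0 by metis
    ultimately show False using p by simp
  qed
  then obtain e where "poly p e = 0" using alg unfolding alg_closed_field_def by blast
  then obtain q where q: "p = [:-e, 1:] * q" using poly_eq_0_iff_dvd by blast
  have "q \<noteq> 0" using q p(2) by auto
  then have "degree q < n" using q p(1) by (simp add: degree_mult_eq del: mult_pCons_left)
  then have "ev q v \<noteq> 0" using min \<open>q \<noteq> 0\<close> p by blast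
  moreover have "g (ev q v) = scale e (ev q v)" using p(5) q ev_lin by simp
  ultimately show ?thesis using that evW p(3) by blast
qed

end

section \<open>Kronecker chains\<close>

text \<open>A pair \<open>(Some e, ws)\<close> encodes a Jordan chain with eigenvalue \<open>e\<close>, a pair \<open>(None, ws)\<close> a scroll chain, whose last
  vector lies outside the domain of \<open>g\<close>.\<close>

definition chain_dom :: "'a option \<times> 'b list \<Rightarrow> 'b list" where
  "chain_dom b = (case fst b of None \<Rightarrow> butlast (snd b) | Some e \<Rightarrow> snd b)"

definition is_chain :: "('a::field \<Rightarrow> 'b::ab_group_add \<Rightarrow> 'b) \<Rightarrow> ('b \<Rightarrow> 'b) \<Rightarrow> 'a option \<times> 'b list \<Rightarrow> bool" where
  "is_chain scale g b \<longleftrightarrow> snd b \<noteq> [] \<and>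
     (case fst b of
        None \<Rightarrow> \<forall>s. Suc s < length (snd b) \<longrightarrow> g (snd b ! s) = snd b ! Suc s
      | Some e \<Rightarrow> \<forall>s < length (snd b).
          g (snd b ! s) = (if Suc s < length (snd b) then snd b ! Suc s else 0) + scale e (snd b ! s))"

definition list_basis :: "('a::field \<Rightarrow> 'b::ab_group_add \<Rightarrow> 'b) \<Rightarrow> 'b list \<Rightarrow> 'b set \<Rightarrow> bool" where
  "list_basis scale xs W \<longleftrightarrow> distinct xs \<and> \<not> module.dependent scale (set xs) \<and> module.span scale (set xs) = W"

definition chain_ends :: "('a option \<times> 'b list) list \<Rightarrow> 'b list" where
  "chain_ends bs = map (\<lambda>b. last (snd b)) (filter (\<lambda>b. fst b = None) bs)"

context vector_space
begin

text \<open>The ends are interspersed between the domains in the concatenated list; multisets ignore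
  this order and still control distinctness and length.\<close>

lemma mset_chains:
  assumes "\<forall>b\<in>set bs. snd b \<noteq> []"
  shows "mset (concat (map snd bs)) = mset (concat (map chain_dom bs)) + mset (chain_ends bs)"
  using assms
proof (induction bs)
  case Nil
  then show ?case by (simp add: chain_ends_def)
next
  case (Cons b bs)
  have IH: "mset (concat (map snd bs)) = mset (concat (map chain_dom bs)) + mset (chain_ends bs)"
    using Cons by simp
  show ?case
  proof (cases "fst b")
    case None
    have "mset (snd b) = mset (butlast (snd b) @ [last (snd b)])" using Cons.prems by simp
    then have "mset (snd b) = mset (butlast (snd b)) + {#last (snd b)#}" by (metis mset_append mset_single_iff_right mset.simps)
    moreover have "chain_dom b = butlast (snd b)" using None by (simp add: chain_dom_def)
    ultimately show ?thesis using IH None by (simp add: chain_ends_def)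
  next
    case (Some e)
    then have "chain_dom b = snd b" by (simp add: chain_dom_def)
    then show ?thesis using IH Some by (simp add: chain_ends_def)
  qed
qed

lemma distinct_append_iff_mset:
  assumes "mset xs = mset ys + mset zs"
  shows "distinct xs \<longleftrightarrow> distinct (ys @ zs)" "set xs = set ys \<union> set zs" "length xs = length ys + length zs"
proof -
  have e: "mset xs = mset (ys @ zs)" using assms by simp
  show "distinct xs \<longleftrightarrow> distinct (ys @ zs)" using e mset_eq_imp_distinct_iff by blast
  show "set xs = set ys \<union> set zs" using e by (metis mset_eq_setD set_append)
  show "length xs = length ys + length zs" using e by (metis mset_eq_length length_append)
qed

text \<open>Each scroll chain of the smaller problem on \<open>V' = {v \<in> V. g v \<in> V}\<close> is prolonged by one
  vector; \<open>g\<close> is injective from \<open>V / V'\<close> to \<open>W / V\<close>, so the new vectors stay independent modulo \<open>V\<close>.\<close>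

lemma chains_extend_domain:
  assumes lin: "Vector_Spaces.linear scale scale g"
    and W: "finite B" "span B = W"
    and V: "V \<subseteq> W" "g ` V \<subseteq> W"
    and bs: "\<forall>b\<in>set bs. is_chain scale g b" "list_basis scale (concat (map snd bs)) V"
      "span (set (concat (map chain_dom bs))) = {v \<in> V. g v \<in> V}"
  shows "\<exists>bs. (\<forall>b\<in>set bs. is_chain scale g b) \<and> list_basis scale (concat (map snd bs)) W \<and>
    span (set (concat (map chain_dom bs))) = V"
proof -
  define A where "A = concat (map snd bs)"
  define D where "D = concat (map chain_dom bs)"
  define E where "E = chain_ends bs"
  have ne: "\<forall>b\<in>set bs. snd b \<noteq> []" using bs(1) unfolding is_chain_def by auto
  have mA: "mset A = mset D + mset E" unfolding A_def D_def E_def using ne by (rule mset_chains)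
  have A: "distinct A" "independent (set A)" "span (set A) = V"
    using bs(2) unfolding A_def list_basis_def by auto
  note AD = distinct_append_iff_mset[OF mA]
  have AV: "set A \<subseteq> V" using A(3) span_superset by metis
  have key: "independent (set A \<union> g ` set E) \<and> inj_on g (set E) \<and> set A \<inter> g ` set E = {}"
  proof (rule independent_Un_image[OF lin A(2), of "set E" "set D"])
    show "independent (set D \<union> set E)" using A(2) AD(2) by simp
    show "set D \<inter> set E = {}" using A(1) AD(1) by simp
    show "set D \<union> set E \<subseteq> span (set A)" using AV A(3) AD(2) by simp
    show "v \<in> span (set D)" if "v \<in> span (set A)" "g v \<in> span (set A)" for v
      using that A(3) bs(3) D_def by auto
  qed simp
  have "set E \<subseteq> V" using AV AD(2) by auto
  then have sub: "set A \<union> g ` set E \<subseteq> W" using AV V by blast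
  obtain C where C: "set A \<union> g ` set E \<subseteq> C" "C \<subseteq> W" "independent C" "W \<subseteq> span C"
    using maximal_independent_subset_extend[OF sub] key by blast
  have finC: "finite C" using independent_span_bound[OF W(1) C(3)] C(2) W(2) by simp
  obtain R where R: "set R = C - (set A \<union> g ` set E)" "distinct R"
    using finite_distinct_list[of "C - (set A \<union> g ` set E)"] finC by auto
  define ext where "ext b = (fst b, if fst b = None then snd b @ [g (last (snd b))] else snd b)"
    for b :: "'a option \<times> 'b list"
  \<comment> \<open>The vectors of R, which complete the basis of W, become scroll chains of length
    one: they have empty domain and give no column.\<close>
  define bs' where "bs' = map ext bs @ map (\<lambda>w. (None, [w])) R"
  have "mset (concat (map snd (map ext bs))) = mset A + mset (map g E)"
    unfolding A_def E_def chain_ends_def ext_def by (induction bs) auto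
  moreover have "concat (map snd (map (\<lambda>w. (None :: 'a option, [w])) R)) = R" by (induction R) auto
  ultimately have m: "mset (concat (map snd bs')) = mset (A @ map g E) + mset R"
    unfolding bs'_def map_append concat_append mset_append by simp
  have "distinct (A @ map g E)" using A(1) AD(1) key by (auto simp: distinct_map)
  then have dist: "distinct (concat (map snd bs'))"
    using distinct_append_iff_mset(1)[OF m] R by auto
  have set: "set (concat (map snd bs')) = C"
    unfolding distinct_append_iff_mset(2)[OF m] using R C(1) by auto
  have "span C = W" using C(2-4) W(2) by (metis span_subspace subspace_span)
  then have basis: "list_basis scale (concat (map snd bs')) W"
    unfolding list_basis_def using dist set C(3) by simp
  have "chain_dom (ext b) = snd b" if "b \<in> set bs" for b
    using that unfolding chain_dom_def ext_def by (auto split: option.splits)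
  then have "concat (map chain_dom (map ext bs)) = A" unfolding A_def
    by (metis (no_types, lifting) list.map_comp map_cong comp_apply)
  moreover have "concat (map chain_dom (map (\<lambda>w. (None, [w])) R)) = []"
    by (induction R) (auto simp: chain_dom_def)
  ultimately have dom: "concat (map chain_dom bs') = A" unfolding bs'_def map_append concat_append by simp
  have "is_chain scale g (ext b)" if b: "b \<in> set bs" for b
  proof (cases "fst b")
    case None
    have "snd b \<noteq> []" using ne b by blast
    moreover have "g ((snd b @ [g (last (snd b))]) ! s) = (snd b @ [g (last (snd b))]) ! Suc s"
      if s: "Suc s < length (snd b @ [g (last (snd b))])" for s
    proof (cases "Suc s < length (snd b)")
      case True
      then show ?thesis using bs(1) b None unfolding is_chain_def by (auto simp: nth_append)
    next
      case False
      then have "s = length (snd b) - 1" "Suc s = length (snd b)" using s \<open>snd b \<noteq> []\<close> by auto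
      then show ?thesis using \<open>snd b \<noteq> []\<close> by (simp add: nth_append last_conv_nth)
    qed
    ultimately show ?thesis using None unfolding is_chain_def ext_def by simp
  next
    case (Some e)
    then show ?thesis using bs(1) b unfolding ext_def by (metis option.distinct(1) prod.collapse)
  qed
  moreover have "is_chain scale g (None, [w])" for w unfolding is_chain_def by simp
  ultimately have "\<forall>b\<in>set bs'. is_chain scale g b" unfolding bs'_def by auto
  then show ?thesis using basis dom A(3) by metis
qed

text \<open>On such a chain \<open>g - e\<close> is triangular with nonzero diagonal
  \<open>e' - e\<close>; the induction runs backwards from the last vector. Chains of the other
  eigenvalues thus lie in the span of their own image and pass unchanged to the larger
  space.\<close>

lemma Jordan_chain_span:
  assumes lin: "Vector_Spaces.linear scale scale g"
    and ch: "is_chain scale g (Some e', ws)" and e: "e' \<noteq> e"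
  shows "set ws \<subseteq> span ((\<lambda>v. g v - scale e v) ` set ws)"
proof -
  let ?N = "\<lambda>v. g v - scale e v"
  have g: "g (ws ! s) = (if Suc s < length ws then ws ! Suc s else 0) + scale e' (ws ! s)" if "s < length ws" for s
    using ch that unfolding is_chain_def by simp
  have "\<forall>s. s < length ws \<longrightarrow> length ws - Suc s = n \<longrightarrow> ws ! s \<in> span (?N ` set ws)" for n
  proof (induction n rule: less_induct)
    case (less n)
    show ?case
    proof (intro allI impI)
      fix s assume s: "s < length ws" "length ws - Suc s = n"
      define x where "x = (if Suc s < length ws then ws ! Suc s else 0)"
      have "x \<in> span (?N ` set ws)"
        unfolding x_def using less.IH[of "length ws - Suc (Suc s)"] s by (auto simp: span_zero)
      moreover have "?N (ws ! s) \<in> span (?N ` set ws)" using s by (intro span_base) simp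
      ultimately have "scale (inverse (e' - e)) (?N (ws ! s) - x) \<in> span (?N ` set ws)"
        by (blast intro: span_scale span_diff[where y = x])
      moreover have "?N (ws ! s) - x = scale (e' - e) (ws ! s)"
        using g[OF s(1)] unfolding x_def by (simp add: scale_left_diff_distrib)
      ultimately show "ws ! s \<in> span (?N ` set ws)" using e by simp
    qed
  qed
  then show ?thesis by (auto simp: in_set_conv_nth)
qed

text \<open>The \<open>e\<close>-chains of \<open>(g - e) W\<close> are prolonged at the front by preimages under \<open>g - e\<close>, and their
  last vectors are completed to a basis of the eigenspace.\<close>

lemma Jordan_chains_step:
  assumes lin: "Vector_Spaces.linear scale scale g"
    and W: "finite B" "span B = W" "g ` W \<subseteq> W"
    and bs: "\<forall>b\<in>set bs. is_chain scale g b \<and> fst b \<noteq> None" 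
      "list_basis scale (concat (map snd bs)) ((\<lambda>v. g v - scale e v) ` W)"
  shows "\<exists>bs. (\<forall>b\<in>set bs. is_chain scale g b \<and> fst b \<noteq> None) \<and> list_basis scale (concat (map snd bs)) W"
proof -
  define N where "N v = g v - scale e v" for v
  interpret g: Vector_Spaces.linear scale scale g by fact
  have linN: "Vector_Spaces.linear scale scale N"
    unfolding N_def by unfold_locales (simp_all add: g.add g.scale scale_right_distrib scale_right_diff_distrib scale_left_commute)
  interpret N: Vector_Spaces.linear scale scale N by fact
  have subW: "subspace W" using W(2) subspace_span by blast
  have NW: "N ` W \<subseteq> W" unfolding N_def using W(3) subW by (auto intro!: subspace_diff subspace_scale)
  define es where "es = filter (\<lambda>b. fst b = Some e) bs"
  define os where "os = filter (\<lambda>b. fst b \<noteq> Some e) bs"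
  define A where "A = concat (map snd es)"
  define Y where "Y = concat (map snd os)"
  define B0 where "B0 = concat (map snd bs)"
  have mB0: "mset B0 = mset A + mset Y"
    unfolding B0_def A_def Y_def es_def os_def by (induction bs) auto
  note B0D = distinct_append_iff_mset[OF mB0]
  have B0: "distinct B0" "independent (set B0)" "span (set B0) = N ` W"
    using bs(2) unfolding B0_def list_basis_def N_def by auto
  have B0W: "set B0 \<subseteq> N ` W" using B0(3) span_superset by metis
  have es: "is_chain scale g (Some e, snd b)" "snd b \<noteq> []" "set (snd b) \<subseteq> set A" if "b \<in> set es" for b
    using that bs(1) unfolding es_def A_def is_chain_def by auto
  have Nes: "N (snd b ! s) = (if Suc s < length (snd b) then snd b ! Suc s else 0)"
    if "b \<in> set es" "s < length (snd b)" for b s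
    using es(1)[OF that(1)] that(2) unfolding is_chain_def N_def by simp
  have "\<forall>b\<in>set es. \<exists>w\<in>W. N w = hd (snd b)"
  proof
    fix b assume "b \<in> set es"
    then have "hd (snd b) \<in> set B0" using es(2,3) B0D(2) hd_in_set by blast
    then show "\<exists>w\<in>W. N w = hd (snd b)" using B0W by fastforce
  qed
  then obtain w0 where w0: "\<And>b. b \<in> set es \<Longrightarrow> w0 b \<in> W" "\<And>b. b \<in> set es \<Longrightarrow> N (w0 b) = hd (snd b)"
    by metis
  define A1 where "A1 = concat (map (\<lambda>b. w0 b # butlast (snd b)) es)"
  define L where "L = map (\<lambda>b. last (snd b)) es"
  have "map N (w0 b # butlast (snd b)) = snd b" if b: "b \<in> set es" for b
  proof (rule nth_equalityI)
    show "length (map N (w0 b # butlast (snd b))) = length (snd b)" using es(2)[OF b] by simp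
    fix i assume "i < length (map N (w0 b # butlast (snd b)))"
    then have i: "i < length (snd b)" using es(2)[OF b] by simp
    show "map N (w0 b # butlast (snd b)) ! i = snd b ! i"
    proof (cases i)
      case 0
      then show ?thesis using w0(2)[OF b] es(2)[OF b] by (simp add: hd_conv_nth)
    next
      case (Suc j)
      then show ?thesis using i Nes[OF b, of j] by (simp add: nth_butlast)
    qed
  qed
  then have NA1: "map N A1 = A" unfolding A1_def A_def map_concat
    by (simp add: comp_def cong: map_cong)
  have Yspan: "set Y \<subseteq> span (N ` set Y)"
  proof
    fix y assume "y \<in> set Y"
    then obtain b where b: "b \<in> set os" "y \<in> set (snd b)" unfolding Y_def by auto
    then have "b \<in> set bs" "fst b \<noteq> Some e" unfolding os_def by auto
    then obtain e' where e': "fst b = Some e'" "e' \<noteq> e" "is_chain scale g (Some e', snd b)"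
      using bs(1) by (metis option.exhaust prod.collapse)
    have "y \<in> span (N ` set (snd b))"
      using Jordan_chain_span[OF lin e'(3,2)] b(2) unfolding N_def by blast
    moreover have "N ` set (snd b) \<subseteq> N ` set Y" using b unfolding Y_def by auto
    ultimately show "y \<in> span (N ` set Y)" using span_mono[of "N ` set (snd b)" "N ` set Y"] by (meson subsetD)
  qed
  define S where "S = set A1 \<union> set Y"
  have NS: "N ` S = set A \<union> N ` set Y" unfolding S_def NA1[symmetric] by auto
  have B0NS: "set B0 \<subseteq> span (N ` S)"
    unfolding NS B0D(2) using Yspan span_mono[of "N ` set Y" "set A \<union> N ` set Y"] span_superset[of "set A \<union> N ` set Y"] by auto
  have finS: "finite S" unfolding S_def by simp
  \<comment> \<open>The cardinalities close up: \<open>card (set B0)\<close> is at most that of the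
    image of S under N, which is at most \<open>card S\<close>, which is at most the combined length
    of \<open>A1\<close> and \<open>Y\<close>, which equals \<open>card (set B0)\<close>. Equality
    throughout yields injectivity of N on S, independence of the image and distinctness of the
    lifted list at once.\<close>
  have "card (set B0) \<le> card (N ` S)"
    using independent_span_bound[OF _ B0(2) B0NS] finS by simp
  moreover have cS: "card S \<le> length A1 + length Y" unfolding S_def
    using card_Un_le[of "set A1" "set Y"] card_length[of A1] card_length[of Y] by linarith
  moreover have "length A1 = length A" using NA1 by (metis length_map)
  moreover have "card (set B0) = length A + length Y" using B0(1) B0D(3) by (simp add: distinct_card)
  moreover have "card (N ` S) \<le> card S" using card_image_le[OF finS] .
  ultimately have cards: "card (N ` S) = card S" "card S = length (A1 @ Y)" "card (N ` S) \<le> card (set B0)" by auto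
  have injS: "inj_on N S" using cards(1) finS by (simp add: eq_card_imp_inj_on)
  have indS: "independent (N ` S)"
    using spanning_card_independent[OF _ B0(2) B0NS cards(3)] finS by simp
  have distS: "distinct (A1 @ Y)" using cards(2) unfolding S_def by (intro card_distinct) simp
  have SW: "S \<subseteq> W"
  proof -
    have "set B0 \<subseteq> W" using B0W NW by (rule order_trans)
    then have "set A \<subseteq> W" unfolding B0D(2) by simp
    then have "set (butlast (snd b)) \<subseteq> W" if "b \<in> set es" for b
      using es(3)[OF that] by (auto dest: in_set_butlastD)
    then have "set A1 \<subseteq> W" unfolding A1_def using w0(1) by auto
    moreover have "set Y \<subseteq> W" using B0D(2) B0W NW by auto
    ultimately show ?thesis unfolding S_def by simp
  qed
  define K where "K = {v \<in> W. N v = 0}"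
  have subK: "subspace K" unfolding K_def
    using subspace_inter[OF subW N.subspace_kernel] by (simp add: Int_def)
  have mA: "mset A = mset (concat (map (\<lambda>b. butlast (snd b)) es)) + mset L"
  proof -
    have "\<forall>b\<in>set es. snd b \<noteq> []" using es(2) by blast
    then show ?thesis unfolding A_def L_def
    proof (induction es)
      case (Cons b es)
      have "mset (snd b) = mset (butlast (snd b) @ [last (snd b)])" using Cons.prems by simp
      then have "mset (snd b) = mset (butlast (snd b)) + {#last (snd b)#}"
        by (simp only: mset_append mset.simps add_mset_add_single[symmetric])
      then show ?case using Cons by simp
    qed simp
  qed
  have LK: "set L \<subseteq> K"
  proof
    fix x assume "x \<in> set L"
    then obtain b where b: "b \<in> set es" "x = last (snd b)" unfolding L_def by auto
    then have "N x = 0" using Nes[OF b(1), of "length (snd b) - 1"] es(2)[OF b(1)] by (simp add: last_conv_nth)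
    moreover have "x \<in> set A" using b es(2,3) last_in_set by blast
    ultimately show "x \<in> K" unfolding K_def using B0D(2) B0W NW by auto
  qed
  have "distinct A" using B0(1) B0D(1) by simp
  then have distL: "distinct L" using distinct_append_iff_mset(1)[OF mA] by simp
  have "set L \<subseteq> set B0" using distinct_append_iff_mset(2)[OF mA] B0D(2) by auto
  then have "independent (set L)" using B0(2) independent_mono by blast
  then obtain C where C: "set L \<subseteq> C" "C \<subseteq> K" "independent C" "K \<subseteq> span C"
    using maximal_independent_subset_extend[OF LK] by blast
  have finC: "finite C" using independent_span_bound[OF W(1) C(3)] C(2) W(2) unfolding K_def by auto
  obtain Z where Z: "set Z = C - set L" "distinct Z"
    using finite_distinct_list[of "C - set L"] finC by auto
  have fin: "independent (S \<union> C) \<and> S \<inter> C = {} \<and> span (S \<union> C) = W"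
  proof (rule kernel_image_basis[OF linN subW SW injS indS])
    show "N ` W \<subseteq> span (N ` S)" using B0NS B0(3) span_minimal[OF _ subspace_span] by metis
  qed (use finC C K_def in auto)
  define bs' where "bs' = map (\<lambda>b. (Some e, w0 b # snd b)) es @ os @ map (\<lambda>z. (Some e, [z])) Z"
  have "mset (concat (map (\<lambda>b. w0 b # snd b) es)) = mset A1 + mset L"
  proof -
    have "\<forall>b\<in>set es. snd b \<noteq> []" using es(2) by blast
    then show ?thesis unfolding A1_def L_def
    proof (induction es)
      case (Cons b es)
      have "mset (snd b) = mset (butlast (snd b) @ [last (snd b)])" using Cons.prems by simp
      then have "mset (snd b) = mset (butlast (snd b)) + {#last (snd b)#}"
        by (simp only: mset_append mset.simps add_mset_add_single[symmetric])
      then show ?case using Cons by simp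
    qed simp
  qed
  moreover have "concat (map snd (map (\<lambda>z. (Some e, [z])) Z)) = Z" by (induction Z) auto
  ultimately have m: "mset (concat (map snd bs')) = mset (A1 @ Y) + mset (L @ Z)"
    unfolding bs'_def map_append concat_append mset_append Y_def by (simp add: comp_def)
  have LZ: "set (L @ Z) = C" "distinct (L @ Z)" using Z C(1) distL by auto
  have "set (concat (map snd bs')) = S \<union> C"
    unfolding distinct_append_iff_mset(2)[OF m] LZ(1) S_def by simp
  moreover have "distinct (concat (map snd bs'))"
    unfolding distinct_append_iff_mset(1)[OF m] using distS LZ fin unfolding S_def by auto
  ultimately have basis: "list_basis scale (concat (map snd bs')) W" unfolding list_basis_def using fin by simp
  have "is_chain scale g (Some e, w0 b # snd b)" if b: "b \<in> set es" for b
  proof -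
    have "g ((w0 b # snd b) ! s) = (if Suc s < length (w0 b # snd b) then (w0 b # snd b) ! Suc s else 0)
        + scale e ((w0 b # snd b) ! s)" if s: "s < length (w0 b # snd b)" for s
    proof (cases s)
      case 0
      have "g (w0 b) = hd (snd b) + scale e (w0 b)" using w0(2)[OF b] unfolding N_def by (simp add: algebra_simps)
      then show ?thesis using 0 es(2)[OF b] by (simp add: hd_conv_nth)
    next
      case (Suc j)
      then show ?thesis using es(1)[OF b] s unfolding is_chain_def by auto
    qed
    then show ?thesis unfolding is_chain_def by simp
  qed
  moreover have "is_chain scale g (Some e, [z])" if "z \<in> set Z" for z
  proof -
    have "N z = 0" using that Z C(2) unfolding K_def by auto
    then show ?thesis unfolding is_chain_def N_def by simp
  qed
  ultimately have "\<forall>b\<in>set bs'. is_chain scale g b \<and> fst b \<noteq> None"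
    unfolding bs'_def using bs(1) unfolding os_def by auto
  then show ?thesis using basis by blast
qed

text \<open>The end of a scroll chain is independent of all domain vectors, so it cannot lie in
  their span.\<close>

lemma no_ends_if_full:
  assumes "\<forall>b\<in>set bs. snd b \<noteq> []" "list_basis scale (concat (map snd bs)) W"
    and "span (set (concat (map chain_dom bs))) = W"
  shows "\<forall>b\<in>set bs. fst b \<noteq> None"
proof (rule ccontr)
  assume "\<not> ?thesis"
  then obtain b where b: "b \<in> set bs" "fst b = None" by blast
  define D where "D = concat (map chain_dom bs)"
  have m: "mset (concat (map snd bs)) = mset D + mset (chain_ends bs)"
    unfolding D_def using assms(1) by (rule mset_chains)
  note mD = distinct_append_iff_mset[OF m]
  define x where "x = last (snd b)"
  have x: "x \<in> set (chain_ends bs)" unfolding x_def chain_ends_def using b by auto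
  then have "x \<notin> set D" "x \<in> set (concat (map snd bs))"
    using assms(2) mD(1,2) unfolding list_basis_def by auto
  moreover have "x \<in> span (set D)"
    using assms(2,3) span_superset \<open>x \<in> set (concat (map snd bs))\<close> unfolding list_basis_def D_def by (metis subsetD)
  moreover have "set D \<subseteq> set (concat (map snd bs)) - {x}" using mD(2) \<open>x \<notin> set D\<close> by auto
  ultimately show False
    using assms(2) span_mono[of "set D" "set (concat (map snd bs)) - {x}"] unfolding list_basis_def dependent_def
    by (meson subsetD)
qed

text \<open>The pencil is \<open>f, g : V \<rightarrow> W\<close> with \<open>f\<close> injective, taken to be the inclusion of a subspace.\<close>

theorem chain_decomposition:
  assumes alg: "alg_closed_field TYPE('a)" and lin: "Vector_Spaces.linear scale scale g"
    and "finite B" "span B = W" "subspace V" "V \<subseteq> W" "g ` V \<subseteq> W"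
  shows "\<exists>bs. (\<forall>b\<in>set bs. is_chain scale g b) \<and> list_basis scale (concat (map snd bs)) W \<and>
    span (set (concat (map chain_dom bs))) = V"
  using assms(3-)
proof (induction "card B" arbitrary: B V W rule: less_induct)
  case less
  show ?case
  proof (cases "V = W")
    case False
    obtain C where C: "finite C" "independent C" "span C = V" "card C \<le> card B"
      using subspace_finite_basis[OF less.prems(1,3)] less.prems(2,4) by auto
    have "card C < card B"
    proof (rule ccontr)
      assume "\<not> ?thesis"
      then have "span C = span B" using independent_card_span[OF less.prems(1) C(2)] C(3) span_superset less.prems(2,4)
        by (metis linorder_not_less order_trans)
      then show False using False C(3) less.prems(2) by simp
    qed
    interpret g: Vector_Spaces.linear scale scale g by fact
    have sub: "subspace {v \<in> V. g v \<in> V}"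
      using subspace_inter[OF less.prems(3) g.subspace_linear_preimage[OF less.prems(3)]] by (simp add: Int_def)
    obtain bs where "\<forall>b\<in>set bs. is_chain scale g b" "list_basis scale (concat (map snd bs)) V"
      "span (set (concat (map chain_dom bs))) = {v \<in> V. g v \<in> V}"
      using less.hyps[OF \<open>card C < card B\<close> C(1,3) sub] by blast
    then show ?thesis using chains_extend_domain[OF lin less.prems(1,2,4,5)] by blast
  next
    case True
    show ?thesis
    proof (cases "W = {0}")
      case W0: True
      then show ?thesis using True by (intro exI[of _ "[]"]) (simp add: list_basis_def independent_empty)
    next
      case W0: False
      have "0 \<in> W" using less.prems(2) span_zero by metis
      then obtain w where w: "w \<in> span B" "w \<noteq> 0" using W0 less.prems(2) by auto
      have "g ` span B \<subseteq> span B" using less.prems(2,5) True by simp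
      from exists_eigenvector[OF alg lin less.prems(1) this w]
      obtain e v where ev: "v \<in> span B" "v \<noteq> 0" "g v = scale e v" by metis
      define N where "N v = g v - scale e v" for v
      interpret g: Vector_Spaces.linear scale scale g by fact
      have linN: "Vector_Spaces.linear scale scale N"
        unfolding N_def by unfold_locales (simp_all add: g.add g.scale scale_right_distrib scale_right_diff_distrib scale_left_commute)
      interpret N: Vector_Spaces.linear scale scale N by fact
      have subW: "subspace W" using less.prems(3) True by simp
      have gW: "g ` W \<subseteq> W" using less.prems(5) True by simp
      have NW: "N ` W \<subseteq> W" unfolding N_def using gW subW by (auto intro!: subspace_diff subspace_scale)
      have subNW: "subspace (N ` W)" using N.subspace_image[OF subW] .
      obtain C where C: "finite C" "independent C" "span C = N ` W" "card C \<le> card B"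
        using subspace_finite_basis[OF less.prems(1) subNW] less.prems(2) NW by auto
      have "card C < card B"
      proof (rule ccontr)
        assume "\<not> ?thesis"
        then have cc: "card B \<le> card C" by simp
        have spNB: "span (N ` B) = N ` W" using N.span_image less.prems(2) by simp
        then have CN: "C \<subseteq> span (N ` B)" using C(3) span_superset by metis
        have finNB: "finite (N ` B)" using less.prems(1) by simp
        have "card C \<le> card (N ` B)" using independent_span_bound[OF finNB C(2) CN] by simp
        moreover have "card (N ` B) \<le> card B" using card_image_le[OF less.prems(1)] .
        ultimately have c: "card (N ` B) = card B" "card (N ` B) \<le> card C" using cc by auto
        then have "inj_on N B" using less.prems(1) by (simp add: eq_card_imp_inj_on)
        moreover have "independent (N ` B)" using spanning_card_independent[OF finNB C(2) CN c(2)] .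
        ultimately have inj: "inj_on N (span B)" using N.inj_on_span_iff_independent_image by blast
        have "N v = N 0" using ev(3) by (simp add: N_def)
        then show False using inj ev(1,2) span_zero unfolding inj_on_def by blast
      qed
      have gNW: "g ` (N ` W) \<subseteq> N ` W"
      proof
        fix x assume "x \<in> g ` (N ` W)"
        then obtain u where u: "u \<in> W" "x = g (N u)" by auto
        then have "x = N (g u)" unfolding N_def by (simp add: g.diff g.scale)
        then show "x \<in> N ` W" using u gW by auto
      qed
      obtain bs where bs: "\<forall>b\<in>set bs. is_chain scale g b" "list_basis scale (concat (map snd bs)) (N ` W)"
        "span (set (concat (map chain_dom bs))) = N ` W"
        using less.hyps[OF \<open>card C < card B\<close> C(1,3) subNW _ gNW] by blast
      then have "\<forall>b\<in>set bs. is_chain scale g b \<and> fst b \<noteq> None"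
        using no_ends_if_full[OF _ bs(2,3)] unfolding is_chain_def by auto
      then obtain bs' where bs': "\<forall>b\<in>set bs'. is_chain scale g b \<and> fst b \<noteq> None" "list_basis scale (concat (map snd bs')) W"
        using Jordan_chains_step[OF lin less.prems(1,2) gW] bs(2) unfolding N_def by blast
      have "map chain_dom bs' = map snd bs'"
        using bs'(1) unfolding chain_dom_def by (auto split: option.splits)
      then show ?thesis using bs' True unfolding list_basis_def by metis
    qed
  qed
qed

end

section \<open>Multivariate polynomials and weights\<close>

abbreviation lookup where "lookup \<equiv> Poly_Mapping.lookup"
abbreviation keys where "keys \<equiv> Poly_Mapping.keys"
abbreviation single where "single \<equiv> Poly_Mapping.single"

lemma Const_simps [simp]:
  "Const 0 = 0" "Const 1 = 1"
  by (simp_all add: Const_def)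

lemma Const_add: "Const (c + d) = Const c + Const d"
  by (simp add: Const_def single_add)

lemma Const_uminus: "Const (- c) = - Const c"
  by (simp add: Const_def single_uminus)

lemma Const_diff: "Const (c - d) = Const c - Const d"
  by (simp add: Const_def single_diff)

lemma Const_mult: "Const (c * d) = Const c * Const d"
  by (simp add: Const_def mult_single)

lemma Const_sum: "Const (sum f A) = (\<Sum>x\<in>A. Const (f x))"
  by (induction A rule: infinite_finite_induct) (simp_all add: Const_add)

lemma lookup_Const_mult: "lookup (Const c * p) x = c * lookup p x"
  unfolding Const_def mult_map_scale_conv_mult[symmetric]
  by (simp add: Poly_Mapping.map.rep_eq when_def)

lemma const_term_Const [simp]: "const_term (Const c) = c"
  by (simp add: const_term_def Const_def)

lemma Const_inject [simp]: "Const c = Const d \<longleftrightarrow> c = d"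
  by (metis const_term_Const)

lemma poly_mapping_sum_single: "p = (\<Sum>x\<in>keys p. single x (lookup p x))"
  by (rule poly_mapping_eqI) (auto simp: lookup_sum lookup_single when_def in_keys_iff sum.delta)

section \<open>Substitution as a ring homomorphism, and polynomials in a given set of
  variables\<close>

definition monomial_value :: "((nat \<times> nat) \<Rightarrow> 'k::comm_ring_1 mpoly) \<Rightarrow> ((nat \<times> nat) \<Rightarrow>\<^sub>0 nat) \<Rightarrow> 'k mpoly" where
  "monomial_value \<sigma> x = (\<Prod>v\<in>keys x. \<sigma> v ^ lookup x v)"

lemma monomial_value_superset:
  assumes "finite A" "keys x \<subseteq> A" shows "monomial_value \<sigma> x = (\<Prod>v\<in>A. \<sigma> v ^ lookup x v)"
  unfolding monomial_value_def using assms by (intro prod.mono_neutral_left) (auto simp: in_keys_iff)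

lemma monomial_value_add: "monomial_value \<sigma> (x + y) = monomial_value \<sigma> x * monomial_value \<sigma> y"
proof -
  have "finite (keys x \<union> keys y)" by simp
  moreover have "keys (x + y) \<subseteq> keys x \<union> keys y" by (rule keys_add)
  ultimately show ?thesis
    by (subst (1 2 3) monomial_value_superset[of "keys x \<union> keys y"]) (auto simp: lookup_add power_add prod.distrib)
qed

lemma monomial_value_0 [simp]: "monomial_value \<sigma> 0 = 1"
  by (simp add: monomial_value_def)

lemma monomial_value_single: "monomial_value \<sigma> (single v n) = \<sigma> v ^ n"
  by (simp add: monomial_value_def)

lemma subst_superset:
  assumes "finite A" "keys p \<subseteq> A" shows "subst \<sigma> p = (\<Sum>x\<in>A. Const (lookup p x) * monomial_value \<sigma> x)"
  unfolding subst_def monomial_value_def[symmetric] using assms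
  by (intro sum.mono_neutral_left) (auto simp: in_keys_iff)

lemma subst_add: "subst \<sigma> (p + q) = subst \<sigma> p + subst \<sigma> q"
proof -
  have "finite (keys p \<union> keys q)" by simp
  moreover have "keys (p + q) \<subseteq> keys p \<union> keys q" by (rule keys_add)
  ultimately show ?thesis
    by (subst (1 2 3) subst_superset[of "keys p \<union> keys q"])
      (auto simp: lookup_add Const_add distrib_right sum.distrib)
qed

lemma subst_0 [simp]: "subst \<sigma> 0 = 0"
  by (simp add: subst_def)

lemma subst_sum: "subst \<sigma> (sum f A) = (\<Sum>x\<in>A. subst \<sigma> (f x))"
  by (induction A rule: infinite_finite_induct) (simp_all add: subst_add)

lemma subst_single: "subst \<sigma> (single x c) = Const c * monomial_value \<sigma> x"
  by (simp add: subst_superset[of "{x}"])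

lemma subst_Const [simp]: "subst \<sigma> (Const c) = Const c"
  unfolding Const_def[of c] subst_single by (simp add: Const_def)

lemma subst_1 [simp]: "subst \<sigma> 1 = 1"
  using subst_Const[of \<sigma> 1] by simp

lemma subst_Var [simp]: "subst \<sigma> (Var v) = \<sigma> v"
  unfolding Var_def subst_single monomial_value_single by simp

lemma subst_mult: "subst \<sigma> (p * q) = subst \<sigma> p * subst \<sigma> q"
proof -
  have "p * q = (\<Sum>x\<in>keys p. \<Sum>y\<in>keys q. single (x + y) (lookup p x * lookup q y))"
    by (subst poly_mapping_sum_single[of p], subst poly_mapping_sum_single[of q])
      (simp add: sum_product mult_single)
  then have "subst \<sigma> (p * q) = (\<Sum>x\<in>keys p. \<Sum>y\<in>keys q. subst \<sigma> (single x (lookup p x)) * subst \<sigma> (single y (lookup q y)))"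
    by (simp add: subst_sum subst_single monomial_value_add Const_mult mult_ac)
  also have "\<dots> = subst \<sigma> p * subst \<sigma> q"
    by (subst (3) poly_mapping_sum_single[of p], subst (3) poly_mapping_sum_single[of q])
      (simp add: subst_sum sum_product)
  finally show ?thesis .
qed

lemma subst_uminus: "subst \<sigma> (- p) = - subst \<sigma> p"
  using subst_add[of \<sigma> "- p" p] by (simp add: eq_neg_iff_add_eq_0)

lemma subst_diff: "subst \<sigma> (p - q) = subst \<sigma> p - subst \<sigma> q"
  using subst_add[of \<sigma> p "- q"] by (simp add: subst_uminus)

definition PolyOn :: "(nat \<times> nat) set \<Rightarrow> 'k::comm_ring_1 mpoly set" where
  "PolyOn X = {p. mvars p \<subseteq> X}"

lemma Sw_PolyOn: "Sw k a = PolyOn (Vars k a)"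
  by (simp add: Sw_def PolyOn_def)

lemma PolyOn_iff: "p \<in> PolyOn X \<longleftrightarrow> (\<forall>x\<in>keys p. keys x \<subseteq> X)"
  by (auto simp: PolyOn_def mvars_def)

lemma PolyOn_mono: "X \<subseteq> Y \<Longrightarrow> PolyOn X \<subseteq> PolyOn Y"
  by (auto simp: PolyOn_def)

lemma PolyOn_Const [simp, intro]: "Const c \<in> PolyOn X"
  by (auto simp: PolyOn_iff Const_def)

lemma PolyOn_0 [simp, intro]: "0 \<in> PolyOn X"
  using PolyOn_Const[of 0 X] by simp

lemma PolyOn_1 [simp, intro]: "1 \<in> PolyOn X"
  using PolyOn_Const[of 1 X] by simp

lemma PolyOn_Var: "v \<in> X \<Longrightarrow> Var v \<in> PolyOn X"
  by (simp add: PolyOn_iff Var_def)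

lemma PolyOn_add [intro]: "p \<in> PolyOn X \<Longrightarrow> q \<in> PolyOn X \<Longrightarrow> p + q \<in> PolyOn X"
  unfolding PolyOn_iff using keys_add[of p q] by blast

lemma PolyOn_mult [intro]:
  assumes "p \<in> PolyOn X" "q \<in> PolyOn X" shows "p * q \<in> PolyOn X"
  unfolding PolyOn_iff
proof
  fix z assume "z \<in> keys (p * q)"
  then obtain x y where "x \<in> keys p" "y \<in> keys q" "z = x + y" using keys_mult[of p q] by blast
  then show "keys z \<subseteq> X" using assms keys_add[of x y] unfolding PolyOn_iff by blast
qed

lemma PolyOn_uminus [intro]: "p \<in> PolyOn X \<Longrightarrow> - p \<in> PolyOn X"
  using PolyOn_mult[OF PolyOn_Const[of "-1" X], of p] by (simp add: Const_uminus)

lemma PolyOn_diff [intro]: "p \<in> PolyOn X \<Longrightarrow> q \<in> PolyOn X \<Longrightarrow> p - q \<in> PolyOn X"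
  using PolyOn_add[of p X "- q"] by auto

lemma PolyOn_sum [intro]: "(\<And>x. x \<in> A \<Longrightarrow> f x \<in> PolyOn X) \<Longrightarrow> sum f A \<in> PolyOn X"
  by (induction A rule: infinite_finite_induct) auto

lemma subst_Var_id [simp]: "subst Var p = p"
proof -
  have *: "monomial_value Var x = single x (1::'a)" for x
  proof (induction "card (keys x)" arbitrary: x)
    case 0
    then show ?case by simp
  next
    case (Suc n)
    then obtain v where v: "v \<in> keys x" by (metis card.empty equals0I nat.distinct(1))
    define y where "y = x - single v (lookup x v)"
    have ly: "lookup y u = (if u = v then 0 else lookup x u)" for u
      unfolding y_def by (simp add: lookup_minus lookup_single when_def)
    have x: "x = y + single v (lookup x v)"
      by (rule poly_mapping_eqI) (simp add: lookup_add ly lookup_single when_def)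
    have "u \<in> keys y \<longleftrightarrow> u \<in> keys x - {v}" for u by (simp add: in_keys_iff ly)
    then have "keys y = keys x - {v}" by blast
    then have "monomial_value Var y = single y (1::'a)" using Suc v by (intro Suc(1)) simp
    moreover have "Var v ^ n = single (single v n) (1::'a)" for n
      by (induction n) (simp_all add: Var_def mult_single single_add[symmetric])
    ultimately show ?case by (subst (1 2) x) (simp add: monomial_value_add monomial_value_single mult_single)
  qed
  have "subst Var p = (\<Sum>x\<in>keys p. single x (lookup p x))"
    by (simp add: subst_superset[of "keys p"] * Const_def mult_single)
  then show ?thesis using poly_mapping_sum_single by metis
qed

text \<open>The identity \<open>subst Var p = p\<close> writes p by sums, products and powers of
  constants and of variables in X, so statements compatible with the ring operations are checked on
  generators.\<close>

lemma PolyOn_induct [consumes 1, case_names Const Var add mult]: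
  assumes p: "p \<in> PolyOn X"
    and C: "\<And>c. P (Const c)" and V: "\<And>v. v \<in> X \<Longrightarrow> P (Var v)"
    and A: "\<And>p q. P p \<Longrightarrow> P q \<Longrightarrow> P (p + q)" and M: "\<And>p q. P p \<Longrightarrow> P q \<Longrightarrow> P (p * q)"
  shows "P p"
proof -
  have P0: "P 0" "P 1" using C[of 0] C[of 1] by auto
  have sum: "(\<And>x. x \<in> A \<Longrightarrow> P (f x)) \<Longrightarrow> P (sum f A)" for f :: "'b \<Rightarrow> _" and A
    by (induction A rule: infinite_finite_induct) (use P0 A in auto)
  have prod: "(\<And>x. x \<in> A \<Longrightarrow> P (f x)) \<Longrightarrow> P (prod f A)" for f :: "'c \<Rightarrow> _" and A
    by (induction A rule: infinite_finite_induct) (use P0 M in auto)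
  have pow: "P p \<Longrightarrow> P (p ^ n)" for p n
    by (induction n) (use P0 M in auto)
  have "P (subst Var p)" unfolding subst_def
    using p unfolding PolyOn_iff by (intro sum M C prod pow V) auto
  then show ?thesis by simp
qed

lemma mpoly_induct [case_names Const Var add mult]:
  assumes "\<And>c. P (Const c)" "\<And>v. P (Var v)"
    "\<And>p q. P p \<Longrightarrow> P q \<Longrightarrow> P (p + q)" "\<And>p q. P p \<Longrightarrow> P q \<Longrightarrow> P (p * q)"
  shows "P p"
  by (rule PolyOn_induct[of p UNIV]) (use assms in \<open>auto simp: PolyOn_def\<close>)

lemma subst_subst: "subst \<sigma> (subst \<tau> p) = subst (\<lambda>v. subst \<sigma> (\<tau> v)) p"
  by (induction p rule: mpoly_induct) (simp_all add: subst_add subst_mult)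

lemma subst_cong:
  assumes "p \<in> PolyOn X" "\<And>v. v \<in> X \<Longrightarrow> \<sigma> v = \<tau> v" shows "subst \<sigma> p = subst \<tau> p"
  using assms(1) by (induction rule: PolyOn_induct) (simp_all add: subst_add subst_mult assms(2))

lemma subst_PolyOn:
  assumes "p \<in> PolyOn X" "\<And>v. v \<in> X \<Longrightarrow> \<sigma> v \<in> PolyOn Y" shows "subst \<sigma> p \<in> PolyOn Y"
  using assms(1) by (induction rule: PolyOn_induct) (auto simp add: subst_add subst_mult assms(2))

section \<open>Weighted degree and homogeneous components\<close>

lemma wdeg_superset:
  assumes "finite A" "keys x \<subseteq> A" shows "wdeg m x = (\<Sum>v\<in>A. lookup x v * m (fst v))"
  unfolding wdeg_def using assms by (intro sum.mono_neutral_left) (auto simp: in_keys_iff)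

lemma wdeg_add: "wdeg m (x + y) = wdeg m x + wdeg m y"
proof -
  have "finite (keys x \<union> keys y)" by simp
  moreover have "keys (x + y) \<subseteq> keys x \<union> keys y" by (rule keys_add)
  ultimately show ?thesis
    by (subst (1 2 3) wdeg_superset[of "keys x \<union> keys y"]) (auto simp: lookup_add sum.distrib distrib_right)
qed

lemma wdeg_0 [simp]: "wdeg m 0 = 0"
  by (simp add: wdeg_def)

lemma wdeg_single: "wdeg m (single v n) = n * m (fst v)"
  by (simp add: wdeg_def)

lemma homog_0 [simp, intro]: "homog m d 0"
  by (simp add: homog_def)

lemma homog_Const [simp, intro]: "homog m 0 (Const c)"
  by (simp add: homog_def Const_def)

lemma homog_Var: "homog m (m (fst v)) (Var v)"
  by (simp add: homog_def Var_def wdeg_single)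

lemma homog_add [intro]: "homog m d p \<Longrightarrow> homog m d q \<Longrightarrow> homog m d (p + q)"
  unfolding homog_def using keys_add[of p q] by blast

lemma homog_mult:
  assumes "homog m d p" "homog m e q" shows "homog m (d + e) (p * q)"
  unfolding homog_def
proof
  fix z assume "z \<in> keys (p * q)"
  then obtain x y where "x \<in> keys p" "y \<in> keys q" "z = x + y" using keys_mult[of p q] by blast
  then show "wdeg m z = d + e" using assms unfolding homog_def by (simp add: wdeg_add)
qed

lemma homog_Const_mult [intro]: "homog m d p \<Longrightarrow> homog m d (Const c * p)"
  using homog_mult[OF homog_Const, of m d p c] by simp

lemma homog_uminus [intro]: "homog m d p \<Longrightarrow> homog m d (- p)"
  using homog_Const_mult[of m d p "-1"] by (simp add: Const_uminus)

lemma homog_diff [intro]: "homog m d p \<Longrightarrow> homog m d q \<Longrightarrow> homog m d (p - q)"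
  using homog_add[of m d p "- q"] by auto

lemma homog_sum [intro]: "(\<And>x. x \<in> A \<Longrightarrow> homog m d (f x)) \<Longrightarrow> homog m d (sum f A)"
  by (induction A rule: infinite_finite_induct) auto

lemma homog_subst:
  assumes p: "homog m d p" "p \<in> PolyOn X" and s: "\<And>v. v \<in> X \<Longrightarrow> homog m (m (fst v)) (\<sigma> v)"
  shows "homog m d (subst \<sigma> p)"
  unfolding subst_def
proof (intro homog_sum homog_Const_mult)
  fix x assume x: "x \<in> keys p"
  have H: "homog m (\<Sum>v\<in>A. lookup x v * m (fst v)) (\<Prod>v\<in>A. \<sigma> v ^ lookup x v)" if "finite A" "A \<subseteq> X" for A
    using that
  proof (induction A rule: finite_induct)
    case empty
    then show ?case using homog_Const[of m 1] by simp
  next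
    case (insert v A)
    have "homog m (n * m (fst v)) (\<sigma> v ^ n)" for n
    proof (induction n)
      case 0
      then show ?case using homog_Const[of m 1] by simp
    next
      case (Suc n)
      then show ?case using homog_mult[OF s] insert.prems by simp
    qed
    then show ?case using insert by (simp add: homog_mult)
  qed
  have "keys x \<subseteq> X" using x p(2) unfolding PolyOn_iff by simp
  then have "homog m (wdeg m x) (\<Prod>v\<in>keys x. \<sigma> v ^ lookup x v)"
    unfolding wdeg_def by (intro H) auto
  then show "homog m d (\<Prod>v\<in>keys x. \<sigma> v ^ lookup x v)" using x p(1) unfolding homog_def by simp
qed

definition hcomp :: "(nat \<Rightarrow> nat) \<Rightarrow> nat \<Rightarrow> 'k::comm_ring_1 mpoly \<Rightarrow> 'k mpoly" where
  "hcomp m D p = (\<Sum>x | x \<in> keys p \<and> wdeg m x = D. single x (lookup p x))"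

lemma lookup_hcomp: "lookup (hcomp m D p) x = (if wdeg m x = D then lookup p x else 0)"
  unfolding hcomp_def by (auto simp: lookup_sum lookup_single when_def in_keys_iff sum.delta)

lemma keys_hcomp: "keys (hcomp m D p) \<subseteq> keys p"
  by (rule subsetI) (simp add: in_keys_iff lookup_hcomp split: if_splits)

lemma hcomp_homog [simp, intro]: "homog m D (hcomp m D p)"
  by (auto simp: homog_def in_keys_iff lookup_hcomp split: if_splits)

lemma hcomp_PolyOn [intro]: "p \<in> PolyOn X \<Longrightarrow> hcomp m D p \<in> PolyOn X"
  unfolding PolyOn_iff using keys_hcomp[of m D p] by blast

lemma hcomp_0 [simp]: "hcomp m D 0 = 0"
  by (simp add: hcomp_def)

lemma hcomp_add: "hcomp m D (p + q) = hcomp m D p + hcomp m D q"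
  by (rule poly_mapping_eqI) (simp add: lookup_hcomp lookup_add)

lemma hcomp_uminus: "hcomp m D (- p) = - hcomp m D p"
  by (rule poly_mapping_eqI) (simp add: lookup_hcomp)

lemma hcomp_diff: "hcomp m D (p - q) = hcomp m D p - hcomp m D q"
  using hcomp_add[of m D p "- q"] by (simp add: hcomp_uminus)

lemma hcomp_sum: "hcomp m D (sum f A) = (\<Sum>x\<in>A. hcomp m D (f x))"
  by (induction A rule: infinite_finite_induct) (simp_all add: hcomp_add)

lemma hcomp_of_homog: "homog m d p \<Longrightarrow> hcomp m D p = (if D = d then p else 0)"
  by (rule poly_mapping_eqI) (auto simp: lookup_hcomp homog_def in_keys_iff)

lemma sum_hcomp:
  assumes "finite T" "wdeg m ` keys p \<subseteq> T" shows "p = (\<Sum>D\<in>T. hcomp m D p)"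
proof (rule poly_mapping_eqI)
  fix x
  have "lookup p x = 0" if "wdeg m x \<notin> T" 
    using that assms(2) not_in_keys_iff_lookup_eq_zero[of x p] by (meson image_subset_iff)
  then show "lookup p x = lookup (\<Sum>D\<in>T. hcomp m D p) x"
    using assms(1) by (auto simp: lookup_sum lookup_hcomp sum.delta)
qed

lemma hcomp_mult_homog:
  assumes f: "homog m d f"
  shows "hcomp m D (f * g) = (if d \<le> D then f * hcomp m (D - d) g else 0)"
proof -
  let ?T = "wdeg m ` keys g"
  have g: "g = (\<Sum>E\<in>?T. hcomp m E g)" by (rule sum_hcomp) auto
  have "hcomp m D (f * hcomp m E g) = (if D = d + E then f * hcomp m E g else 0)" for E
    using homog_mult[OF f hcomp_homog] by (rule hcomp_of_homog)
  then have eq: "hcomp m D (f * g) = (\<Sum>E\<in>?T. if D = d + E then f * hcomp m E g else 0)"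
    by (subst g) (simp add: sum_distrib_left hcomp_sum)
  show ?thesis
  proof (cases "d \<le> D")
    case True
    then have "\<And>E. D = d + E \<longleftrightarrow> E = D - d" by auto
    then have "hcomp m D (f * g) = (if D - d \<in> ?T then f * hcomp m (D - d) g else 0)"
      unfolding eq by (simp add: sum.delta)
    moreover have "hcomp m (D - d) g = 0" if "D - d \<notin> ?T"
    proof (rule poly_mapping_eqI)
      fix x
      have "x \<notin> keys g" if "wdeg m x = D - d" using that \<open>D - d \<notin> ?T\<close> by (metis imageI)
      then show "lookup (hcomp m (D - d) g) x = lookup 0 x"
        by (simp add: lookup_hcomp not_in_keys_iff_lookup_eq_zero)
    qed
    ultimately show ?thesis using True by auto
  next
    case False
    then show ?thesis unfolding eq by (auto intro!: sum.neutral)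
  qed
qed

lemma hcomp_mult_homog':
  assumes f: "homog m d f"
  shows "hcomp m D (g * f) = (if d \<le> D then hcomp m (D - d) g * f else 0)"
  using hcomp_mult_homog[OF f, of D g] by (simp add: mult.commute)

lemma homog_eqI_0: "homog m d p \<Longrightarrow> homog m e p \<Longrightarrow> d \<noteq> e \<Longrightarrow> p = 0"
  using hcomp_of_homog by metis

definition vcoef :: "'k::comm_ring_1 mpoly \<Rightarrow> nat \<times> nat \<Rightarrow> 'k" where
  "vcoef p v = lookup p (single v 1)"

lemma vcoef_simps [simp]:
  "vcoef 0 v = 0" "vcoef (p + q) v = vcoef p v + vcoef q v" "vcoef (p - q) v = vcoef p v - vcoef q v"
  "vcoef (- p) v = - vcoef p v" "vcoef (Const c * p) v = c * vcoef p v"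
  by (simp_all add: vcoef_def lookup_add lookup_minus lookup_Const_mult)

lemma vcoef_sum: "vcoef (sum f A) v = (\<Sum>x\<in>A. vcoef (f x) v)"
  by (simp add: vcoef_def lookup_sum)

lemma vcoef_Var: "vcoef (Var u) v = (if u = v then 1 else 0)"
proof -
  have "single u (1::nat) = single v 1 \<longleftrightarrow> u = v"
    by (metis lookup_single_eq lookup_single_not_eq one_neq_zero)
  then show ?thesis by (auto simp: vcoef_def Var_def lookup_single when_def)
qed

text \<open>An element of \<open>gen_ideal\<close> is a finite sum in which generators may repeat;
  grouping the terms by index leaves one coefficient per j, even if f is not injective.\<close>

lemma gen_ideal_image:
  assumes R: "0 \<in> R" "\<And>x y. x \<in> R \<Longrightarrow> y \<in> R \<Longrightarrow> x + y \<in> R" and J: "finite J"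
  shows "g \<in> gen_ideal R (f ` J) \<longleftrightarrow> (\<exists>b. (\<forall>j\<in>J. b j \<in> R) \<and> g = (\<Sum>j\<in>J. b j * f j))"
proof
  have sumR: "(\<And>x. x \<in> A \<Longrightarrow> h x \<in> R) \<Longrightarrow> sum h A \<in> R" for h :: "nat \<Rightarrow> _" and A
    by (induction A rule: infinite_finite_induct) (use R in auto)
  assume "g \<in> gen_ideal R (f ` J)"
  then obtain n c h where h: "g = (\<Sum>i<n. c i * h i)" "\<forall>i<(n::nat). c i \<in> R \<and> h i \<in> f ` J"
    unfolding gen_ideal_def by blast
  then have "\<forall>i\<in>{..<n}. \<exists>j. j \<in> J \<and> h i = f j" by auto
  from bchoice[OF this] obtain t where t: "\<And>i. i < n \<Longrightarrow> t i \<in> J \<and> h i = f (t i)" by auto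
  define b where "b j = (\<Sum>i | i \<in> {..<n} \<and> t i = j. c i)" for j
  have "(\<Sum>j\<in>J. b j * f j) = (\<Sum>j\<in>J. \<Sum>i | i \<in> {..<n} \<and> t i = j. c i * h i)"
    unfolding b_def sum_distrib_right using t by (intro sum.cong) auto
  also have "\<dots> = (\<Sum>i<n. c i * h i)" using t J by (intro sum.group) auto
  finally show "\<exists>b. (\<forall>j\<in>J. b j \<in> R) \<and> g = (\<Sum>j\<in>J. b j * f j)"
    using h unfolding b_def by (intro exI[of _ b]) (auto simp: b_def intro!: sumR)
next
  assume "\<exists>b. (\<forall>j\<in>J. b j \<in> R) \<and> g = (\<Sum>j\<in>J. b j * f j)"
  then obtain b where b: "\<forall>j\<in>J. b j \<in> R" "g = (\<Sum>j\<in>J. b j * f j)" by blast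
  obtain h where h: "bij_betw h {0..<card J} J" using ex_bij_betw_nat_finite[OF J] by blast
  then have "g = (\<Sum>i<card J. b (h i) * f (h i))"
    using b(2) sum.reindex_bij_betw[OF h, of "\<lambda>j. b j * f j"] by (simp add: atLeast0LessThan)
  moreover have "\<forall>i<card J. b (h i) \<in> R \<and> f (h i) \<in> f ` J"
    using h b(1) unfolding bij_betw_def by auto
  ultimately show "g \<in> gen_ideal R (f ` J)" unfolding gen_ideal_def mem_Collect_eq
    by (intro exI[of _ "card J"] exI[of _ "\<lambda>i. b (h i)"] exI[of _ "\<lambda>i. f (h i)"]) blast
qed

section \<open>The weights of the variables and linear parts of forms\<close>

locale weights =
  fixes k :: nat and a m :: "nat \<Rightarrow> nat"
  assumes m0: "m 0 = 1" and m_mono: "\<And>i. 1 \<le> i \<Longrightarrow> i \<le> k \<Longrightarrow> m (i - 1) < m i"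
begin

lemma m_less: "i < j \<Longrightarrow> j \<le> k \<Longrightarrow> m i < m j"
proof (induction j)
  case (Suc j)
  have "m j < m (Suc j)" using m_mono[of "Suc j"] Suc.prems by simp
  then show ?case using Suc by (cases "i = j") auto
qed simp

lemma m_pos: "i \<le> k \<Longrightarrow> 0 < m i"
  using m0 m_less[of 0 i] by (cases "i = 0") auto

lemma m_inj: "i \<le> k \<Longrightarrow> j \<le> k \<Longrightarrow> m i = m j \<Longrightarrow> i = j"
  using m_less[of i j] m_less[of j i] by (cases i j rule: linorder_cases) auto

lemma m_less_iff: "i \<le> k \<Longrightarrow> j \<le> k \<Longrightarrow> m i < m j \<longleftrightarrow> i < j"
  using m_less[of i j] m_less[of j i] by (cases i j rule: linorder_cases) auto

definition Low :: "nat \<Rightarrow> (nat \<times> nat) set" where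
  "Low i = {v \<in> Vars k a. m (fst v) < m i}"

lemma Low_iff: "i \<le> k \<Longrightarrow> v \<in> Low i \<longleftrightarrow> v \<in> Vars k a \<and> fst v < i"
  unfolding Low_def Vars_def using m_less_iff by auto

lemma lower_poly_iff: "lower_poly k a m i p \<longleftrightarrow> homog m (m i) p \<and> p \<in> PolyOn (Low i)"
  unfolding lower_poly_def PolyOn_def Low_def by simp

lemma Low_subset: "PolyOn (Low i) \<subseteq> Sw k a"
  unfolding Sw_PolyOn by (rule PolyOn_mono) (auto simp: Low_def)

text \<open>All variables have positive degree, so a single variable of degree at least
  \<open>m i\<close> already exhausts the weight.\<close>

lemma monomial_cases:
  assumes x: "keys x \<subseteq> Vars k a" "wdeg m x = m i" and i: "i \<le> k"
  shows "(\<exists>j. (i, j) \<in> Vars k a \<and> x = single (i, j) 1) \<or> keys x \<subseteq> Low i"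
proof (cases "keys x \<subseteq> Low i")
  case False
  then obtain v where v: "v \<in> keys x" "m i \<le> m (fst v)" using x(1) unfolding Low_def by fastforce
  have pos: "m (fst u) > 0" if "u \<in> keys x" for u using that x(1) m_pos unfolding Vars_def by auto
  have sum: "m i = lookup x v * m (fst v) + (\<Sum>u\<in>keys x - {v}. lookup x u * m (fst u))"
    using x(2) v(1) unfolding wdeg_def by (simp add: sum.remove)
  have lv: "lookup x v \<ge> 1" using v(1) by (simp add: in_keys_iff Suc_leI)
  have ge: "lookup x v * m (fst v) \<ge> m (fst v)" using lv by simp
  then have eq: "lookup x v * m (fst v) = m i" "m (fst v) = m i" 
    and z: "(\<Sum>u\<in>keys x - {v}. lookup x u * m (fst u)) = 0" using sum v(2) by linarith+
  then have l1: "lookup x v = 1" using pos[OF v(1)] by simp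
  have "keys x - {v} = {}"
  proof (rule ccontr)
    assume "keys x - {v} \<noteq> {}"
    then obtain u where u: "u \<in> keys x - {v}" by blast
    then have "lookup x u * m (fst u) = 0" using z by (simp add: sum_eq_0_iff)
    then show False using u pos[of u] by (auto simp: in_keys_iff)
  qed
  then have kx: "keys x = {v}" using v(1) by blast
  have "x = single v 1"
    by (rule poly_mapping_eqI) (use kx l1 in \<open>auto simp: lookup_single when_def in_keys_iff\<close>)
  moreover have "fst v = i" using m_inj[of "fst v" i] eq(2) i v(1) x(1) unfolding Vars_def by auto
  ultimately show ?thesis using v(1) x(1) by (metis prod.collapse subsetD)
qed simp

text \<open>The linear part in degree \<open>m i\<close>. On forms of degree \<open>m i\<close> its
  kernel consists of the polynomials in variables of smaller degree, by
  \<open>lin_eq_0_lower\<close>.\<close>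

definition lin :: "nat \<Rightarrow> 'k::comm_ring_1 mpoly \<Rightarrow> 'k mpoly" where
  "lin i p = (\<Sum>j\<in>{1..a i}. Const (vcoef p (i, j)) * Var (i, j))"

lemma Vars_iff: "i \<le> k \<Longrightarrow> (i, j) \<in> Vars k a \<longleftrightarrow> j \<in> {1..a i}"
  by (auto simp: Vars_def)

lemma vcoef_lin: "i \<le> k \<Longrightarrow> vcoef (lin i p) v = (if v \<in> Vars k a \<and> fst v = i then vcoef p v else 0)"
proof (cases "fst v = i")
  case True
  then obtain b where v: "v = (i, b)" by (metis prod.collapse)
  assume "i \<le> k"
  then show ?thesis unfolding lin_def vcoef_sum v
    by (auto simp: vcoef_Var Vars_iff if_distrib[of "\<lambda>x. _ * x"] sum.delta cong: if_cong)
next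
  case False
  then show ?thesis unfolding lin_def vcoef_sum by (cases v) (auto simp: vcoef_Var intro!: sum.neutral)
qed

lemma lin_add: "lin i (p + q) = lin i p + lin i q"
  by (simp add: lin_def Const_add distrib_right sum.distrib)

lemma lin_Const_mult: "lin i (Const c * p) = Const c * lin i p"
  by (simp add: lin_def Const_mult sum_distrib_left mult.assoc)

lemma lin_0 [simp]: "lin i 0 = 0"
  by (simp add: lin_def)

lemma lin_uminus: "lin i (- p) = - lin i p"
  by (simp add: lin_def Const_uminus sum_negf)

lemma lin_diff: "lin i (p - q) = lin i p - lin i q"
  using lin_add[of i p "- q"] by (simp add: lin_uminus)

lemma lin_sum: "lin i (sum f A) = (\<Sum>x\<in>A. lin i (f x))"
  by (induction A rule: infinite_finite_induct) (simp_all add: lin_add)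

lemma lin_lin: "i \<le> k \<Longrightarrow> lin i (lin i p) = lin i p"
  by (subst lin_def, subst lin_def[of i p]) (simp add: vcoef_lin Vars_iff)

lemma lin_PolyOn: "i \<le> k \<Longrightarrow> lin i p \<in> Sw k a"
  unfolding lin_def Sw_PolyOn by (intro PolyOn_sum PolyOn_mult PolyOn_Const PolyOn_Var) (simp add: Vars_iff)

lemma lin_homog: "homog m (m i) (lin i p)"
  unfolding lin_def using homog_Var[of m "(i, _)"] by (intro homog_sum homog_Const_mult) simp

lemma lin_Var: "i \<le> k \<Longrightarrow> j \<in> {1..a i} \<Longrightarrow> lin i (Var (i, j)) = Var (i, j)"
  unfolding lin_def vcoef_Var by (simp add: if_distrib[of Const] if_distrib[of "\<lambda>x. x * _"] sum.delta cong: if_cong)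

lemma lin_eq_0_lower:
  assumes p: "p \<in> Sw k a" "homog m (m i) p" "lin i p = 0" and i: "i \<le> k"
  shows "lower_poly k a m i p"
  unfolding lower_poly_iff
proof
  show "p \<in> PolyOn (Low i)" unfolding PolyOn_iff
  proof (rule ballI)
    fix x assume x: "x \<in> keys p"
    then have "keys x \<subseteq> Vars k a" "wdeg m x = m i"
      using p(1,2) unfolding Sw_PolyOn PolyOn_iff homog_def by auto
    from monomial_cases[OF this i] show "keys x \<subseteq> Low i"
    proof
      assume "\<exists>j. (i, j) \<in> Vars k a \<and> x = single (i, j) 1"
      then obtain j where j: "(i, j) \<in> Vars k a" "x = single (i, j) 1" by blast
      then have "vcoef (lin i p) (i, j) = vcoef p (i, j)" using i by (simp add: vcoef_lin)
      then have "vcoef p (i, j) = 0" using p(3) by simp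
      then show ?thesis using x j unfolding vcoef_def by (simp add: in_keys_iff)
    qed
  qed
qed (use p in simp)

end

section \<open>Koszul syzygies and the row ideal\<close>

text \<open>The vanishing diagonal is assumed separately because antisymmetry gives only 2 e_ii = 0,
  which says nothing in characteristic 2.\<close>

lemma antisym_double_sum_0:
  fixes e :: "nat \<Rightarrow> nat \<Rightarrow> 'a::comm_ring_1"
  assumes "finite J" "\<And>i j. i \<in> J \<Longrightarrow> j \<in> J \<Longrightarrow> e j i = - e i j" "\<And>i. i \<in> J \<Longrightarrow> e i i = 0"
  shows "(\<Sum>i\<in>J. \<Sum>j\<in>J. e i j * x i * x j) = 0"
  using assms
proof (induction J rule: finite_induct)
  case (insert t J)
  have "(\<Sum>i\<in>insert t J. \<Sum>j\<in>insert t J. e i j * x i * x j)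
      = (\<Sum>j\<in>J. e t j * x t * x j) + (\<Sum>i\<in>J. e i t * x i * x t) + (\<Sum>i\<in>J. \<Sum>j\<in>J. e i j * x i * x j)"
    using insert.hyps insert.prems(2)[of t] by (simp add: sum.distrib add_ac)
  also have "(\<Sum>i\<in>J. e i t * x i * x t) = - (\<Sum>j\<in>J. e t j * x t * x j)"
    unfolding sum_negf[symmetric]
  proof (rule sum.cong[OF refl])
    fix i assume "i \<in> J"
    then have "e i t = - e t i" using insert.prems by blast
    then show "e i t * x i * x t = - (e t i * x t * x i)" by (simp add: algebra_simps)
  qed
  also have "(\<Sum>i\<in>J. \<Sum>j\<in>J. e i j * x i * x j) = 0"
    by (rule insert.IH) (use insert.prems in blast)+
  finally show ?case by simp
qed simp

lemma antisym_syzygy_0: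
  fixes e :: "nat \<Rightarrow> nat \<Rightarrow> 'a::comm_ring_1"
  assumes "finite J" "\<And>i j. i \<in> J \<Longrightarrow> j \<in> J \<Longrightarrow> e j i = - e i j" "\<And>i. i \<in> J \<Longrightarrow> e i i = 0"
  shows "(\<Sum>i\<in>J. (\<Sum>j\<in>J. e i j * x j) * x i) = 0"
proof -
  have "(\<Sum>i\<in>J. (\<Sum>j\<in>J. e i j * x j) * x i) = (\<Sum>i\<in>J. \<Sum>j\<in>J. e i j * x i * x j)"
    unfolding sum_distrib_right by (intro sum.cong refl) (simp only: mult_ac)
  then show ?thesis using antisym_double_sum_0[OF assms] by simp
qed

text \<open>The factor is monic, so comparison of top coefficients cancels it over any commutative
  ring.\<close>

lemma linear_factor_cancel:
  fixes h :: "'a::comm_ring_1 poly"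
  assumes "[:- c, 1:] * h = 0" shows "h = 0"
proof (rule ccontr)
  assume "h \<noteq> 0"
  have "coeff ([:- c, 1:] * h) (Suc (degree h)) = - c * coeff h (Suc (degree h)) + coeff h (degree h)" by simp
  then have "lead_coeff h = 0" unfolding assms by (simp add: coeff_eq_0)
  then show False using \<open>h \<noteq> 0\<close> by simp
qed

section \<open>Polynomials in \<mu> with coefficients in the polynomial ring\<close>

definition cpoly :: "'k::comm_ring_1 poly \<Rightarrow> 'k mpoly poly" where
  "cpoly p = map_poly Const p"

lemma coeff_cpoly [simp]: "coeff (cpoly p) n = Const (coeff p n)"
  unfolding cpoly_def by (simp add: coeff_map_poly)

lemma cpoly_simps [simp]:
  "cpoly 0 = 0" "cpoly 1 = 1" "cpoly (pCons c p) = pCons (Const c) (cpoly p)"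
  by (auto simp: poly_eq_iff coeff_pCons split: nat.splits)

lemma cpoly_add: "cpoly (p + q) = cpoly p + cpoly q"
  by (simp add: poly_eq_iff Const_add)

lemma cpoly_diff: "cpoly (p - q) = cpoly p - cpoly q"
  by (simp add: poly_eq_iff Const_diff)

lemma cpoly_mult: "cpoly (p * q) = cpoly p * cpoly q"
  by (simp add: poly_eq_iff coeff_mult Const_sum Const_mult)

lemma degree_cpoly [simp]: "degree (cpoly p) = degree p"
  unfolding cpoly_def by (rule degree_map_poly) (metis Const_inject Const_simps(1))

lemma poly_cpoly: "poly (cpoly p) (Const c) = Const (poly p c)"
  by (induction p) (simp_all add: Const_add Const_mult)

text \<open>The set X[\<mu>]. Membership is coefficientwise, so that graded pieces, which are not
  rings, are covered as well as subrings.\<close>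

definition coeffs_in :: "'k::comm_ring_1 mpoly set \<Rightarrow> 'k mpoly poly set" where
  "coeffs_in X = {p. \<forall>n. coeff p n \<in> X}"

definition scalar_closed :: "'k::comm_ring_1 mpoly set \<Rightarrow> bool" where
  "scalar_closed X \<longleftrightarrow> 0 \<in> X \<and> (\<forall>x\<in>X. \<forall>y\<in>X. x + y \<in> X) \<and> (\<forall>c. \<forall>x\<in>X. Const c * x \<in> X)"

lemma scalar_closed_simps:
  assumes "scalar_closed X"
  shows "0 \<in> X" "x \<in> X \<Longrightarrow> y \<in> X \<Longrightarrow> x + y \<in> X" "x \<in> X \<Longrightarrow> Const c * x \<in> X"
    "x \<in> X \<Longrightarrow> - x \<in> X" "x \<in> X \<Longrightarrow> y \<in> X \<Longrightarrow> x - y \<in> X"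
proof -
  show *: "0 \<in> X" "x \<in> X \<Longrightarrow> y \<in> X \<Longrightarrow> x + y \<in> X" "x \<in> X \<Longrightarrow> Const c * x \<in> X" for x y c
    using assms unfolding scalar_closed_def by auto
  show **: "x \<in> X \<Longrightarrow> - x \<in> X" for x using *(3)[of x "-1"] by (simp add: Const_uminus)
  show "x \<in> X \<Longrightarrow> y \<in> X \<Longrightarrow> x - y \<in> X" using *(2)[OF _ **] by fastforce
qed

lemma scalar_closed_sum: "scalar_closed X \<Longrightarrow> (\<And>x. x \<in> A \<Longrightarrow> f x \<in> X) \<Longrightarrow> sum f A \<in> X"
  by (induction A rule: infinite_finite_induct) (auto simp: scalar_closed_simps)

lemma coeffs_in_0: "scalar_closed X \<Longrightarrow> 0 \<in> coeffs_in X" by (simp add: coeffs_in_def scalar_closed_simps)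
lemma coeffs_in_add: "scalar_closed X \<Longrightarrow> p \<in> coeffs_in X \<Longrightarrow> q \<in> coeffs_in X \<Longrightarrow> p + q \<in> coeffs_in X" by (simp add: coeffs_in_def scalar_closed_simps)
lemma coeffs_in_diff: "scalar_closed X \<Longrightarrow> p \<in> coeffs_in X \<Longrightarrow> q \<in> coeffs_in X \<Longrightarrow> p - q \<in> coeffs_in X" by (simp add: coeffs_in_def scalar_closed_simps)
lemma coeffs_in_sum: "scalar_closed X \<Longrightarrow> (\<And>x. x \<in> A \<Longrightarrow> f x \<in> coeffs_in X) \<Longrightarrow> sum f A \<in> coeffs_in X"
  by (induction A rule: infinite_finite_induct) (auto simp: coeffs_in_0 coeffs_in_add)
lemma coeffs_in_pCons: "pCons c p \<in> coeffs_in X \<longleftrightarrow> c \<in> X \<and> p \<in> coeffs_in X"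
  unfolding coeffs_in_def mem_Collect_eq by (metis coeff_pCons_0 coeff_pCons_Suc nat.exhaust)

lemma coeffs_in_cpoly_mult: "scalar_closed X \<Longrightarrow> p \<in> coeffs_in X \<Longrightarrow> cpoly d * p \<in> coeffs_in X"
  unfolding coeffs_in_def by (auto simp: coeff_mult scalar_closed_simps intro!: scalar_closed_sum)

lemma coeffs_in_poly: 
  assumes "scalar_closed X" "p \<in> coeffs_in X" shows "poly p (Const c) \<in> X"
  using assms(2)
proof (induction p)
  case 0
  then show ?case using assms by (simp add: scalar_closed_simps)
next
  case (pCons x p)
  then show ?case using assms by (simp add: coeffs_in_pCons scalar_closed_simps)
qed

text \<open>Division by \<mu> - c from the top: each coefficient of B is a coefficient of the
  product plus c times the next higher coefficient of B.\<close>

lemma coeffs_in_linear_factor: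
  assumes "scalar_closed X" "[:- Const c, 1:] * B \<in> coeffs_in X" shows "B \<in> coeffs_in X"
proof -
  have s: "coeff B n = coeff ([:- Const c, 1:] * B) (Suc n) + Const c * coeff B (Suc n)" for n by simp
  have "\<forall>n. degree B < n + t \<longrightarrow> coeff B n \<in> X" for t
  proof (induction t)
    case 0
    then show ?case using assms by (auto simp: coeff_eq_0 scalar_closed_simps)
  next
    case (Suc t)
    show ?case
    proof (intro allI impI)
      fix n assume "degree B < n + Suc t"
      then have "coeff B (Suc n) \<in> X" using Suc by simp
      moreover have "coeff ([:- Const c, 1:] * B) (Suc n) \<in> X" using assms(2) unfolding coeffs_in_def by blast
      ultimately show "coeff B n \<in> X" by (subst s) (intro scalar_closed_simps(2,3) assms(1))
    qed
  qed
  from this[of "Suc (degree B)"] show ?thesis unfolding coeffs_in_def by simp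
qed

text \<open>The generalized rows \<open>u - \<mu> v\<close>, with \<open>\<mu>\<close> the variable of \<^typ>\<open>'k mpoly poly\<close>. The point \<open>\<mu> = \<infinity>\<close> is the row \<open>v\<close>.\<close>

definition row :: "(nat \<Rightarrow> 'k::comm_ring_1 mpoly) \<Rightarrow> (nat \<Rightarrow> 'k mpoly) \<Rightarrow> nat \<Rightarrow> 'k mpoly poly" where
  "row u v j = [:u j, - v j:]"

definition row_module :: "nat set \<Rightarrow> (nat \<Rightarrow> 'k::comm_ring_1 mpoly set) \<Rightarrow> (nat \<Rightarrow> 'k mpoly) \<Rightarrow> (nat \<Rightarrow> 'k mpoly) \<Rightarrow> 'k mpoly poly set" where
  "row_module J X u v = {\<Sum>j\<in>J. A j * row u v j | A. \<forall>j\<in>J. A j \<in> coeffs_in (X j)}"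

text \<open>\<open>X j\<close> is the space of coefficients admitted at column \<open>j\<close>: all of \<open>S\<close> for the ideal of minors, or the piece
  making the sum homogeneous of degree \<open>D\<close>. In the latter case columns of degree at least \<open>D\<close> drop out.\<close>

definition koszul :: "nat set \<Rightarrow> (nat \<Rightarrow> 'k::comm_ring_1 mpoly set) \<Rightarrow> (nat \<Rightarrow> 'k mpoly) \<Rightarrow> (nat \<Rightarrow> 'k mpoly) \<Rightarrow> bool" where
  "koszul J X u v \<longleftrightarrow> (\<forall>c0 c1. (c0, c1) \<noteq> (0, 0) \<longrightarrow> (\<forall>b. (\<forall>j\<in>J. b j \<in> X j) \<longrightarrow>
     (\<Sum>j\<in>J. b j * (Const c0 * u j + Const c1 * v j)) = 0 \<longrightarrow>
     (\<exists>e. (\<forall>i\<in>J. \<forall>j\<in>J. e j i = - e i j \<and> e i j * u j \<in> X i \<and> e i j * v j \<in> X i) \<and>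
          (\<forall>i\<in>J. e i i = 0) \<and>
          (\<forall>i\<in>J. b i = (\<Sum>j\<in>J. e i j * (Const c0 * u j + Const c1 * v j))))))"

lemma koszulE:
  assumes "koszul J X u v" "(s, t) \<noteq> (0, 0)" "\<And>j. j \<in> J \<Longrightarrow> b j \<in> X j"
    "(\<Sum>j\<in>J. b j * (Const s * u j + Const t * v j)) = 0"
  obtains e where "\<forall>i\<in>J. \<forall>j\<in>J. e j i = - e i j \<and> e i j * u j \<in> X i \<and> e i j * v j \<in> X i"
    "\<forall>i\<in>J. e i i = 0" "\<forall>i\<in>J. b i = (\<Sum>j\<in>J. e i j * (Const s * u j + Const t * v j))"
proof -
  have "\<forall>j\<in>J. b j \<in> X j" using assms(3) by blast
  from assms(1)[unfolded koszul_def, THEN spec[of _ s], THEN spec[of _ t], THEN mp, OF assms(2),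
      THEN spec[of _ b], THEN mp, OF this, THEN mp, OF assms(4)]
  show ?thesis by (elim exE conjE) (rule that)
qed

lemma poly_row: "poly (row u v j) (Const c) = Const 1 * u j + Const (- c) * v j"
  by (simp add: row_def Const_uminus)

text \<open>At \<mu> = c the coefficients form a syzygy of a generalized row, which is Koszul. The
  same antisymmetric matrix applied to the rows over S[\<mu>] gives a syzygy there; subtracting it
  leaves the sum unchanged and makes all coefficients vanish at c, hence divisible by \<mu> -
  c.\<close>

lemma row_module_torsion_free:
  fixes u v :: "nat \<Rightarrow> 'k::field mpoly"
  assumes J: "finite J" and X: "\<And>j. j \<in> J \<Longrightarrow> scalar_closed (X j)" and K: "koszul J X u v"
    and g: "[:- Const c, 1:] * g \<in> row_module J X u v"
  shows "g \<in> row_module J X u v"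
proof -
  obtain A where A: "[:- Const c, 1:] * g = (\<Sum>j\<in>J. A j * row u v j)" "\<forall>j\<in>J. A j \<in> coeffs_in (X j)"
    using g unfolding row_module_def by blast
  define b where "b j = poly (A j) (Const c)" for j
  have bX: "b j \<in> X j" if "j \<in> J" for j unfolding b_def using that A(2) X coeffs_in_poly by blast
  have "poly ([:- Const c, 1:] * g) (Const c) = 0" by simp
  then have sum0: "(\<Sum>j\<in>J. b j * (Const 1 * u j + Const (- c) * v j)) = 0"
    unfolding A(1) b_def by (simp add: poly_sum poly_row)
  have ne: "(1 :: 'k, - c) \<noteq> (0, 0)" by simp
  obtain e where E: "\<forall>i\<in>J. \<forall>j\<in>J. e j i = - e i j \<and> e i j * u j \<in> X i \<and> e i j * v j \<in> X i"
    "\<forall>i\<in>J. e i i = 0" "\<forall>i\<in>J. b i = (\<Sum>j\<in>J. e i j * (Const 1 * u j + Const (- c) * v j))"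
    by (rule koszulE[OF K ne bX sum0]) (assumption, rule that)
  then have e: "\<And>i j. i \<in> J \<Longrightarrow> j \<in> J \<Longrightarrow> e j i = - e i j"
    "\<And>i j. i \<in> J \<Longrightarrow> j \<in> J \<Longrightarrow> e i j * u j \<in> X i" "\<And>i j. i \<in> J \<Longrightarrow> j \<in> J \<Longrightarrow> e i j * v j \<in> X i"
    "\<And>i. i \<in> J \<Longrightarrow> e i i = 0" 
    "\<And>i. i \<in> J \<Longrightarrow> b i = (\<Sum>j\<in>J. e i j * (Const 1 * u j + Const (- c) * v j))"
    by blast+
  define A' where "A' j = A j - (\<Sum>l\<in>J. [:e j l:] * row u v l)" for j
  have A'X: "A' j \<in> coeffs_in (X j)" if j: "j \<in> J" for j
  proof -
    have "[:e j l:] * row u v l \<in> coeffs_in (X j)" if l: "l \<in> J" for l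
    proof -
      have "[:e j l:] * row u v l = [:e j l * u l, - (e j l * v l):]" by (simp add: row_def)
      then show ?thesis using e(2,3)[OF j l] X[OF j] by (simp add: coeffs_in_pCons scalar_closed_simps coeffs_in_0)
    qed
    then have "(\<Sum>l\<in>J. [:e j l:] * row u v l) \<in> coeffs_in (X j)" by (rule coeffs_in_sum[OF X[OF j]])
    moreover have "A j \<in> coeffs_in (X j)" using A(2) j by simp
    ultimately show ?thesis unfolding A'_def using coeffs_in_diff[OF X[OF j]] by simp
  qed
  have "(\<Sum>j\<in>J. (\<Sum>l\<in>J. [:e j l:] * row u v l) * row u v j) = 0"
  proof (rule antisym_syzygy_0[OF J])
    show "[:e j i:] = - [:e i j:]" if "i \<in> J" "j \<in> J" for i j using e(1)[OF that] by simp
    show "[:e i i:] = 0" if "i \<in> J" for i using e(4)[OF that] by simp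
  qed
  then have sA': "(\<Sum>j\<in>J. A' j * row u v j) = [:- Const c, 1:] * g"
    unfolding A(1) A'_def by (simp add: left_diff_distrib sum_subtractf)
  have "\<forall>j\<in>J. \<exists>B. A' j = [:- Const c, 1:] * B"
  proof
    fix j assume "j \<in> J"
    then have "poly (A' j) (Const c) = 0"
      unfolding A'_def using e(5)[of j] by (simp add: b_def poly_sum poly_row)
    then show "\<exists>B. A' j = [:- Const c, 1:] * B" unfolding poly_eq_0_iff_dvd by (rule dvdE) blast
  qed
  then obtain B where B: "\<And>j. j \<in> J \<Longrightarrow> A' j = [:- Const c, 1:] * B j" by metis
  have "[:- Const c, 1:] * (g - (\<Sum>j\<in>J. B j * row u v j)) = 0"
    unfolding right_diff_distrib sA'[symmetric] sum_distrib_left using B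
    by (simp add: mult.assoc[symmetric] del: mult_pCons_left)
  then have "g = (\<Sum>j\<in>J. B j * row u v j)" using linear_factor_cancel by fastforce
  moreover have "B j \<in> coeffs_in (X j)" if "j \<in> J" for j
    by (rule coeffs_in_linear_factor[OF X[OF that], where c = c], subst B[OF that, symmetric], rule A'X[OF that])
  ultimately show ?thesis unfolding row_module_def by blast
qed

text \<open>D splits into linear factors over the algebraically closed field, and
  \<open>row_module_torsion_free\<close> removes them one by one.\<close>

lemma row_module_torsion_free':
  fixes u v :: "nat \<Rightarrow> 'k::field mpoly"
  assumes alg: "alg_closed_field TYPE('k)"
    and J: "finite J" and X: "\<And>j. j \<in> J \<Longrightarrow> scalar_closed (X j)" and K: "koszul J X u v"
    and D: "D \<noteq> 0" and g: "cpoly D * g \<in> row_module J X u v"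
  shows "g \<in> row_module J X u v"
  using D g
proof (induction "degree D" arbitrary: D)
  case 0
  then obtain c where D: "D = [:c:]" by (metis degree_eq_zeroE)
  then have c: "D = [:c:]" "c \<noteq> 0" using 0 by auto
  obtain A where A: "cpoly D * g = (\<Sum>j\<in>J. A j * row u v j)" "\<forall>j\<in>J. A j \<in> coeffs_in (X j)"
    using 0(3) unfolding row_module_def by blast
  have "g = cpoly [:inverse c:] * (cpoly D * g)"
    unfolding mult.assoc[symmetric] cpoly_mult[symmetric] using c by simp
  also have "\<dots> = (\<Sum>j\<in>J. (cpoly [:inverse c:] * A j) * row u v j)"
    unfolding A(1) sum_distrib_left mult.assoc ..
  finally have "g = (\<Sum>j\<in>J. (cpoly [:inverse c:] * A j) * row u v j)" .
  moreover have "\<forall>j\<in>J. cpoly [:inverse c:] * A j \<in> coeffs_in (X j)" using A(2) X coeffs_in_cpoly_mult by blast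
  ultimately show ?case unfolding row_module_def mem_Collect_eq by (intro exI[of _ "\<lambda>j. cpoly [:inverse c:] * A j"]) blast
next
  case (Suc n)
  then obtain c where "poly D c = 0" using alg unfolding alg_closed_field_def by (metis Suc_le_mono Suc_leI One_nat_def le0)
  then obtain q where q: "D = [:- c, 1:] * q" unfolding poly_eq_0_iff_dvd by (rule dvdE)
  then have "q \<noteq> 0" using Suc by auto
  then have "n = degree q" using q Suc.hyps(2) by (simp add: degree_mult_eq del: mult_pCons_left)
  have "cpoly D * g = [:- Const c, 1:] * (cpoly q * g)"
    unfolding q cpoly_mult mult.assoc by (simp add: Const_uminus)
  then have "cpoly q * g \<in> row_module J X u v" using row_module_torsion_free[OF J X K] Suc.prems(2) by metis
  then show ?case using Suc.hyps(1)[OF \<open>n = degree q\<close> \<open>q \<noteq> 0\<close>] by blast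
qed

text \<open>The same argument at \<mu> = \<infinity>: top coefficients that cancel form a syzygy of
  the row v, and adding a Koszul syzygy shifted by a power of \<mu> lowers the degree. The rows are
  linear in \<mu>, whence n against \<open>Suc n\<close>.\<close>

lemma row_module_degree_bound:
  fixes u v :: "nat \<Rightarrow> 'k::field mpoly"
  assumes J: "finite J" and X: "\<And>j. j \<in> J \<Longrightarrow> scalar_closed (X j)" and K: "koszul J X u v"
    and g: "g \<in> row_module J X u v" "degree g \<le> Suc n"
  obtains A where "g = (\<Sum>j\<in>J. A j * row u v j)" "\<And>j. j \<in> J \<Longrightarrow> A j \<in> coeffs_in (X j)" "\<And>j. j \<in> J \<Longrightarrow> degree (A j) \<le> n"
proof -
  have step: "\<exists>A. g = (\<Sum>j\<in>J. A j * row u v j) \<and> (\<forall>j\<in>J. A j \<in> coeffs_in (X j) \<and> degree (A j) \<le> n)"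
    if "\<exists>A. g = (\<Sum>j\<in>J. A j * row u v j) \<and> (\<forall>j\<in>J. A j \<in> coeffs_in (X j) \<and> degree (A j) \<le> n + N)" for N
    using that
  proof (induction N)
    case (Suc N)
    then obtain A where A: "g = (\<Sum>j\<in>J. A j * row u v j)"
      "\<And>j. j \<in> J \<Longrightarrow> A j \<in> coeffs_in (X j)" "\<And>j. j \<in> J \<Longrightarrow> degree (A j) \<le> Suc (n + N)" by auto
    define b where "b j = coeff (A j) (Suc (n + N))" for j
    have "coeff g (Suc (Suc (n + N))) = 0" using g(2) by (intro coeff_eq_0) simp
    moreover have "coeff (A j * row u v j) (Suc (Suc (n + N))) = - (b j * v j)" if "j \<in> J" for j
      using A(3)[OF that] unfolding row_def b_def
      by (simp add: coeff_eq_0)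
    ultimately have "- (\<Sum>j\<in>J. b j * v j) = 0"
      unfolding A(1) coeff_sum by (simp add: sum_negf)
    then have sum0: "(\<Sum>j\<in>J. b j * (Const 0 * u j + Const 1 * v j)) = 0" by simp
    have bX: "b j \<in> X j" if "j \<in> J" for j using A(2)[OF that] unfolding b_def coeffs_in_def by simp
    have ne: "(0, 1 :: 'k) \<noteq> (0, 0)" by simp
    obtain e where E: "\<forall>i\<in>J. \<forall>j\<in>J. e j i = - e i j \<and> e i j * u j \<in> X i \<and> e i j * v j \<in> X i"
      "\<forall>i\<in>J. e i i = 0" "\<forall>i\<in>J. b i = (\<Sum>j\<in>J. e i j * (Const 0 * u j + Const 1 * v j))"
      by (rule koszulE[OF K ne bX sum0]) (assumption, rule that)
    then have e: "\<And>i j. i \<in> J \<Longrightarrow> j \<in> J \<Longrightarrow> e j i = - e i j"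
      "\<And>i j. i \<in> J \<Longrightarrow> j \<in> J \<Longrightarrow> e i j * u j \<in> X i" "\<And>i j. i \<in> J \<Longrightarrow> j \<in> J \<Longrightarrow> e i j * v j \<in> X i"
      "\<And>i. i \<in> J \<Longrightarrow> e i i = 0" 
      "\<And>i. i \<in> J \<Longrightarrow> b i = (\<Sum>j\<in>J. e i j * (Const 0 * u j + Const 1 * v j))"
      by blast+
    \<comment> \<open>The sign is opposite to the one at a finite point because the
      \<mu>-coefficient of \<open>row u v l\<close> is \<open>- v l\<close>.\<close>
    define A' where "A' j = A j + (\<Sum>l\<in>J. monom (e j l) (n + N) * row u v l)" for j
    have cm: "coeff (monom x s * row u v l) t = (if t = s then x * u l else 0) - (if t = Suc s then x * v l else 0)" for x s l t
      unfolding row_def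
      by (simp add: coeff_monom_mult coeff_pCons split: nat.splits)
    have "degree (A' j) \<le> n + N" if j: "j \<in> J" for j
    proof (rule degree_le, intro allI impI)
      fix t assume t: "n + N < t"
      show "coeff (A' j) t = 0"
      proof (cases "t = Suc (n + N)")
        case True
        then show ?thesis unfolding A'_def coeff_add coeff_sum cm using e(5)[OF j]
          by (simp add: b_def sum_negf)
      next
        case False
        then show ?thesis unfolding A'_def coeff_add coeff_sum cm using A(3)[OF j] t
          by (simp add: coeff_eq_0)
      qed
    qed
    moreover have "A' j \<in> coeffs_in (X j)" if j: "j \<in> J" for j
    proof -
      have "monom (e j l) (n + N) * row u v l \<in> coeffs_in (X j)" if "l \<in> J" for l
        unfolding coeffs_in_def mem_Collect_eq cm using e(2,3)[OF j that] X[OF j] by (auto simp: scalar_closed_simps)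
      then have "(\<Sum>l\<in>J. monom (e j l) (n + N) * row u v l) \<in> coeffs_in (X j)" by (rule coeffs_in_sum[OF X[OF j]])
      then show ?thesis unfolding A'_def using coeffs_in_add[OF X[OF j] A(2)[OF j]] by simp
    qed
    moreover have "g = (\<Sum>j\<in>J. A' j * row u v j)"
    proof -
      have "(\<Sum>j\<in>J. (\<Sum>l\<in>J. monom (e j l) (n + N) * row u v l) * row u v j) = 0"
      proof (rule antisym_syzygy_0[OF J])
        show "monom (e j i) (n + N) = - monom (e i j) (n + N)" if "i \<in> J" "j \<in> J" for i j
          using e(1)[OF that] by (simp add: minus_monom)
        show "monom (e i i) (n + N) = 0" if "i \<in> J" for i using e(4)[OF that] by simp
      qed
      then show ?thesis unfolding A(1) A'_def by (simp add: distrib_right sum.distrib)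
    qed
    ultimately show ?case using Suc.IH by blast
  qed simp
  obtain A where A: "g = (\<Sum>j\<in>J. A j * row u v j)" "\<And>j. j \<in> J \<Longrightarrow> A j \<in> coeffs_in (X j)"
    using g(1) unfolding row_module_def by blast
  have "degree (A j) \<le> n + (\<Sum>j\<in>J. degree (A j))" if "j \<in> J" for j
    using member_le_sum[OF that, of "\<lambda>j. degree (A j)"] J by simp
  then have "\<exists>A. g = (\<Sum>j\<in>J. A j * row u v j) \<and> (\<forall>j\<in>J. A j \<in> coeffs_in (X j) \<and> degree (A j) \<le> n)"
    using A by (intro step) blast
  then show ?thesis using that by blast
qed

section \<open>From regularity in the localization to graded Koszul syzygies\<close>

context weights
begin

lemmas Sw_intros = PolyOn_Const[of _ "Vars k a", folded Sw_PolyOn] PolyOn_0[of "Vars k a", folded Sw_PolyOn]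
  PolyOn_1[of "Vars k a", folded Sw_PolyOn] PolyOn_add[of _ "Vars k a", folded Sw_PolyOn]
  PolyOn_diff[of _ "Vars k a", folded Sw_PolyOn] PolyOn_uminus[of _ "Vars k a", folded Sw_PolyOn]
  PolyOn_mult[of _ "Vars k a", folded Sw_PolyOn] PolyOn_sum[of _ _ "Vars k a", folded Sw_PolyOn]
  PolyOn_Var[of _ "Vars k a", folded Sw_PolyOn]

text \<open>Only the trivial monomial has weight 0. Positivity of the weights is known on
  \<open>Vars k a\<close> only, whence the restriction to \<open>Sw k a\<close>.\<close>

lemma hcomp_0_Sw:
  assumes "u \<in> Sw k a" shows "hcomp m 0 u = Const (const_term u)"
proof (rule poly_mapping_eqI)
  fix x
  show "lookup (hcomp m 0 u) x = lookup (Const (const_term u)) x"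
  proof (cases "x = 0")
    case True
    then show ?thesis by (simp add: lookup_hcomp Const_def const_term_def)
  next
    case False
    then have c: "lookup (Const (const_term u)) x = 0" by (simp add: Const_def lookup_single)
    have "wdeg m x \<noteq> 0" if "x \<in> keys u"
    proof -
      obtain v where v: "v \<in> keys x" using False by (metis equals0I keys_eq_empty)
      then have "v \<in> Vars k a" using that assms unfolding Sw_PolyOn PolyOn_iff by blast
      then have "m (fst v) > 0" using m_pos unfolding Vars_def by auto
      then have "lookup x v * m (fst v) > 0" using v by (simp add: in_keys_iff)
      then show ?thesis using v finite_keys[of x] unfolding wdeg_def
        using member_le_sum[of v "keys x" "\<lambda>v. lookup x v * m (fst v)"] by linarith
    qed
    then have "wdeg m x = 0 \<Longrightarrow> lookup u x = 0" using not_in_keys_iff_lookup_eq_zero by metis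
    then show ?thesis using c by (simp add: lookup_hcomp)
  qed
qed

lemma gen_ideal_Sw_image:
  "finite J \<Longrightarrow> g \<in> gen_ideal (Sw k a) (f ` J) \<longleftrightarrow> (\<exists>b. (\<forall>j\<in>J. b j \<in> Sw k a) \<and> g = (\<Sum>j\<in>J. b j * f j))"
  by (rule gen_ideal_image) (auto simp: Sw_PolyOn)

lemma gen_ideal_Sw_closed:
  assumes "finite J"
  shows "0 \<in> gen_ideal (Sw k a) (f ` J)"
    "x \<in> gen_ideal (Sw k a) (f ` J) \<Longrightarrow> y \<in> gen_ideal (Sw k a) (f ` J) \<Longrightarrow> x - y \<in> gen_ideal (Sw k a) (f ` J)"
    "x \<in> gen_ideal (Sw k a) (f ` J) \<Longrightarrow> y \<in> gen_ideal (Sw k a) (f ` J) \<Longrightarrow> x + y \<in> gen_ideal (Sw k a) (f ` J)"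
    "x \<in> gen_ideal (Sw k a) (f ` J) \<Longrightarrow> r \<in> Sw k a \<Longrightarrow> r * x \<in> gen_ideal (Sw k a) (f ` J)"
proof -
  note G = gen_ideal_Sw_image[OF assms, of _ f]
  show "0 \<in> gen_ideal (Sw k a) (f ` J)" unfolding G by (rule exI[of _ "\<lambda>_. 0"]) (simp add: Sw_PolyOn)
  { assume "x \<in> gen_ideal (Sw k a) (f ` J)" "y \<in> gen_ideal (Sw k a) (f ` J)"
    then obtain b c where "\<forall>j\<in>J. b j \<in> Sw k a" "x = (\<Sum>j\<in>J. b j * f j)" "\<forall>j\<in>J. c j \<in> Sw k a" "y = (\<Sum>j\<in>J. c j * f j)"
      unfolding G by blast
    then show "x - y \<in> gen_ideal (Sw k a) (f ` J)" "x + y \<in> gen_ideal (Sw k a) (f ` J)" unfolding G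
      by - (rule exI[of _ "\<lambda>j. b j - c j"], force simp: left_diff_distrib sum_subtractf Sw_PolyOn,
         rule exI[of _ "\<lambda>j. b j + c j"], force simp: distrib_right sum.distrib Sw_PolyOn) }
  { assume "x \<in> gen_ideal (Sw k a) (f ` J)" "r \<in> Sw k a"
    then obtain b where "\<forall>j\<in>J. b j \<in> Sw k a" "x = (\<Sum>j\<in>J. b j * f j)" "r \<in> Sw k a" unfolding G by blast
    then show "r * x \<in> gen_ideal (Sw k a) (f ` J)" unfolding G
      by (intro exI[of _ "\<lambda>j. r * b j"]) (auto simp: sum_distrib_left Sw_PolyOn mult.assoc) }
qed

lemma gen_ideal_Sw_sum:
  assumes "finite J" "\<And>t. t \<in> T \<Longrightarrow> h t \<in> gen_ideal (Sw k a) (f ` J)"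
  shows "sum h T \<in> gen_ideal (Sw k a) (f ` J)"
  using assms(2) by (induction T rule: infinite_finite_induct) (simp_all add: gen_ideal_Sw_closed[OF assms(1)])

text \<open>The ideal is homogeneous, and the degree D part of \<open>u * g\<close> is the nonzero
  constant \<open>const_term u\<close> times that of g plus multiples of lower parts of g. Induction
  on D puts every component of g into the ideal, so nothing is gained by localizing.\<close>

lemma in_loc_ext_homog:
  fixes f :: "nat \<Rightarrow> 'k::field mpoly"
  assumes J: "finite J" and f: "\<And>j. j \<in> J \<Longrightarrow> f j \<in> Sw k a \<and> homog m (d j) (f j)"
    and g: "g \<in> Sw k a" "in_loc_ext (Sw k a) (gen_ideal (Sw k a) (f ` J)) g"
  shows "g \<in> gen_ideal (Sw k a) (f ` J)"
proof -
  let ?I = "gen_ideal (Sw k a) (f ` J)"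
  note cl = gen_ideal_Sw_closed[OF J, where f = f]
  obtain u where u: "u \<in> Sw k a" "const_term u \<noteq> 0" "u * g \<in> ?I" using g unfolding in_loc_ext_def by blast
  have hc: "hcomp m D x \<in> ?I" if x: "x \<in> ?I" for x D
  proof -
    obtain b where b: "\<forall>j\<in>J. b j \<in> Sw k a" "x = (\<Sum>j\<in>J. b j * f j)"
      using x unfolding gen_ideal_Sw_image[OF J] by blast
    have "hcomp m D x = (\<Sum>j\<in>J. (if d j \<le> D then hcomp m (D - d j) (b j) else 0) * f j)"
      unfolding b(2) hcomp_sum
    proof (rule sum.cong[OF refl])
      fix j assume "j \<in> J"
      then have "homog m (d j) (f j)" using f by blast
      from hcomp_mult_homog'[OF this] show "hcomp m D (b j * f j) = (if d j \<le> D then hcomp m (D - d j) (b j) else 0) * f j"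
        by simp
    qed
    then show ?thesis unfolding gen_ideal_Sw_image[OF J]
      using b(1) by (intro exI[of _ "\<lambda>j. if d j \<le> D then hcomp m (D - d j) (b j) else 0"]) (auto simp: Sw_PolyOn)
  qed
  have comp: "hcomp m D g \<in> ?I" for D
  proof (induction D rule: less_induct)
    case (less D)
    define T where "T = insert 0 (wdeg m ` keys u)"
    have T: "finite T" "0 \<in> T" unfolding T_def by auto
    have us: "u = (\<Sum>e\<in>T. hcomp m e u)" by (rule sum_hcomp) (auto simp: T_def)
    have "hcomp m D (u * g) = (\<Sum>e\<in>T. hcomp m D (hcomp m e u * g))"
      by (subst us) (simp add: sum_distrib_right hcomp_sum)
    also have "\<dots> = (\<Sum>e\<in>T. if e \<le> D then hcomp m e u * hcomp m (D - e) g else 0)"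
      by (simp add: hcomp_mult_homog[OF hcomp_homog])
    also have "\<dots> = Const (const_term u) * hcomp m D g + (\<Sum>e\<in>T - {0}. if e \<le> D then hcomp m e u * hcomp m (D - e) g else 0)"
      using T by (simp add: sum.remove hcomp_0_Sw[OF u(1)])
    finally have "Const (const_term u) * hcomp m D g = hcomp m D (u * g) - (\<Sum>e\<in>T - {0}. if e \<le> D then hcomp m e u * hcomp m (D - e) g else 0)"
      by simp
    moreover have "(\<Sum>e\<in>T - {0}. if e \<le> D then hcomp m e u * hcomp m (D - e) g else 0) \<in> ?I"
    proof (rule gen_ideal_Sw_sum[OF J])
      fix t assume t: "t \<in> T - {0}"
      have "hcomp m t u \<in> Sw k a" using u(1) by (auto simp: Sw_PolyOn)
      then show "(if t \<le> D then hcomp m t u * hcomp m (D - t) g else 0) \<in> ?I"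
        using less[of "D - t"] t cl(1,4) by auto
    qed
    ultimately have "Const (const_term u) * hcomp m D g \<in> ?I" using cl(2)[OF hc[OF u(3)]] by simp
    then have "Const (inverse (const_term u)) * (Const (const_term u) * hcomp m D g) \<in> ?I"
      by (rule cl(4)) (simp add: Sw_PolyOn)
    then show ?case using u(2) unfolding mult.assoc[symmetric] Const_mult[symmetric] by simp
  qed
  have g_sum: "g = (\<Sum>D\<in>wdeg m ` keys g. hcomp m D g)" by (rule sum_hcomp) auto
  show ?thesis by (subst g_sum, rule gen_ideal_Sw_sum[OF J], rule comp)
qed

text \<open>The last entry is regular modulo its predecessors, so - b_n is a combination of them
  with coefficients c_j. Subtracting the Koszul relations c_j between f_j and f_n leaves a syzygy of
  the shorter sequence; the c_j become the last row and column of the antisymmetric matrix.\<close>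

lemma regular_koszul:
  fixes f :: "nat \<Rightarrow> 'k::field mpoly"
  assumes f: "\<And>j. j < n \<Longrightarrow> f j \<in> Sw k a"
    and reg: "\<And>i g. i < n \<Longrightarrow> g \<in> Sw k a \<Longrightarrow> f i * g \<in> gen_ideal (Sw k a) (f ` {..<i}) \<Longrightarrow>
        g \<in> gen_ideal (Sw k a) (f ` {..<i})"
    and b: "\<And>j. j < n \<Longrightarrow> b j \<in> Sw k a" "(\<Sum>j<n. b j * f j) = 0"
  shows "\<exists>e. (\<forall>i<n. \<forall>j<n. e i j \<in> Sw k a \<and> e j i = - e i j) \<and> (\<forall>i<n. e i i = 0) \<and>
     (\<forall>i<n. b i = (\<Sum>j<n. e i j * f j))"
  using assms
proof (induction n arbitrary: b)
  case (Suc n)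
  have "f n * - b n = (\<Sum>j<n. b j * f j)" using Suc.prems(4) by (simp add: mult.commute neg_eq_iff_add_eq_0 add.commute)
  then have "f n * - b n \<in> gen_ideal (Sw k a) (f ` {..<n})"
    unfolding gen_ideal_Sw_image[OF finite_lessThan] using Suc.prems(3) by (intro exI[of _ b]) auto
  moreover have "- b n \<in> Sw k a" using Suc.prems(3) by (auto simp: Sw_PolyOn)
  ultimately have "- b n \<in> gen_ideal (Sw k a) (f ` {..<n})" using Suc.prems(2) by blast
  then obtain c where c: "\<forall>j<n. c j \<in> Sw k a" "- b n = (\<Sum>j<n. c j * f j)"
    unfolding gen_ideal_Sw_image[OF finite_lessThan] by auto
  define b' where "b' j = b j - c j * f n" for j
  have "(\<Sum>j<n. b' j * f j) = (\<Sum>j<n. b j * f j) - (\<Sum>j<n. c j * f j) * f n"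
    unfolding b'_def left_diff_distrib sum_subtractf sum_distrib_right by (simp only: mult_ac)
  also have "\<dots> = 0" unfolding c(2)[symmetric] using Suc.prems(4) by simp
  finally have b'0: "(\<Sum>j<n. b' j * f j) = 0" .
  have b'S: "b' j \<in> Sw k a" if "j < n" for j
    unfolding b'_def using Suc.prems(1,3) c(1) that by (intro Sw_intros) auto
  have "\<exists>e. (\<forall>i<n. \<forall>j<n. e i j \<in> Sw k a \<and> e j i = - e i j) \<and> (\<forall>i<n. e i i = 0) \<and>
     (\<forall>i<n. b' i = (\<Sum>j<n. e i j * f j))"
    by (rule Suc.IH) (use Suc.prems(1,2) b'S b'0 in \<open>simp_all add: less_Suc_eq\<close>)
  then obtain e where e: "\<forall>i<n. \<forall>j<n. e i j \<in> Sw k a \<and> e j i = - e i j" "\<forall>i<n. e i i = 0"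
    "\<forall>i<n. b' i = (\<Sum>j<n. e i j * f j)"
    by (elim exE conjE) (rule that)
  define e' where "e' i j = (if i < n then (if j < n then e i j else c i) else (if j < n then - c j else 0))" for i j
  have "b i = (\<Sum>j<Suc n. e' i j * f j)" if "i < Suc n" for i
  proof (cases "i < n")
    case True
    then have "(\<Sum>j<Suc n. e' i j * f j) = b' i + c i * f n" using e(3) by (simp add: e'_def)
    then show ?thesis by (simp add: b'_def)
  next
    case False
    then have "(\<Sum>j<Suc n. e' i j * f j) = - (\<Sum>j<n. c j * f j)" by (simp add: e'_def sum_negf)
    then show ?thesis using False that c(2) by (metis less_antisym minus_minus)
  qed
  moreover have "e' i j \<in> Sw k a" for i j
  proof -
    have "e i j \<in> Sw k a" if "i < n" "j < n" using e(1) that by blast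
    then show ?thesis unfolding e'_def using c(1) by (auto intro!: Sw_intros)
  qed
  moreover have "e' j i = - e' i j" for i j
  proof (cases "i < n \<and> j < n")
    case True
    then have "e j i = - e i j" using e(1) by blast
    then show ?thesis unfolding e'_def using True by simp
  qed (auto simp: e'_def)
  moreover have "e' i i = 0" for i unfolding e'_def using e(2) by simp
  ultimately show ?case by (intro exI[of _ e']) blast
qed simp

text \<open>Only the component of \<open>e i j\<close> in degree D - d i - d j contributes to b i in
  degree D - d i. This degree is symmetric in i and j, so dropping the other components keeps
  antisymmetry.\<close>

lemma koszul_graded:
  fixes f :: "nat \<Rightarrow> 'k::field mpoly"
  assumes f: "\<And>j. j < n \<Longrightarrow> homog m (d j) (f j)"
    and e: "\<forall>i<n. \<forall>j<n. e i j \<in> Sw k a \<and> e j i = - e i j" "\<forall>i<n. e i i = 0" "\<forall>i<n. b i = (\<Sum>j<n. e i j * f j)"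
    and b: "\<And>i. i < n \<Longrightarrow> d i \<le> D \<Longrightarrow> homog m (D - d i) (b i)" "\<And>i. i < n \<Longrightarrow> D < d i \<Longrightarrow> b i = 0"
  shows "\<exists>e. (\<forall>i<n. \<forall>j<n. e i j \<in> Sw k a \<and> e j i = - e i j \<and>
       (if d i + d j \<le> D then homog m (D - d i - d j) (e i j) else e i j = 0)) \<and> (\<forall>i<n. e i i = 0) \<and>
     (\<forall>i<n. b i = (\<Sum>j<n. e i j * f j))"
proof -
  define e' where "e' i j = (if d i + d j \<le> D then hcomp m (D - d i - d j) (e i j) else 0)" for i j
  have "b i = (\<Sum>j<n. e' i j * f j)" if i: "i < n" for i
  proof (cases "d i \<le> D")
    case True
    have "b i = hcomp m (D - d i) (b i)" using b(1)[OF i True] by (simp add: hcomp_of_homog)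
    also have "\<dots> = (\<Sum>j<n. hcomp m (D - d i) (e i j * f j))" using e(3) i by (simp add: hcomp_sum)
    also have "\<dots> = (\<Sum>j<n. e' i j * f j)"
    proof (rule sum.cong[OF refl])
      fix j assume "j \<in> {..<n}"
      then have "hcomp m (D - d i) (e i j * f j) = (if d j \<le> D - d i then hcomp m (D - d i - d j) (e i j) * f j else 0)"
        using hcomp_mult_homog'[OF f] by simp
      moreover have "d j \<le> D - d i \<longleftrightarrow> d i + d j \<le> D" using True by auto
      ultimately show "hcomp m (D - d i) (e i j * f j) = e' i j * f j" unfolding e'_def by simp
    qed
    finally show ?thesis .
  next
    case False
    then show ?thesis using b(2)[OF i] by (simp add: e'_def)
  qed
  moreover have "e' i j \<in> Sw k a \<and> e' j i = - e' i j \<and> (if d i + d j \<le> D then homog m (D - d i - d j) (e' i j) else e' i j = 0)"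
    if "i < n" "j < n" for i j
  proof -
    have "e j i = - e i j" using e(1) that by blast
    moreover have "e' j i = (if d i + d j \<le> D then hcomp m (D - d i - d j) (e j i) else 0)"
      unfolding e'_def by (simp only: diff_commute[of D "d j"] add.commute[of "d j"])
    moreover have "e i j \<in> Sw k a" using e(1) that by blast
    ultimately show ?thesis by (auto simp: e'_def Sw_PolyOn hcomp_uminus)
  qed
  moreover have "e' i i = 0" if "i < n" for i unfolding e'_def using e(2) that by simp
  ultimately show ?thesis by (intro exI[of _ e']) blast
qed

end

section \<open>Pencils and triangular automorphisms\<close>

context vector_space
begin

lemma independent_family_eq:
  assumes "finite J" "inj_on w J" "independent (w ` J)"
    and eq: "(\<Sum>t\<in>J. scale (x t) (w t)) = (\<Sum>t\<in>J. scale (y t) (w t))" and t: "t \<in> J"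
  shows "x t = y t"
proof -
  define u where "u b = x (inv_into J w b) - y (inv_into J w b)" for b
  have "(\<Sum>b\<in>w ` J. scale (u b) b) = (\<Sum>t\<in>J. scale (x t - y t) (w t))"
    using assms(2) by (simp add: sum.reindex u_def)
  also have "\<dots> = 0" using eq by (simp add: scale_left_diff_distrib sum_subtractf)
  finally have "u (w t) = 0" using independentD[OF assms(3), of "w ` J" u "w t"] assms(1) t by auto
  then show ?thesis using assms(2) t by (simp add: u_def)
qed

lemma span_family:
  assumes "finite J" "x \<in> span (f ` J)" "inj_on f J"
  shows "\<exists>c. x = (\<Sum>j\<in>J. scale (c j) (f j))"
proof -
  obtain u where "x = (\<Sum>b\<in>f ` J. scale (u b) b)"
    using assms(2) unfolding span_finite[OF finite_imageI[OF assms(1)]] by blast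
  then have "x = (\<Sum>j\<in>J. scale (u (f j)) (f j))" using assms(3) by (simp add: sum.reindex)
  then show ?thesis by (rule exI[of _ "\<lambda>j. u (f j)"])
qed

lemma independent_familyI:
  assumes "finite J" and z: "\<And>c. (\<Sum>j\<in>J. scale (c j) (f j)) = 0 \<Longrightarrow> \<forall>j\<in>J. c j = 0"
  shows "inj_on f J \<and> independent (f ` J)"
proof -
  have inj: "inj_on f J"
  proof (rule inj_onI, rule ccontr)
    fix i j assume ij: "i \<in> J" "j \<in> J" "f i = f j" "i \<noteq> j"
    define c where "c t = (if t = i then 1 else 0) - (if t = j then 1 else (0::'a))" for t
    have "(\<Sum>t\<in>J. scale (c t) (f t)) = (\<Sum>t\<in>J. if t = i then f t else 0) - (\<Sum>t\<in>J. if t = j then f t else 0)"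
      unfolding c_def scale_left_diff_distrib sum_subtractf by (simp add: if_distrib[of "\<lambda>x. scale x _"] cong: if_cong)
    also have "\<dots> = 0" using ij assms(1) by simp
    finally have "c i = 0" using z ij(1) by blast
    then show False using ij by (simp add: c_def)
  qed
  moreover have "independent (f ` J)"
  proof (rule independent_if_scalars_zero)
    show "finite (f ` J)" using assms(1) by simp
    fix g x assume g: "(\<Sum>x\<in>f ` J. scale (g x) x) = 0" "x \<in> f ` J"
    then have "(\<Sum>j\<in>J. scale (g (f j)) (f j)) = 0" using inj by (simp add: sum.reindex)
    then show "g x = 0" using z[of "\<lambda>j. g (f j)"] g(2) by blast
  qed
  ultimately show ?thesis by simp
qed

text \<open>Indexing both bases by the same set makes the transition matrices square, and comparing
  coefficients gives both products, as \<open>change_of_coords\<close> asks for a two-sided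
  inverse.\<close>

lemma basis_change:
  assumes J: "finite J" and f: "inj_on f J" "independent (f ` J)" and w: "inj_on w J" "independent (w ` J)"
    and sp: "span (f ` J) = span (w ` J)"
  shows "\<exists>c c'. (\<forall>l\<in>J. w l = (\<Sum>j\<in>J. scale (c j l) (f j))) \<and> (\<forall>l\<in>J. f l = (\<Sum>j\<in>J. scale (c' j l) (w j))) \<and>
    (\<forall>j\<in>J. \<forall>l\<in>J. (\<Sum>t\<in>J. c j t * c' t l) = (if j = l then 1 else 0)) \<and>
    (\<forall>j\<in>J. \<forall>l\<in>J. (\<Sum>t\<in>J. c' j t * c t l) = (if j = l then 1 else 0))"
proof -
  have "\<forall>l\<in>J. \<exists>c. w l = (\<Sum>j\<in>J. scale (c j) (f j))"
    by (intro ballI span_family J f) (simp add: sp span_base)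
  then obtain c0 where c0: "\<And>l. l \<in> J \<Longrightarrow> w l = (\<Sum>j\<in>J. scale (c0 l j) (f j))" by metis
  have "\<forall>l\<in>J. \<exists>c. f l = (\<Sum>j\<in>J. scale (c j) (w j))"
    by (intro ballI span_family J w) (simp add: sp[symmetric] span_base)
  then obtain c1 where c1: "\<And>l. l \<in> J \<Longrightarrow> f l = (\<Sum>j\<in>J. scale (c1 l j) (w j))" by metis
  have comp: "(\<Sum>t\<in>J. x t j * y l t) = (if j = l then 1 else 0)"
    if x: "\<And>t. t \<in> J \<Longrightarrow> g t = (\<Sum>j\<in>J. scale (x t j) (h j))"
      and y: "\<And>l. l \<in> J \<Longrightarrow> h l = (\<Sum>t\<in>J. scale (y l t) (g t))"
      and h: "inj_on h J" "independent (h ` J)" and jl: "j \<in> J" "l \<in> J" for x y g h j l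
  proof -
    have "h l = (\<Sum>t\<in>J. scale (y l t) (g t))" by (rule y[OF jl(2)])
    also have "\<dots> = (\<Sum>t\<in>J. scale (y l t) (\<Sum>j\<in>J. scale (x t j) (h j)))"
      by (rule sum.cong[OF refl], rule arg_cong[of _ _ "scale _"], rule x)
    also have "\<dots> = (\<Sum>t\<in>J. \<Sum>j\<in>J. scale (y l t * x t j) (h j))" by (simp add: scale_sum_right)
    also have "\<dots> = (\<Sum>j\<in>J. \<Sum>t\<in>J. scale (y l t * x t j) (h j))" by (rule sum.swap)
    also have "\<dots> = (\<Sum>j\<in>J. scale (\<Sum>t\<in>J. x t j * y l t) (h j))" by (simp add: scale_sum_left mult.commute)
    finally have "h l = (\<Sum>j\<in>J. scale (\<Sum>t\<in>J. x t j * y l t) (h j))" .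
    moreover have "h l = (\<Sum>j\<in>J. scale (if j = l then 1 else 0) (h j))"
      using J jl(2) by (simp add: if_distrib[of "\<lambda>x. scale x _"] cong: if_cong)
    ultimately show ?thesis
      using independent_family_eq[OF J h, of "\<lambda>j. \<Sum>t\<in>J. x t j * y l t" "\<lambda>j. if j = l then 1 else 0" j] jl by simp
  qed
  have 1: "(\<Sum>t\<in>J. c0 t j * c1 l t) = (if j = l then 1 else 0)" if "j \<in> J" "l \<in> J" for j l
    by (rule comp[of w c0 f c1, OF c0 c1 f that])
  have 2: "(\<Sum>t\<in>J. c1 t j * c0 l t) = (if j = l then 1 else 0)" if "j \<in> J" "l \<in> J" for j l
    by (rule comp[of f c1 w c0, OF c1 c0 w that])
  show ?thesis
    by (rule exI[of _ "\<lambda>j l. c0 l j"], rule exI[of _ "\<lambda>j l. c1 l j"])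
      (intro conjI ballI c0 c1 1 2)
qed

end

text \<open>D plays the role of a nonzero maximal minor on the columns C, obtained by elimination
  without fractions: on C every right-hand side is solvable up to the factor D, and the rows stay
  independent at every \<epsilon> that is not a root of D.\<close>

lemma pencil_dichotomy_aux:
  fixes L :: "'i \<Rightarrow> 'c \<Rightarrow> 'k::field poly"
  assumes "finite T"
    and "\<And>v. (\<forall>c\<in>X. (\<Sum>j\<in>T. v j * L j c) = 0) \<Longrightarrow> \<forall>j\<in>T. v j = 0"
  shows "\<exists>D C. D \<noteq> 0 \<and> C \<subseteq> X \<and> (\<forall>w. \<exists>b. \<forall>c\<in>C. D * w c = (\<Sum>j\<in>T. b j * L j c)) \<and>
    (\<forall>\<epsilon>. poly D \<epsilon> \<noteq> 0 \<longrightarrow> (\<forall>t. (\<forall>c\<in>C. (\<Sum>j\<in>T. t j * poly (L j c) \<epsilon>) = 0) \<longrightarrow> (\<forall>j\<in>T. t j = 0)))"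
  using assms
proof (induction T rule: finite_induct)
  case empty
  then show ?case by (intro exI[of _ 1] exI[of _ "{}"]) auto
next
  case (insert n T)
  have ins: "(\<Sum>j\<in>insert n T. h j) = h n + (\<Sum>j\<in>T. h j)" for h :: "'i \<Rightarrow> 'z::comm_monoid_add"
    using insert.hyps by simp
  have nT: "j \<noteq> n" if "j \<in> T" for j using that insert.hyps by blast
  have noT: "\<forall>j\<in>T. v j = 0" if v: "\<forall>c\<in>X. (\<Sum>j\<in>T. v j * L j c) = 0" for v
  proof -
    have "(\<Sum>j\<in>T. (v(n := 0)) j * L j c) = (\<Sum>j\<in>T. v j * L j c)" for c
      by (intro sum.cong refl) (use nT in auto)
    then have "\<forall>c\<in>X. (\<Sum>j\<in>insert n T. (v(n := 0)) j * L j c) = 0" unfolding ins using v by simp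
    from insert.prems[OF this] show ?thesis using nT by auto
  qed
  have "\<exists>D C. D \<noteq> 0 \<and> C \<subseteq> X \<and> (\<forall>w. \<exists>b. \<forall>c\<in>C. D * w c = (\<Sum>j\<in>T. b j * L j c)) \<and>
    (\<forall>\<epsilon>. poly D \<epsilon> \<noteq> 0 \<longrightarrow> (\<forall>t. (\<forall>c\<in>C. (\<Sum>j\<in>T. t j * poly (L j c) \<epsilon>) = 0) \<longrightarrow> (\<forall>j\<in>T. t j = 0)))"
    by (rule insert.IH, rule noT)
  then obtain D C where D0: "D \<noteq> 0" "C \<subseteq> X" 
    "\<forall>w. \<exists>b. \<forall>c\<in>C. D * w c = (\<Sum>j\<in>T. b j * L j c)"
    "\<forall>\<epsilon>. poly D \<epsilon> \<noteq> 0 \<longrightarrow> (\<forall>t. (\<forall>c\<in>C. (\<Sum>j\<in>T. t j * poly (L j c) \<epsilon>) = 0) \<longrightarrow> (\<forall>j\<in>T. t j = 0))"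
    by (elim exE conjE) (rule that)
  have D: "D \<noteq> 0" "C \<subseteq> X" 
    "\<And>w. \<exists>b. \<forall>c\<in>C. D * w c = (\<Sum>j\<in>T. b j * L j c)"
    "\<And>\<epsilon> t. poly D \<epsilon> \<noteq> 0 \<Longrightarrow> \<forall>c\<in>C. (\<Sum>j\<in>T. t j * poly (L j c) \<epsilon>) = 0 \<Longrightarrow> \<forall>j\<in>T. t j = 0"
    using D0 by simp_all
  obtain b where b: "\<forall>c\<in>C. D * L n c = (\<Sum>j\<in>T. b j * L j c)" using D(3) by blast
  \<comment> \<open>Row n with the columns in C cleared. It is nonzero at some column c0, since
    otherwise D and the \<open>- b j\<close> would form a relation.\<close>
  define z where "z c = D * L n c - (\<Sum>j\<in>T. b j * L j c)" for c
  have "\<exists>c\<in>X. z c \<noteq> 0"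
  proof (rule ccontr)
    assume z: "\<not> ?thesis"
    define v where "v j = (if j = n then D else - b j)" for j
    have "(\<Sum>j\<in>T. v j * L j c) = - (\<Sum>j\<in>T. b j * L j c)" for c
      unfolding sum_negf[symmetric] by (intro sum.cong refl) (use nT in \<open>auto simp: v_def\<close>)
    then have "\<forall>c\<in>X. (\<Sum>j\<in>insert n T. v j * L j c) = 0" unfolding ins using z by (simp add: v_def z_def)
    from insert.prems[OF this] show False using D(1) by (simp add: v_def)
  qed
  then obtain c0 where c0: "c0 \<in> X" "z c0 \<noteq> 0" by blast
  have zC: "z c = 0" if "c \<in> C" for c using b that by (simp add: z_def)
  show ?case
  proof (intro exI[of _ "D * z c0"] exI[of _ "insert c0 C"] conjI allI impI)
    show "D * z c0 \<noteq> 0" using D(1) c0 by simp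
    show "insert c0 C \<subseteq> X" using c0 D(2) by simp
  next
    fix w :: "'c \<Rightarrow> 'k poly"
    obtain d where d: "\<forall>c\<in>C. D * w c = (\<Sum>j\<in>T. d j * L j c)" using D(3) by blast
    define y where "y = D * w c0 - (\<Sum>j\<in>T. d j * L j c0)"
    \<comment> \<open>Solve on C by d, then correct the defect y at c0 by a multiple of z, which
      vanishes on C.\<close>
    define e where "e j = (if j = n then y * D else z c0 * d j - y * b j)" for j
    have e: "(\<Sum>j\<in>insert n T. e j * L j c) = y * z c + z c0 * (\<Sum>j\<in>T. d j * L j c)" for c
    proof -
      have "(\<Sum>j\<in>T. e j * L j c) = (\<Sum>j\<in>T. z c0 * (d j * L j c) - y * (b j * L j c))"
        by (intro sum.cong refl) (use nT in \<open>auto simp: e_def algebra_simps\<close>)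
      also have "\<dots> = z c0 * (\<Sum>j\<in>T. d j * L j c) - y * (\<Sum>j\<in>T. b j * L j c)"
        by (simp add: sum_subtractf sum_distrib_left)
      finally have "(\<Sum>j\<in>T. e j * L j c) = z c0 * (\<Sum>j\<in>T. d j * L j c) - y * (\<Sum>j\<in>T. b j * L j c)" .
      then have "(\<Sum>j\<in>insert n T. e j * L j c) = y * D * L n c + (z c0 * (\<Sum>j\<in>T. d j * L j c) - y * (\<Sum>j\<in>T. b j * L j c))"
        unfolding ins by (simp add: e_def)
      also have "\<dots> = y * z c + z c0 * (\<Sum>j\<in>T. d j * L j c)"
        unfolding z_def[of c] by (simp add: right_diff_distrib)
      finally show ?thesis .
    qed
    show "\<exists>b. \<forall>c\<in>insert c0 C. D * z c0 * w c = (\<Sum>j\<in>insert n T. b j * L j c)"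
    proof (rule exI[of _ e], intro ballI)
      fix c assume "c \<in> insert c0 C"
      then show "D * z c0 * w c = (\<Sum>j\<in>insert n T. e j * L j c)"
        unfolding e using zC d by (cases "c = c0") (auto simp: y_def algebra_simps)
    qed
  next
    fix \<epsilon> t
    assume D0: "poly (D * z c0) \<epsilon> \<noteq> 0" and t: "\<forall>c\<in>insert c0 C. (\<Sum>j\<in>insert n T. t j * poly (L j c) \<epsilon>) = 0"
    define s where "s j = poly D \<epsilon> * t j + t n * poly (b j) \<epsilon>" for j
    have s: "(\<Sum>j\<in>T. s j * poly (L j c) \<epsilon>) + t n * poly (z c) \<epsilon> = poly D \<epsilon> * (\<Sum>j\<in>insert n T. t j * poly (L j c) \<epsilon>)" for c
      unfolding ins z_def s_def
      by (simp add: poly_sum sum_distrib_left sum.distrib distrib_right distrib_left algebra_simps)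
    have "\<forall>c\<in>C. (\<Sum>j\<in>T. s j * poly (L j c) \<epsilon>) = 0"
    proof
      fix c assume "c \<in> C"
      then show "(\<Sum>j\<in>T. s j * poly (L j c) \<epsilon>) = 0" using s[of c] t zC[of c] by simp
    qed
    moreover have "poly D \<epsilon> \<noteq> 0" using D0 by simp
    ultimately have s0: "\<forall>j\<in>T. s j = 0" using D(4)[of \<epsilon> s] by metis
    then have "t n * poly (z c0) \<epsilon> = 0" using s[of c0] t by simp
    then have tn: "t n = 0" using D0 by simp
    have "t j = 0" if "j \<in> T" for j using s0 that tn D0 unfolding s_def by auto
    then show "\<forall>j\<in>insert n T. t j = 0" using tn by simp
  qed
qed

text \<open>A relation of least total degree is primitive: if all its entries vanished at
  \<epsilon>, they could be divided by \<mu> - \<epsilon>. Primitivity later keeps the associated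
  element h nonzero in every finite fibre.\<close>

lemma pencil_dichotomy:
  fixes L :: "'i \<Rightarrow> 'c \<Rightarrow> 'k::field poly"
  assumes T: "finite T"
  obtains (rel) v where "\<And>c. c \<in> X \<Longrightarrow> (\<Sum>j\<in>T. v j * L j c) = 0" "\<And>\<epsilon>. \<exists>j\<in>T. poly (v j) \<epsilon> \<noteq> 0"
  | (inj) D where "D \<noteq> 0"
      "\<And>\<epsilon> t. poly D \<epsilon> \<noteq> 0 \<Longrightarrow> \<forall>c\<in>X. (\<Sum>j\<in>T. t j * poly (L j c) \<epsilon>) = 0 \<Longrightarrow> \<forall>j\<in>T. t j = 0"
proof (cases "\<forall>v. (\<forall>c\<in>X. (\<Sum>j\<in>T. v j * L j c) = 0) \<longrightarrow> (\<forall>j\<in>T. v j = 0)")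
  case True
  then obtain D C where DC: "D \<noteq> 0" "C \<subseteq> X" 
    "\<forall>\<epsilon>. poly D \<epsilon> \<noteq> 0 \<longrightarrow> (\<forall>t. (\<forall>c\<in>C. (\<Sum>j\<in>T. t j * poly (L j c) \<epsilon>) = 0) \<longrightarrow> (\<forall>j\<in>T. t j = 0))"
    using pencil_dichotomy_aux[OF T, of X L] by blast
  show ?thesis by (rule inj[OF DC(1)]) (use DC(2,3) in blast)
next
  case False
  let ?R = "\<lambda>v. (\<forall>c\<in>X. (\<Sum>j\<in>T. v j * L j c) = 0) \<and> \<not> (\<forall>j\<in>T. v j = 0)"
  have "\<exists>n v. ?R v \<and> (\<Sum>j\<in>T. degree (v j)) = n" using False by blast
  then obtain n where n: "\<exists>v. ?R v \<and> (\<Sum>j\<in>T. degree (v j)) = n"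
    and min: "\<And>n'. n' < n \<Longrightarrow> \<not> (\<exists>v. ?R v \<and> (\<Sum>j\<in>T. degree (v j)) = n')"
    by (subst (asm) exists_least_iff) blast
  from n obtain v where v: "?R v" "(\<Sum>j\<in>T. degree (v j)) = n" by blast
  show ?thesis
  proof (rule rel)
    show "(\<Sum>j\<in>T. v j * L j c) = 0" if "c \<in> X" for c using v that by blast
    fix \<epsilon>
    show "\<exists>j\<in>T. poly (v j) \<epsilon> \<noteq> 0"
    proof (rule ccontr)
      assume "\<not> ?thesis"
      then have "\<forall>j\<in>T. \<exists>w. v j = [:- \<epsilon>, 1:] * w" by (metis dvdE poly_eq_0_iff_dvd)
      then obtain w where w: "\<And>j. j \<in> T \<Longrightarrow> v j = [:- \<epsilon>, 1:] * w j" by metis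
      have "(\<Sum>j\<in>T. w j * L j c) = 0" if "c \<in> X" for c
      proof -
        have "[:- \<epsilon>, 1:] * (\<Sum>j\<in>T. w j * L j c) = (\<Sum>j\<in>T. v j * L j c)"
          unfolding sum_distrib_left using w by (simp add: mult.assoc[symmetric] del: mult_pCons_left)
        then show ?thesis using v(1) that by (metis linear_factor_cancel)
      qed
      moreover obtain j0 where j0: "j0 \<in> T" "v j0 \<noteq> 0" using v(1) by blast
      have w0: "w j0 \<noteq> 0" using w[OF j0(1)] j0(2) by auto
      have dg: "degree (v j) = Suc (degree (w j))" if "j \<in> T" "w j \<noteq> 0" for j
        using w[OF that(1)] that(2) by (simp add: degree_mult_eq del: mult_pCons_left)
      have "degree (w j) \<le> degree (v j)" if "j \<in> T" for j
        using dg[OF that] by (cases "w j = 0") auto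
      then have "(\<Sum>j\<in>T. degree (w j)) < (\<Sum>j\<in>T. degree (v j))"
        using dg[OF j0(1) w0] j0(1) T by (intro sum_strict_mono_ex1 ballI bexI[of _ j0]) auto
      ultimately show False using min[of "\<Sum>j\<in>T. degree (w j)"] v(2) w0 j0(1) by blast
    qed
  qed
qed

section \<open>Forms as vectors over the field, and graded coordinate changes\<close>

definition msc :: "'k::field \<Rightarrow> 'k mpoly \<Rightarrow> 'k mpoly" where
  "msc c p = Const c * p"

global_interpretation mp: vector_space msc
  by unfold_locales (simp_all add: msc_def Const_add Const_mult algebra_simps)

global_interpretation mpp: vector_space_pair msc msc ..

context weights
begin

text \<open>A variable of degree at least \<open>m i\<close> would by itself exceed the weight d.
  Graded substitutions therefore send lower polynomials to lower polynomials.\<close>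

lemma homog_low:
  assumes "p \<in> Sw k a" "homog m d p" "d < m i" shows "p \<in> PolyOn (Low i)"
  unfolding PolyOn_iff
proof (intro ballI subsetI)
  fix x v assume x: "x \<in> keys p" and v: "v \<in> keys x"
  then have V: "v \<in> Vars k a" using assms(1) unfolding Sw_PolyOn PolyOn_iff by blast
  have "lookup x v * m (fst v) \<le> wdeg m x" unfolding wdeg_def using v
    using member_le_sum[of v "keys x" "\<lambda>v. lookup x v * m (fst v)"] by simp
  moreover have "lookup x v \<ge> 1" using v by (simp add: in_keys_iff Suc_leI)
  then have "1 * m (fst v) \<le> lookup x v * m (fst v)" by (rule mult_le_mono1)
  moreover have "wdeg m x = d" using x assms(2) unfolding homog_def by blast
  ultimately have "m (fst v) < m i" using assms(3) by linarith
  then show "v \<in> Low i" using V unfolding Low_def by simp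
qed

lemma lower_poly_subst:
  assumes \<sigma>: "\<And>v. v \<in> Vars k a \<Longrightarrow> \<sigma> v \<in> Sw k a \<and> homog m (m (fst v)) (\<sigma> v)"
    and p: "lower_poly k a m i p"
  shows "lower_poly k a m i (subst \<sigma> p)"
proof -
  have V: "Low i \<subseteq> Vars k a" by (auto simp: Low_def)
  have "homog m (m i) (subst \<sigma> p)"
    by (rule homog_subst[of _ _ _ "Low i"]) (use p \<sigma> V in \<open>auto simp: lower_poly_iff\<close>)
  moreover have "subst \<sigma> p \<in> PolyOn (Low i)"
  proof (rule subst_PolyOn)
    show "p \<in> PolyOn (Low i)" using p by (simp add: lower_poly_iff)
    fix v assume "v \<in> Low i"
    then show "\<sigma> v \<in> PolyOn (Low i)" using \<sigma>[of v] by (intro homog_low[of _ "m (fst v)"]) (auto simp: Low_def)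
  qed
  ultimately show ?thesis by (simp add: lower_poly_iff)
qed

text \<open>The inverse is found by solving for the \<open>x(i, j)\<close> degree by degree.\<close>

lemma triangular_automorphism:
  fixes y :: "nat \<times> nat \<Rightarrow> 'k::field mpoly"
  assumes y: "\<And>v. v \<in> Vars k a \<Longrightarrow> y v \<in> Sw k a \<and> homog m (m (fst v)) (y v)"
    and low: "\<And>i j. i \<le> k \<Longrightarrow> j \<in> {1..a i} \<Longrightarrow>
        lower_poly k a m i (Var (i, j) - (\<Sum>l\<in>{1..a i}. Const (d' i l j) * y (i, l)))"
    and inv: "\<And>i l l'. i \<le> k \<Longrightarrow> l \<in> {1..a i} \<Longrightarrow> l' \<in> {1..a i} \<Longrightarrow>
        (\<Sum>j\<in>{1..a i}. d' i l j * d i j l') = (if l = l' then 1 else 0)"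
  obtains \<sigma> where "graded_aut k a m \<sigma>" "\<And>v. v \<in> Vars k a \<Longrightarrow> subst \<sigma> (y v) = Var v"
    "\<And>v. v \<in> Vars k a \<Longrightarrow> subst y (\<sigma> v) = Var v"
proof -
  \<comment> \<open>The desired \<sigma> satisfies \<sigma>(x) = (linear combination of variables of
    the same degree) + \<sigma>(q), where q involves lower variables only. F is this equation read
    as an iteration, started at the identity.\<close>
  define q where "q v = Var v - (\<Sum>l\<in>{1..a (fst v)}. Const (d' (fst v) l (snd v)) * y (fst v, l))" for v
  define F where "F \<tau> v = (\<Sum>l\<in>{1..a (fst v)}. Const (d' (fst v) l (snd v)) * Var (fst v, l)) + subst \<tau> (q v)"
    for \<tau> :: "nat \<times> nat \<Rightarrow> 'k mpoly" and v
  have q: "lower_poly k a m (fst v) (q v)" if "v \<in> Vars k a" for v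
    using that low[of "fst v" "snd v"] unfolding q_def Vars_def by auto
  define S where "S n = (F ^^ n) Var" for n
  have S_Suc: "S (Suc n) v = F (S n) v" for n v unfolding S_def by simp
  have good: "\<forall>v\<in>Vars k a. S n v \<in> Sw k a \<and> homog m (m (fst v)) (S n v)" for n
  proof (induction n)
    case 0
    then show ?case unfolding S_def by (auto simp: Sw_PolyOn PolyOn_Var homog_Var)
  next
    case (Suc n)
    show ?case
    proof
      fix v assume v: "v \<in> Vars k a"
      have "lower_poly k a m (fst v) (subst (S n) (q v))"
        by (rule lower_poly_subst[OF _ q[OF v]]) (use Suc in blast)
      then have 1: "subst (S n) (q v) \<in> Sw k a" "homog m (m (fst v)) (subst (S n) (q v))"
        unfolding lower_poly_iff using Low_subset by auto
      have "(\<Sum>l\<in>{1..a (fst v)}. Const (d' (fst v) l (snd v)) * Var (fst v, l)) \<in> Sw k a"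
        using v by (intro Sw_intros) (auto simp: Vars_def)
      moreover have "homog m (m (fst v)) (\<Sum>l\<in>{1..a (fst v)}. Const (d' (fst v) l (snd v)) * Var (fst v, l))"
        using homog_Var[of m "(fst v, _)"] by (intro homog_sum homog_Const_mult) simp
      ultimately show "S (Suc n) v \<in> Sw k a \<and> homog m (m (fst v)) (S (Suc n) v)"
        unfolding S_Suc F_def using 1 by (auto intro: Sw_intros)
    qed
  qed
  have stable: "\<forall>v\<in>Vars k a. fst v < n \<longrightarrow> S (Suc n) v = S n v" for n
  proof (induction n)
    case (Suc n)
    show ?case
    proof (intro ballI impI)
      fix v assume v: "v \<in> Vars k a" "fst v < Suc n"
      have "subst (S (Suc n)) (q v) = subst (S n) (q v)"
      proof (rule subst_cong)
        show "q v \<in> PolyOn (Low (fst v))" using q[OF v(1)] by (simp add: lower_poly_iff)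
        fix u assume "u \<in> Low (fst v)"
        then have "u \<in> Vars k a" "fst u < fst v" using Low_iff[of "fst v" u] v(1) by (auto simp: Vars_def)
        then show "S (Suc n) u = S n u" using Suc v(2) by auto
      qed
      then show "S (Suc (Suc n)) v = S (Suc n) v" unfolding S_Suc[of "Suc n"] S_Suc[of n] F_def by simp
    qed
  qed simp
  \<comment> \<open>Values at variables with first index i are stable from step i + 1 on, and first
    indices are at most k.\<close>
  define \<sigma> where "\<sigma> = S (Suc k)"
  have \<sigma>V: "\<sigma> v \<in> Sw k a \<and> homog m (m (fst v)) (\<sigma> v)" if "v \<in> Vars k a" for v
    using good that unfolding \<sigma>_def by blast
  have fixp: "\<sigma> v = F \<sigma> v" if "v \<in> Vars k a" for v
  proof -
    have "fst v < Suc k" using that by (auto simp: Vars_def)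
    then show ?thesis using stable[of "Suc k"] that unfolding \<sigma>_def S_Suc[of "Suc k", symmetric] by simp
  qed
  have y\<sigma>: "subst \<sigma> (y v) = Var v" if v: "v \<in> Vars k a" for v
  proof -
    obtain i l' where il: "v = (i, l')" "i \<le> k" "l' \<in> {1..a i}" using v by (auto simp: Vars_def)
    \<comment> \<open>The fixed point equation is a homogeneous linear system in z with matrix
      \<open>d' i\<close>; contraction with \<open>d i\<close> shows z = 0.\<close>
    define z where "z l = Var (i, l) - subst \<sigma> (y (i, l))" for l
    have "(\<Sum>l\<in>{1..a i}. Const (d' i l j) * z l) = 0" if j: "j \<in> {1..a i}" for j
    proof -
      have "(i, j) \<in> Vars k a" using il j by (auto simp: Vars_def)
      from fixp[OF this] have "(\<Sum>l\<in>{1..a i}. Const (d' i l j) * Var (i, l)) - (\<Sum>l\<in>{1..a i}. Const (d' i l j) * subst \<sigma> (y (i, l))) = 0"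
        unfolding F_def q_def by (simp add: subst_diff subst_sum subst_mult)
      then show ?thesis unfolding z_def by (simp add: right_diff_distrib sum_subtractf)
    qed
    then have "0 = (\<Sum>j\<in>{1..a i}. Const (d i j l') * (\<Sum>l\<in>{1..a i}. Const (d' i l j) * z l))" by simp
    also have "\<dots> = (\<Sum>j\<in>{1..a i}. \<Sum>l\<in>{1..a i}. Const (d' i l j * d i j l') * z l)"
      by (simp add: sum_distrib_left Const_mult mult_ac)
    also have "\<dots> = (\<Sum>l\<in>{1..a i}. \<Sum>j\<in>{1..a i}. Const (d' i l j * d i j l') * z l)" by (rule sum.swap)
    also have "\<dots> = (\<Sum>l\<in>{1..a i}. Const (if l = l' then 1 else 0) * z l)"
    proof (rule sum.cong[OF refl])
      fix l assume "l \<in> {1..a i}"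
      from inv[OF il(2) this il(3)]
      show "(\<Sum>j\<in>{1..a i}. Const (d' i l j * d i j l') * z l) = Const (if l = l' then 1 else 0) * z l"
        by (simp only: sum_distrib_right[symmetric] Const_sum[symmetric])
    qed
    also have "\<dots> = z l'" using il(3) by (simp add: if_distrib[of Const] if_distrib[of "\<lambda>x. x * _"] cong: if_cong)
    finally show ?thesis using il(1) by (simp add: z_def)
  qed
  have \<sigma>y: "subst y (\<sigma> v) = Var v" if v: "v \<in> Vars k a" for v
    using v
  proof (induction "fst v" arbitrary: v rule: less_induct)
    case less
    have "subst y (subst \<sigma> (q v)) = subst Var (q v)" unfolding subst_subst
    proof (rule subst_cong)
      show "q v \<in> PolyOn (Low (fst v))" using q[OF less.prems] by (simp add: lower_poly_iff)
      fix u assume "u \<in> Low (fst v)"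
      then have "u \<in> Vars k a" "fst u < fst v" using Low_iff[of "fst v" u] less.prems by (auto simp: Vars_def)
      then show "subst y (\<sigma> u) = Var u" using less.hyps by blast
    qed
    then have "subst y (\<sigma> v) = (\<Sum>l\<in>{1..a (fst v)}. Const (d' (fst v) l (snd v)) * y (fst v, l)) + q v"
      by (subst fixp[OF less.prems]) (simp add: F_def subst_add subst_sum subst_mult)
    then show ?case by (simp add: q_def)
  qed
  have maps: "subst \<tau> p \<in> Sw k a" if "p \<in> Sw k a" "\<And>v. v \<in> Vars k a \<Longrightarrow> \<tau> v \<in> Sw k a" for \<tau> and p :: "'k mpoly"
    using subst_PolyOn[of p "Vars k a" \<tau> "Vars k a"] that by (simp add: Sw_PolyOn)
  have id: "subst \<sigma> (subst y p) = p" "subst y (subst \<sigma> p) = p" if "p \<in> Sw k a" for p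
    using that subst_cong[of p "Vars k a" "\<lambda>v. subst \<sigma> (y v)" Var] subst_cong[of p "Vars k a" "\<lambda>v. subst y (\<sigma> v)" Var] y\<sigma> \<sigma>y
    by (simp_all add: subst_subst Sw_PolyOn)
  have "bij_betw (subst \<sigma>) (Sw k a) (Sw k a)"
    by (rule bij_betw_byWitness[where f' = "subst y"]) (use maps y \<sigma>V id in auto)
  then have "graded_aut k a m \<sigma>" unfolding graded_aut_def using \<sigma>V by blast
  then show ?thesis using that y\<sigma> \<sigma>y by blast
qed

end

section \<open>Normal form in one degree\<close>

lemma ex_map_eq:
  assumes "length ps = length vs" "distinct ps" shows "\<exists>f. map f ps = vs"
  using assms
proof (induction ps vs rule: list_induct2)
  case (Cons x xs y ys)
  then obtain f where "map f xs = ys" by auto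
  then have "map (f(x := y)) (x # xs) = y # ys" using Cons by auto
  then show ?case by (rule exI[of _ "f(x := y)"])
qed simp

lemma msc_linear_iff: "Vector_Spaces.linear msc msc f \<longleftrightarrow> (\<forall>x y. f (x + y) = f x + f y) \<and> (\<forall>c x. f (Const c * x) = Const c * f x)"
  unfolding Vector_Spaces.linear_iff by (simp add: mp.vector_space_axioms msc_def[symmetric])

context weights
begin

lemma lin_linear: "Vector_Spaces.linear msc msc (lin i)"
  unfolding msc_linear_iff by (simp add: lin_add lin_Const_mult)

definition injrow :: "nat \<Rightarrow> nat set \<Rightarrow> (nat \<Rightarrow> 'k::field mpoly) \<Rightarrow> bool" where
  "injrow i J w \<longleftrightarrow> (\<forall>c. lin i (\<Sum>j\<in>J. Const (c j) * w j) = 0 \<longrightarrow> (\<forall>j\<in>J. c j = 0))"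

text \<open>The shapes of Jordan and scroll blocks in \<open>is_block\<close>, with forms in place
  of variables: the coordinate change that turns these forms into variables is available only after
  all degrees have been treated.\<close>

definition nf_block :: "nat \<Rightarrow> 'k::field option \<times> 'k mpoly list \<Rightarrow> ('k mpoly \<times> 'k mpoly) list \<Rightarrow> bool" where
  "nf_block i b cs \<longleftrightarrow> snd b \<noteq> [] \<and> (\<exists>p. (\<forall>s. lower_poly k a m i (p s)) \<and>
    cs = (case fst b of
      Some e \<Rightarrow> map (\<lambda>s. (snd b ! s,
          (if s + 1 < length (snd b) then snd b ! (s + 1) else 0) + Const e * snd b ! s + p s)) [0..<length (snd b)]
    | None \<Rightarrow> map (\<lambda>s. (snd b ! s, snd b ! (s + 1) + (if s + 2 < length (snd b) then p (s + 1) else 0)))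
        [0..<length (snd b) - 1]))"

lemma lower_0 [simp]: "lower_poly k a m i 0"
  by (simp add: lower_poly_iff)

lemma Var_basis:
  assumes i: "i \<le> k"
  shows "inj_on (\<lambda>j. Var (i, j) :: 'k::field mpoly) {1..a i} \<and> mp.independent ((\<lambda>j. Var (i, j) :: 'k mpoly) ` {1..a i})"
proof (rule mp.independent_familyI)
  fix c :: "nat \<Rightarrow> 'k"
  assume "(\<Sum>j\<in>{1..a i}. msc (c j) (Var (i, j))) = 0"
  then have "vcoef (\<Sum>j\<in>{1..a i}. msc (c j) (Var (i, j))) (i, l) = 0" for l by simp
  moreover have "vcoef (\<Sum>j\<in>{1..a i}. msc (c j) (Var (i, j))) (i, l) = c l" if "l \<in> {1..a i}" for l
    using that by (simp add: vcoef_sum msc_def vcoef_Var if_distrib[of "\<lambda>x. _ * x"] cong: if_cong)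
  ultimately show "\<forall>j\<in>{1..a i}. c j = 0" by metis
qed simp

lemma lin_in_span: "lin i p \<in> mp.span ((\<lambda>j. Var (i, j)) ` {1..a i})"
  unfolding lin_def msc_def[symmetric] by (intro mp.span_sum mp.span_scale mp.span_base) auto

lemma span_Var:
  assumes i: "i \<le> k" and w: "w \<in> mp.span ((\<lambda>j. Var (i, j)) ` {1..a i})"
  shows "lin i w = w" "w \<in> Sw k a" "homog m (m i) w"
proof -
  interpret l: Vector_Spaces.linear msc msc "lin i" by (rule lin_linear)
  show 1: "lin i w = w" using w
  proof (induction rule: mp.span_induct)
    case base
    show ?case by (rule mp.subspaceI) (simp_all add: lin_add lin_Const_mult msc_def)
  next
    case (step x)
    then show ?case using i by (auto simp: lin_Var)
  qed
  show "w \<in> Sw k a" "homog m (m i) w" using lin_PolyOn[OF i, of w] lin_homog[of i w] 1 by simp_all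
qed

text \<open>Independence of the linear parts of the top entries identifies combinations of columns
  with a subspace V of linear forms. The linear parts of the bottom entries define g on V, and
  \<open>chain_decomposition\<close> applies to the inclusion and g. The chains are lifted to forms
  so that top entries are exact and all lower terms fall into the bottom row.\<close>

lemma normal_form:
  fixes u v :: "nat \<Rightarrow> 'k::field mpoly"
  assumes alg: "alg_closed_field TYPE('k)" and i: "i \<le> k" and ps: "distinct ps"
    and uv: "\<And>j. j \<in> set ps \<Longrightarrow> u j \<in> Sw k a \<and> homog m (m i) (u j)" 
      "\<And>j. j \<in> set ps \<Longrightarrow> v j \<in> Sw k a \<and> homog m (m i) (v j)"
    and inj: "injrow i (set ps) u"
  shows "\<exists>bs css c c' d d'. list_all2 (nf_block i) bs css \<and>
    length (concat (map snd bs)) = a i \<and>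
    (\<forall>y\<in>set (concat (map snd bs)). y \<in> Sw k a \<and> homog m (m i) y) \<and>
    (\<forall>j\<in>{1..a i}. lower_poly k a m i (Var (i, j) - (\<Sum>l\<in>{1..a i}. Const (d' l j) * concat (map snd bs) ! (l - 1)))) \<and>
    (\<forall>l\<in>{1..a i}. \<forall>l'\<in>{1..a i}. (\<Sum>j\<in>{1..a i}. d' l j * d j l') = (if l = l' then 1 else 0)) \<and>
    map (\<lambda>l. (\<Sum>j\<in>set ps. Const (c j l) * u j, \<Sum>j\<in>set ps. Const (c j l) * v j)) ps = concat css \<and>
    (\<forall>j\<in>set ps. \<forall>l\<in>set ps. (\<Sum>t\<in>set ps. c j t * c' t l) = (if j = l then 1 else 0)) \<and>
    (\<forall>j\<in>set ps. \<forall>l\<in>set ps. (\<Sum>t\<in>set ps. c' j t * c t l) = (if j = l then 1 else 0))"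
proof -
  interpret l: Vector_Spaces.linear msc msc "lin i" by (rule lin_linear)
  define J where "J = set ps"
  have J: "finite J" unfolding J_def by simp
  define f where "f j = lin i (u j)" for j
  have f: "inj_on f J \<and> mp.independent (f ` J)"
  proof (rule mp.independent_familyI[OF J])
    fix c assume "(\<Sum>j\<in>J. msc (c j) (f j)) = 0"
    then have "lin i (\<Sum>j\<in>J. Const (c j) * u j) = 0" by (simp add: f_def msc_def lin_sum lin_Const_mult)
    then show "\<forall>j\<in>J. c j = 0" using inj unfolding injrow_def J_def by blast
  qed
  \<comment> \<open>U inverts \<open>lin i\<close> on V: it returns the combination of top entries
    with a given linear part, and T returns the same combination of bottom entries.\<close>
  obtain U where U: "Vector_Spaces.linear msc msc U" "\<And>j. j \<in> J \<Longrightarrow> U (f j) = u j"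
    using mpp.linear_independent_extend[of "f ` J" "\<lambda>b. u (inv_into J f b)"] f by auto
  obtain T where T: "Vector_Spaces.linear msc msc T" "\<And>j. j \<in> J \<Longrightarrow> T (f j) = v j"
    using mpp.linear_independent_extend[of "f ` J" "\<lambda>b. v (inv_into J f b)"] f by auto
  interpret U: Vector_Spaces.linear msc msc U by fact
  interpret T: Vector_Spaces.linear msc msc T by fact
  define V where "V = mp.span (f ` J)"
  define B where "B = (\<lambda>j. Var (i, j) :: 'k mpoly) ` {1..a i}"
  define W where "W = mp.span B"
  have linW: "lin i p \<in> W" for p unfolding W_def B_def by (rule lin_in_span)
  have VW: "V \<subseteq> W" unfolding V_def W_def
    by (rule mp.span_minimal) (use linW in \<open>auto simp: f_def W_def\<close>)
  define g where "g w = lin i (T w)" for w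
  have lin_g: "Vector_Spaces.linear msc msc g"
    unfolding msc_linear_iff g_def by (simp add: T.add T.scale[unfolded msc_def] lin_add lin_Const_mult)
  have good_sub: "mp.subspace {p \<in> Sw k a. homog m (m i) p}"
    by (rule mp.subspaceI) (auto simp: msc_def intro!: Sw_intros)
  have UT: "U w \<in> Sw k a" "homog m (m i) (U w)" "T w \<in> Sw k a" "homog m (m i) (T w)" if "w \<in> V" for w
  proof -
    have "U w \<in> mp.span (u ` J)" "T w \<in> mp.span (v ` J)"
    proof -
      have "U ` f ` J = u ` J" "T ` f ` J = v ` J" using U(2) T(2) by force+
      then show "U w \<in> mp.span (u ` J)" "T w \<in> mp.span (v ` J)"
        using that U.span_image[of "f ` J"] T.span_image[of "f ` J"] unfolding V_def by auto
    qed
    moreover have "mp.span (u ` J) \<subseteq> {p \<in> Sw k a. homog m (m i) p}" "mp.span (v ` J) \<subseteq> {p \<in> Sw k a. homog m (m i) p}"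
      by (rule mp.span_minimal[OF _ good_sub]; use uv in \<open>auto simp: J_def\<close>)+
    ultimately show "U w \<in> Sw k a" "homog m (m i) (U w)" "T w \<in> Sw k a" "homog m (m i) (T w)" by auto
  qed
  have linU: "lin i (U w) = w" if "w \<in> V" for w
    using that unfolding V_def
  proof (induction rule: mp.span_induct)
    case base
    show ?case by (rule mp.subspaceI) (simp_all add: U.add U.scale[unfolded msc_def] msc_def lin_add lin_Const_mult)
  next
    case (step x)
    then show ?case using U(2) f_def by auto
  qed
  have "finite B" unfolding B_def by simp
  have "mp.subspace V" "g ` V \<subseteq> W" unfolding V_def g_def using linW by auto
  from mp.chain_decomposition[OF alg lin_g \<open>finite B\<close> W_def[symmetric] this(1) VW this(2)]
  obtain bs0 where bs0: "\<forall>b\<in>set bs0. is_chain msc g b" "list_basis msc (concat (map snd bs0)) W"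
    "mp.span (set (concat (map chain_dom bs0))) = V" by blast
  define vs where "vs = concat (map chain_dom bs0)"
  define ws where "ws = concat (map snd bs0)"
  have ne: "\<forall>b\<in>set bs0. snd b \<noteq> []" using bs0(1) unfolding is_chain_def by blast
  have ms: "mset ws = mset vs + mset (chain_ends bs0)" unfolding vs_def ws_def using ne by (rule mset_chains)
  have ws: "distinct ws" "mp.independent (set ws)" "mp.span (set ws) = W"
    using bs0(2) unfolding list_basis_def ws_def by auto
  have vs: "distinct vs" "mp.independent (set vs)" "mp.span (set vs) = V"
    using ws distinct_append_iff_mset(1,2)[OF ms] bs0(3) mp.independent_mono[OF ws(2), of "set vs"]
    unfolding vs_def[symmetric] by auto
  have vsV: "w \<in> V" if "w \<in> set vs" for w using that vs(3) mp.span_base by metis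
  have wsW: "w \<in> W" if "w \<in> set ws" for w using that ws(3) mp.span_base by metis
  have len_vs: "length vs = length ps"
  proof -
    have "card (set vs) = card (f ` J)"
      using mp.dim_eq_card_independent[OF vs(2)] mp.dim_eq_card_independent[of "f ` J"] f
        mp.span_eq_dim[of "set vs" "f ` J"] vs(3) unfolding V_def by simp
    then show ?thesis using vs(1) ps f by (simp add: distinct_card card_image J_def)
  qed
  have Bb: "inj_on (\<lambda>j. Var (i, j) :: 'k mpoly) {1..a i}" "mp.independent B" 
    using Var_basis[OF i] unfolding B_def by auto
  have len_ws: "length ws = a i"
  proof -
    have "card (set ws) = card B"
      using mp.dim_eq_card_independent[OF ws(2)] mp.dim_eq_card_independent[OF Bb(2)]
        mp.span_eq_dim[of "set ws" B] ws(3) unfolding W_def by simp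
    then show ?thesis using ws(1) Bb(1) by (simp add: distinct_card card_image B_def)
  qed
  \<comment> \<open>Domain vectors are lifted by U. A scroll end has no column with itself on top;
    its lift is the bottom entry below the preceding vector, so that the last column carries no
    lower term, as \<open>is_block\<close> demands. A scroll chain of length one has no column and
    keeps its linear form.\<close>
  define lf where "lf b = (fst b, case fst b of Some e \<Rightarrow> map U (snd b)
    | None \<Rightarrow> map U (butlast (snd b)) @ [if length (snd b) \<ge> 2 then T (last (butlast (snd b))) else last (snd b)])"
    for b :: "'k option \<times> 'k mpoly list"
  have fst_lf: "fst (lf b) = fst b" for b by (simp add: lf_def)
  have dom_sub: "set (chain_dom b) \<subseteq> V" if "b \<in> set bs0" for b
    using vsV that unfolding vs_def by auto
  have snd_sub: "set (snd b) \<subseteq> W" if "b \<in> set bs0" for b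
    using wsW that unfolding ws_def by auto
  have lf: "map (lin i) (snd (lf b)) = snd b \<and> (\<forall>y\<in>set (snd (lf b)). y \<in> Sw k a \<and> homog m (m i) y)"
    if b: "b \<in> set bs0" for b
  proof (cases "fst b")
    case (Some e)
    then have sV: "set (snd b) \<subseteq> V" using dom_sub[OF b] by (simp add: chain_dom_def)
    then have "map (\<lambda>w. lin i (U w)) (snd b) = map (\<lambda>w. w) (snd b)" by (intro map_cong refl linU) auto
    then show ?thesis using Some UT sV by (auto simp: lf_def comp_def)
  next
    case None
    have sV: "set (butlast (snd b)) \<subseteq> V" using dom_sub[OF b] None by (simp add: chain_dom_def)
    then have e1: "map (\<lambda>w. lin i (U w)) (butlast (snd b)) = map (\<lambda>w. w) (butlast (snd b))" by (intro map_cong refl linU) auto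
    have nb: "snd b \<noteq> []" using ne b by blast
    define z where "z = (if length (snd b) \<ge> 2 then T (last (butlast (snd b))) else last (snd b))"
    have "lin i z = last (snd b) \<and> z \<in> Sw k a \<and> homog m (m i) z"
    proof (cases "length (snd b) \<ge> 2")
      case True
      then have "butlast (snd b) \<noteq> []" by (cases "snd b" rule: rev_cases) auto
      then have lV: "last (butlast (snd b)) \<in> V" using sV last_in_set by blast
      have idx: "last (butlast (snd b)) = snd b ! (length (snd b) - 2)" "last (snd b) = snd b ! (length (snd b) - 1)"
        using True \<open>butlast (snd b) \<noteq> []\<close> nb by (simp_all add: last_conv_nth nth_butlast numeral_2_eq_2)
      have "Suc (length (snd b) - 2) = length (snd b) - 1" using True by simp
      moreover have "\<forall>s. Suc s < length (snd b) \<longrightarrow> g (snd b ! s) = snd b ! Suc s"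
        using bs0(1) b None unfolding is_chain_def by auto
      ultimately have "g (last (butlast (snd b))) = last (snd b)" unfolding idx using True
        by (metis Suc_diff_1 diff_less length_greater_0_conv lessI nb numeral_2_eq_2 Suc_lessI zero_less_Suc)
      then show ?thesis using True UT[OF lV] unfolding z_def g_def by simp
    next
      case False
      have "last (snd b) \<in> W" using snd_sub[OF b] nb last_in_set by blast
      then show ?thesis using False span_Var[OF i] unfolding z_def W_def B_def by auto
    qed
    moreover have "snd (lf b) = map U (butlast (snd b)) @ [z]" using None by (simp add: lf_def z_def)
    ultimately show ?thesis using e1 UT sV nb by (auto simp: comp_def)
  qed
  define bs where "bs = map lf bs0"
  define css where "css = map (\<lambda>b. map (\<lambda>w. (U w, T w)) (chain_dom b)) bs0"
  have Y: "map (lin i) (concat (map snd bs)) = ws" unfolding ws_def bs_def map_concat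
    using lf by (simp add: comp_def cong: map_cong)
  have Yg: "\<forall>y\<in>set (concat (map snd bs)). y \<in> Sw k a \<and> homog m (m i) y"
    using lf unfolding bs_def by auto
  have len_Y: "length (concat (map snd bs)) = a i" using arg_cong[OF Y, of length] len_ws by simp
  have cols: "concat css = map (\<lambda>w. (U w, T w)) vs" unfolding css_def vs_def by (simp add: map_concat comp_def)
  have block: "nf_block i (lf b) (map (\<lambda>w. (U w, T w)) (chain_dom b))" if b: "b \<in> set bs0" for b
  proof -
    have nb: "snd b \<noteq> []" using ne b by blast
    have lenlf: "length (snd (lf b)) = length (snd b)" using arg_cong[OF conjunct1[OF lf[OF b]], of length] by simp
    have nth_lf: "snd (lf b) ! s \<in> Sw k a" "homog m (m i) (snd (lf b) ! s)" "lin i (snd (lf b) ! s) = snd b ! s"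
      if "s < length (snd b)" for s
    proof -
      have "snd (lf b) ! s \<in> set (snd (lf b))" using that lenlf by simp
      then show "snd (lf b) ! s \<in> Sw k a" "homog m (m i) (snd (lf b) ! s)" using lf[OF b] by auto
      show "lin i (snd (lf b) ! s) = snd b ! s"
        using arg_cong[OF conjunct1[OF lf[OF b]], of "\<lambda>xs. xs ! s"] that lenlf by simp
    qed
    show ?thesis
    proof (cases "fst b")
      case (Some e)
      have dm: "chain_dom b = snd b" using Some by (simp add: chain_dom_def)
      have sl: "snd (lf b) = map U (snd b)" using Some by (simp add: lf_def)
      define x where "x s = (if s + 1 < length (snd b) then snd (lf b) ! (s + 1) else 0) + Const e * snd (lf b) ! s" for s
      define p where "p s = (if s < length (snd b) then T (snd b ! s) - x s else 0)" for s
      have "lower_poly k a m i (p s)" for s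
      proof (cases "s < length (snd b)")
        case True
        then have sV: "snd b ! s \<in> V" using dom_sub[OF b] dm by auto
        have x: "x s \<in> Sw k a" "homog m (m i) (x s)" "lin i (x s) = g (snd b ! s)"
          using nth_lf[of s] nth_lf[of "s + 1"] True bs0(1) b Some unfolding x_def is_chain_def
          by (auto intro!: Sw_intros simp: lin_add lin_Const_mult msc_def)
        have "lower_poly k a m i (T (snd b ! s) - x s)"
          using x UT[OF sV] by (intro lin_eq_0_lower i) (auto intro!: Sw_intros simp: lin_diff g_def)
        then show ?thesis using True by (simp add: p_def)
      qed (simp add: p_def)
      moreover have "map (\<lambda>w. (U w, T w)) (chain_dom b) = map (\<lambda>s. (snd (lf b) ! s,
          (if s + 1 < length (snd (lf b)) then snd (lf b) ! (s + 1) else 0) + Const e * snd (lf b) ! s + p s)) [0..<length (snd (lf b))]"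
        unfolding lenlf dm by (rule nth_equalityI) (auto simp: sl p_def x_def)
      moreover have "snd (lf b) \<noteq> []" using nb lenlf by auto
      ultimately show ?thesis unfolding nf_block_def fst_lf Some by auto
    next
      case None
      have dm: "chain_dom b = butlast (snd b)" using None by (simp add: chain_dom_def)
      define n where "n = length (snd b)"
      have n: "n > 0" using nb by (simp add: n_def)
      have slU: "snd (lf b) ! s = U (snd b ! s)" if "s + 1 < n" for s
      proof -
        have "s < length (butlast (snd b))" using that by (simp add: n_def)
        then show ?thesis using None by (simp add: lf_def nth_append nth_butlast)
      qed
      have slT: "snd (lf b) ! (s + 1) = T (snd b ! s)" if "s + 2 = n" for s
      proof -
        have ne': "butlast (snd b) \<noteq> []" using that by (cases "snd b" rule: rev_cases) (auto simp: n_def)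
        have "last (butlast (snd b)) = snd b ! s" using that ne'
          by (simp add: last_conv_nth nth_butlast n_def) (metis Suc_1 Suc_eq_plus1 add_2_eq_Suc' diff_Suc_1 lessI nth_butlast length_butlast diff_Suc_Suc minus_nat.diff_0)
        moreover have "s + 1 = length (map U (butlast (snd b)))" using that by (simp add: n_def)
        then have "(map U (butlast (snd b)) @ [x]) ! (s + 1) = x" for x by (simp only: nth_append_length)
        ultimately show ?thesis using that None by (simp add: lf_def n_def)
      qed
      define p where "p t = (if 0 < t \<and> t + 1 < n then T (snd b ! (t - 1)) - snd (lf b) ! t else 0)" for t
      have "lower_poly k a m i (p t)" for t
      proof (cases "0 < t \<and> t + 1 < n")
        case True
        have "snd b ! (t - 1) \<in> set (butlast (snd b))" using True
          by (metis n_def in_set_conv_nth length_butlast nth_butlast less_diff_conv less_imp_diff_less)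
        then have sV: "snd b ! (t - 1) \<in> V" using dom_sub[OF b] dm by auto
        have "g (snd b ! (t - 1)) = snd b ! t" using bs0(1) b None True unfolding is_chain_def n_def by auto
        then have "lower_poly k a m i (T (snd b ! (t - 1)) - snd (lf b) ! t)"
          using UT[OF sV] nth_lf[of t] True by (intro lin_eq_0_lower i) (auto intro!: Sw_intros simp: lin_diff g_def n_def)
        then show ?thesis using True by (simp add: p_def)
      qed (auto simp: p_def)
      moreover have "map (\<lambda>w. (U w, T w)) (chain_dom b) = map (\<lambda>s. (snd (lf b) ! s,
          snd (lf b) ! (s + 1) + (if s + 2 < length (snd (lf b)) then p (s + 1) else 0))) [0..<length (snd (lf b)) - 1]"
      proof (rule nth_equalityI)
        show "length (map (\<lambda>w. (U w, T w)) (chain_dom b)) = length (map (\<lambda>s. (snd (lf b) ! s,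
          snd (lf b) ! (s + 1) + (if s + 2 < length (snd (lf b)) then p (s + 1) else 0))) [0..<length (snd (lf b)) - 1])"
          by (simp add: dm lenlf)
        fix s assume "s < length (map (\<lambda>w. (U w, T w)) (chain_dom b))"
        then have s: "s + 1 < n" by (simp add: dm n_def)
        have "T (snd b ! s) = snd (lf b) ! (s + 1) + (if s + 2 < n then p (s + 1) else 0)"
        proof (cases "s + 2 < n")
          case True
          then show ?thesis by (simp add: p_def)
        next
          case False
          then show ?thesis using slT[of s] s by simp
        qed
        then show "map (\<lambda>w. (U w, T w)) (chain_dom b) ! s = map (\<lambda>s. (snd (lf b) ! s,
          snd (lf b) ! (s + 1) + (if s + 2 < length (snd (lf b)) then p (s + 1) else 0))) [0..<length (snd (lf b)) - 1] ! s"
          using s slU[OF s] by (simp add: dm lenlf n_def nth_butlast)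
      qed
      moreover have "snd (lf b) \<noteq> []" using nb lenlf by auto
      ultimately show ?thesis unfolding nf_block_def fst_lf None by auto
    qed
  qed
  have blocks: "list_all2 (nf_block i) bs css" unfolding bs_def css_def list_all2_map1 list_all2_map2
    using block by (simp add: list_all2_same)
  obtain w0 where w0: "map w0 ps = vs" using ex_map_eq[OF len_vs[symmetric] ps] by blast
  have w0J: "inj_on w0 J" "w0 ` J = set vs"
    using w0 vs(1) by (auto simp: J_def distinct_map image_set)
  have "mp.span (f ` J) = mp.span (w0 ` J)" using w0J(2) vs(3) V_def by simp
  from mp.basis_change[OF J _ _ w0J(1) _ this] f vs(2) w0J(2)
  obtain c c' where c: "\<forall>l\<in>J. w0 l = (\<Sum>j\<in>J. msc (c j l) (f j))"
    "\<forall>j\<in>J. \<forall>l\<in>J. (\<Sum>t\<in>J. c j t * c' t l) = (if j = l then 1 else 0)"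
    "\<forall>j\<in>J. \<forall>l\<in>J. (\<Sum>t\<in>J. c' j t * c t l) = (if j = l then 1 else 0)" by auto
  have Uw0: "U (w0 l) = (\<Sum>j\<in>J. Const (c j l) * u j)" "T (w0 l) = (\<Sum>j\<in>J. Const (c j l) * v j)" if "l \<in> J" for l
  proof -
    have "w0 l = (\<Sum>j\<in>J. msc (c j l) (f j))" using c(1) that by blast
    then have "U (w0 l) = (\<Sum>j\<in>J. msc (c j l) (U (f j)))" "T (w0 l) = (\<Sum>j\<in>J. msc (c j l) (T (f j)))"
      by (simp_all add: U.sum U.scale T.sum T.scale)
    then show "U (w0 l) = (\<Sum>j\<in>J. Const (c j l) * u j)" "T (w0 l) = (\<Sum>j\<in>J. Const (c j l) * v j)"
      using U(2) T(2) by (simp_all add: msc_def)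
  qed
  have newcols: "map (\<lambda>l. (\<Sum>j\<in>J. Const (c j l) * u j, \<Sum>j\<in>J. Const (c j l) * v j)) ps = concat css"
    unfolding cols w0[symmetric] using Uw0 by (simp add: J_def)
  define x where "x l = ws ! (l - 1)" for l
  have x: "inj_on x {1..a i}" "x ` {1..a i} = set ws"
  proof -
    show "inj_on x {1..a i}" using ws(1) len_ws unfolding x_def inj_on_def
      by (auto simp: nth_eq_iff_index_eq)
    show "x ` {1..a i} = set ws"
    proof
      show "x ` {1..a i} \<subseteq> set ws" unfolding x_def using len_ws by auto
      show "set ws \<subseteq> x ` {1..a i}"
      proof
        fix w assume "w \<in> set ws"
        then obtain t where "t < a i" "w = ws ! t" using len_ws by (auto simp: in_set_conv_nth)
        then show "w \<in> x ` {1..a i}" unfolding x_def by (intro image_eqI[of _ _ "Suc t"]) auto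
      qed
    qed
  qed
  have "mp.span ((\<lambda>j. Var (i, j)) ` {1..a i}) = mp.span (x ` {1..a i})" unfolding x(2) ws(3) W_def B_def ..
  from mp.basis_change[OF _ Bb(1) Bb(2)[unfolded B_def] x(1) _ this] x(2) ws(2)
  obtain d d' where d: "\<forall>j\<in>{1..a i}. Var (i, j) = (\<Sum>l\<in>{1..a i}. msc (d' l j) (x l))"
    "\<forall>j\<in>{1..a i}. \<forall>l\<in>{1..a i}. (\<Sum>t\<in>{1..a i}. d' j t * d t l) = (if j = l then 1 else 0)" by auto
  have low: "lower_poly k a m i (Var (i, j) - (\<Sum>l\<in>{1..a i}. Const (d' l j) * concat (map snd bs) ! (l - 1)))"
    if j: "j \<in> {1..a i}" for j
  proof (rule lin_eq_0_lower[OF _ _ _ i])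
    have y: "concat (map snd bs) ! (l - 1) \<in> Sw k a" "homog m (m i) (concat (map snd bs) ! (l - 1))"
      "lin i (concat (map snd bs) ! (l - 1)) = x l" if "l \<in> {1..a i}" for l
    proof -
      have lt: "l - 1 < length (concat (map snd bs))" using that len_Y by auto
      then show "concat (map snd bs) ! (l - 1) \<in> Sw k a" "homog m (m i) (concat (map snd bs) ! (l - 1))"
        using Yg nth_mem by blast+
      show "lin i (concat (map snd bs) ! (l - 1)) = x l"
        unfolding x_def Y[symmetric] using lt by (simp only: nth_map)
    qed
    have V: "(i, j) \<in> Vars k a" using i j by (simp add: Vars_iff)
    show "Var (i, j) - (\<Sum>l\<in>{1..a i}. Const (d' l j) * concat (map snd bs) ! (l - 1)) \<in> Sw k a"
      using y(1) V by (intro Sw_intros)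
    show "homog m (m i) (Var (i, j) - (\<Sum>l\<in>{1..a i}. Const (d' l j) * concat (map snd bs) ! (l - 1)))"
      using y(2) homog_Var[of m "(i, j)"] by (intro homog_diff homog_sum homog_Const_mult) simp_all
    have "lin i (\<Sum>l\<in>{1..a i}. Const (d' l j) * concat (map snd bs) ! (l - 1)) = (\<Sum>l\<in>{1..a i}. msc (d' l j) (x l))"
      unfolding lin_sum lin_Const_mult msc_def by (intro sum.cong refl) (simp only: y(3))
    then have "lin i (\<Sum>l\<in>{1..a i}. Const (d' l j) * concat (map snd bs) ! (l - 1)) = lin i (Var (i, j))"
      using bspec[OF d(1) j] lin_Var[OF i j] by metis
    then show "lin i (Var (i, j) - (\<Sum>l\<in>{1..a i}. Const (d' l j) * concat (map snd bs) ! (l - 1))) = 0"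
      by (simp only: lin_diff right_minus_eq)
  qed
  show ?thesis
    by (rule exI[of _ bs], rule exI[of _ css], rule exI[of _ c], rule exI[of _ c'], rule exI[of _ d], rule exI[of _ d'])
      (intro conjI blocks len_Y Yg ballI low newcols[unfolded J_def] c(2)[unfolded J_def, rule_format]
        c(3)[unfolded J_def, rule_format] d(2)[rule_format])
qed

end

section \<open>Pseudo 1-generic matrices\<close>

locale generic_matrix = weights k a m for k :: nat and a m :: "nat \<Rightarrow> nat" +
  fixes q :: nat and M :: "nat \<Rightarrow> nat \<Rightarrow> 'k::field mpoly" and cd :: "nat \<Rightarrow> nat"
  assumes alg: "alg_closed_field TYPE('k)"
    and hom: "homog_matrix k a m q M cd"
    and gen: "pseudo_1_generic k a q M"
    and cd_cases: "\<And>j. j < q \<Longrightarrow> \<exists>i\<le>k. cd j = m i"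
begin

lemma cd_pos: "j < q \<Longrightarrow> 0 < cd j"
  using cd_cases m_pos by fastforce

definition N :: "(nat \<Rightarrow> nat \<Rightarrow> 'k) \<Rightarrow> nat \<Rightarrow> nat \<Rightarrow> 'k mpoly" where
  "N P r j = Const (P r 0) * M 0 j + Const (P r 1) * M 1 j"

definition row_det :: "(nat \<Rightarrow> nat \<Rightarrow> 'k) \<Rightarrow> 'k" where
  "row_det P = P 0 0 * P 1 1 - P 0 1 * P 1 0"

lemma M_simps: "j < q \<Longrightarrow> M 0 j \<in> Sw k a" "j < q \<Longrightarrow> M 1 j \<in> Sw k a"
  "j < q \<Longrightarrow> homog m (cd j) (M 0 j)" "j < q \<Longrightarrow> homog m (cd j) (M 1 j)"
  using hom unfolding homog_matrix_def by auto

lemma N_simps: "j < q \<Longrightarrow> N P r j \<in> Sw k a" "j < q \<Longrightarrow> homog m (cd j) (N P r j)"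
  unfolding N_def by (intro Sw_intros M_simps, assumption+) (intro homog_add homog_Const_mult M_simps, assumption+)

text \<open>Every initial segment of a generalized row generates a homogeneous ideal, so regularity
  in the localization descends to S(w) by \<open>in_loc_ext_homog\<close>, and
  \<open>regular_koszul\<close> applies.\<close>

lemma M_koszul:
  assumes st: "(s, t) \<noteq> (0, 0)" and b: "\<And>j. j < q \<Longrightarrow> b j \<in> Sw k a"
    and z: "(\<Sum>j<q. b j * (Const s * M 0 j + Const t * M 1 j)) = 0"
  shows "\<exists>e. (\<forall>i<q. \<forall>j<q. e i j \<in> Sw k a \<and> e j i = - e i j) \<and> (\<forall>i<q. e i i = 0) \<and>
     (\<forall>i<q. b i = (\<Sum>j<q. e i j * (Const s * M 0 j + Const t * M 1 j)))"
proof (rule regular_koszul[OF _ _ b z])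
  let ?f = "\<lambda>j. Const s * M 0 j + Const t * M 1 j"
  show f: "?f j \<in> Sw k a" if "j < q" for j using that M_simps by (intro Sw_intros)
  fix i g assume i: "i < q" "g \<in> Sw k a" "?f i * g \<in> gen_ideal (Sw k a) (?f ` {..<i})"
  have reg: "regular_seq_loc (Sw k a) (map ?f [0..<q])" using gen st unfolding pseudo_1_generic_def by blast
  have set: "set (take i (map ?f [0..<q])) = ?f ` {..<i}" using i(1) by (auto simp: take_map take_upt)
  have "in_loc_ext (Sw k a) (gen_ideal (Sw k a) (?f ` {..<i})) (?f i * g)"
    unfolding in_loc_ext_def using i(3) const_term_Const[of "1::'k"] by (intro bexI[of _ 1]) (auto intro: Sw_intros)
  moreover have L: "map ?f [0..<q] ! i = ?f i" "i < length (map ?f [0..<q])" using i(1) by simp_all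
  moreover have "in_loc_ext (Sw k a) (gen_ideal (Sw k a) (set (take i (map ?f [0..<q])))) (map ?f [0..<q] ! i * g) \<longrightarrow>
      in_loc_ext (Sw k a) (gen_ideal (Sw k a) (set (take i (map ?f [0..<q])))) g"
    using reg L(2) i(2) unfolding regular_seq_loc_def by blast
  ultimately have "in_loc_ext (Sw k a) (gen_ideal (Sw k a) (?f ` {..<i})) g"
    unfolding set L(1) by (elim mp)
  then show "g \<in> gen_ideal (Sw k a) (?f ` {..<i})"
  proof (intro in_loc_ext_homog[of "{..<i}" ?f cd])
    fix j assume "j \<in> {..<i}"
    then have j: "j < q" using i(1) by simp
    show "?f j \<in> Sw k a \<and> homog m (cd j) (?f j)"
      using f[OF j] M_simps(3,4)[OF j] by (intro conjI homog_add homog_Const_mult)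
  qed (use i(2) in auto)
qed

lemma N_comb:
  "Const c0 * N P 0 j + Const c1 * N P 1 j
    = Const (c0 * P 0 0 + c1 * P 1 0) * M 0 j + Const (c0 * P 0 1 + c1 * P 1 1) * M 1 j"
  by (simp add: N_def Const_add Const_mult algebra_simps)

text \<open>An invertible row operation permutes the points (c0, c1) of the projective line, so
  genericity of M passes to \<open>N P\<close>. The two identities are Cramer's rule.\<close>

lemma row_det_point:
  assumes "row_det P \<noteq> 0" "(c0, c1) \<noteq> (0, 0)"
  shows "(c0 * P 0 0 + c1 * P 1 0, c0 * P 0 1 + c1 * P 1 1) \<noteq> (0, 0)"
proof
  assume z: "(c0 * P 0 0 + c1 * P 1 0, c0 * P 0 1 + c1 * P 1 1) = (0, 0)"
  have "c0 * row_det P = (c0 * P 0 0 + c1 * P 1 0) * P 1 1 - (c0 * P 0 1 + c1 * P 1 1) * P 1 0"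
    "c1 * row_det P = (c0 * P 0 1 + c1 * P 1 1) * P 0 0 - (c0 * P 0 0 + c1 * P 1 0) * P 0 1"
    unfolding row_det_def by (simp_all add: algebra_simps)
  then show False using z assms by simp
qed

lemma koszul_N:
  assumes "row_det P \<noteq> 0" shows "koszul {..<q} (\<lambda>_. Sw k a) (N P 0) (N P 1)"
  unfolding koszul_def
proof (intro allI impI)
  fix c0 c1 b
  assume c: "(c0, c1) \<noteq> (0, 0)" and b: "\<forall>j\<in>{..<q}. b j \<in> Sw k a"
    and z: "(\<Sum>j<q. b j * (Const c0 * N P 0 j + Const c1 * N P 1 j)) = 0"
  have "\<exists>e. (\<forall>i<q. \<forall>j<q. e i j \<in> Sw k a \<and> e j i = - e i j) \<and> (\<forall>i<q. e i i = 0) \<and>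
     (\<forall>i<q. b i = (\<Sum>j<q. e i j * (Const c0 * N P 0 j + Const c1 * N P 1 j)))"
    using z unfolding N_comb by (intro M_koszul[OF row_det_point[OF assms c]]) (use b in auto)
  then obtain e where e: "\<forall>i<q. \<forall>j<q. e i j \<in> Sw k a \<and> e j i = - e i j" "\<forall>i<q. e i i = 0"
     "\<forall>i<q. b i = (\<Sum>j<q. e i j * (Const c0 * N P 0 j + Const c1 * N P 1 j))" by (elim exE conjE) (rule that)
  have "e i j * N P r j \<in> Sw k a" if "i < q" "j < q" for i j r
    using e(1) that N_simps(1) by (intro Sw_intros) blast+
  then show "\<exists>e. (\<forall>i\<in>{..<q}. \<forall>j\<in>{..<q}. e j i = - e i j \<and> e i j * N P 0 j \<in> Sw k a \<and> e i j * N P 1 j \<in> Sw k a) \<and>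
          (\<forall>i\<in>{..<q}. e i i = 0) \<and>
          (\<forall>i\<in>{..<q}. b i = (\<Sum>j<q. e i j * (Const c0 * N P 0 j + Const c1 * N P 1 j)))"
    using e by (intro exI[of _ e]) blast
qed

definition lower_cols :: "nat \<Rightarrow> nat set" where "lower_cols D = {j. j < q \<and> cd j < D}"

definition lower_coeffs :: "nat \<Rightarrow> nat \<Rightarrow> 'k mpoly set" where "lower_coeffs D j = {p \<in> Sw k a. homog m (D - cd j) p}"

text \<open>The coefficients are extended by zero to all q columns, where the ungraded statement
  holds. In the graded Koszul matrix an entry at a column j of degree at least D vanishes, because
  \<open>cd i\<close> is positive and so \<open>cd i + cd j\<close> exceeds D; only the lower
  columns remain.\<close>

lemma koszul_N_graded:
  assumes "row_det P \<noteq> 0" shows "koszul (lower_cols D) (lower_coeffs D) (N P 0) (N P 1)"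
  unfolding koszul_def
proof (intro allI impI)
  fix c0 c1 b
  let ?f = "\<lambda>j. Const c0 * N P 0 j + Const c1 * N P 1 j"
  assume c: "(c0, c1) \<noteq> (0, 0)" and b: "\<forall>j\<in>lower_cols D. b j \<in> lower_coeffs D j" and z: "(\<Sum>j\<in>lower_cols D. b j * ?f j) = 0"
  define b' where "b' j = (if j \<in> lower_cols D then b j else 0)" for j
  have "(\<Sum>j<q. b' j * ?f j) = (\<Sum>j\<in>lower_cols D. b j * ?f j)"
    by (rule sum.mono_neutral_cong_right) (auto simp: lower_cols_def b'_def)
  then have z': "(\<Sum>j<q. b' j * ?f j) = 0" using z by simp
  have b'S: "b' j \<in> Sw k a" for j using b by (auto simp: b'_def lower_coeffs_def intro: Sw_intros)
  have "\<exists>e. (\<forall>i<q. \<forall>j<q. e i j \<in> Sw k a \<and> e j i = - e i j) \<and> (\<forall>i<q. e i i = 0) \<and>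
     (\<forall>i<q. b' i = (\<Sum>j<q. e i j * ?f j))"
    using z' unfolding N_comb by (intro M_koszul[OF row_det_point[OF assms c]] b'S)
  then obtain e0 where e0: "\<forall>i<q. \<forall>j<q. e0 i j \<in> Sw k a \<and> e0 j i = - e0 i j" "\<forall>i<q. e0 i i = 0"
     "\<forall>i<q. b' i = (\<Sum>j<q. e0 i j * ?f j)" by (elim exE conjE) (rule that)
  have "\<exists>e. (\<forall>i<q. \<forall>j<q. e i j \<in> Sw k a \<and> e j i = - e i j \<and>
       (if cd i + cd j \<le> D then homog m (D - cd i - cd j) (e i j) else e i j = 0)) \<and> (\<forall>i<q. e i i = 0) \<and>
     (\<forall>i<q. b' i = (\<Sum>j<q. e i j * ?f j))"
  proof (rule koszul_graded[OF _ e0])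
    show "homog m (cd j) (?f j)" if "j < q" for j using N_simps(2)[OF that] by (intro homog_add homog_Const_mult)
    show "homog m (D - cd i) (b' i)" if "i < q" "cd i \<le> D" for i using b by (auto simp: b'_def lower_coeffs_def)
    show "b' i = 0" if "i < q" "D < cd i" for i using that by (simp add: b'_def lower_cols_def)
  qed
  then obtain e where e: "\<forall>i<q. \<forall>j<q. e i j \<in> Sw k a \<and> e j i = - e i j \<and>
       (if cd i + cd j \<le> D then homog m (D - cd i - cd j) (e i j) else e i j = 0)" "\<forall>i<q. e i i = 0"
     "\<forall>i<q. b' i = (\<Sum>j<q. e i j * ?f j)" by (elim exE conjE) (rule that)
  have e1: "e i j \<in> Sw k a" "cd i + cd j \<le> D \<Longrightarrow> homog m (D - cd i - cd j) (e i j)" "\<not> cd i + cd j \<le> D \<Longrightarrow> e i j = 0"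
    "e j i = - e i j"
    if "i < q" "j < q" for i j using e(1)[rule_format, OF that] by (auto split: if_splits)
  have X: "e i j * N P r j \<in> lower_coeffs D i" if "i < q" "j < q" for i j r
  proof (cases "cd i + cd j \<le> D")
    case True
    then have "D - cd i = D - cd i - cd j + cd j" by simp
    then have "homog m (D - cd i) (e i j * N P r j)"
      using homog_mult[OF e1(2)[OF that True] N_simps(2)[OF that(2)]] by metis
    then show ?thesis unfolding lower_coeffs_def using e1(1)[OF that] N_simps(1)[OF that(2)] by (simp add: Sw_intros)
  next
    case False
    then show ?thesis using e1(3)[OF that] by (simp add: lower_coeffs_def Sw_intros)
  qed
  have bi: "b i = (\<Sum>j\<in>lower_cols D. e i j * ?f j)" if i: "i \<in> lower_cols D" for i
  proof -
    have iq: "i < q" using i by (simp add: lower_cols_def)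
    have "b i = b' i" using i by (simp add: b'_def)
    also have "\<dots> = (\<Sum>j<q. e i j * ?f j)" using e(3) iq by blast
    also have "\<dots> = (\<Sum>j\<in>lower_cols D. e i j * ?f j)"
    proof (rule sum.mono_neutral_right)
      show "\<forall>j\<in>{..<q} - lower_cols D. e i j * ?f j = 0"
      proof
        fix j assume "j \<in> {..<q} - lower_cols D"
        then have "j < q" "D \<le> cd j" by (auto simp: lower_cols_def)
        then show "e i j * ?f j = 0" using e1(3)[OF iq, of j] cd_pos[OF iq] by simp
      qed
    qed (auto simp: lower_cols_def)
    finally show ?thesis .
  qed
  show "\<exists>e. (\<forall>i\<in>lower_cols D. \<forall>j\<in>lower_cols D. e j i = - e i j \<and> e i j * N P 0 j \<in> lower_coeffs D i \<and> e i j * N P 1 j \<in> lower_coeffs D i) \<and>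
          (\<forall>i\<in>lower_cols D. e i i = 0) \<and> (\<forall>i\<in>lower_cols D. b i = (\<Sum>j\<in>lower_cols D. e i j * ?f j))"
  proof (intro exI[of _ e] conjI ballI)
    fix i j assume "i \<in> lower_cols D" "j \<in> lower_cols D"
    then have ij: "i < q" "j < q" by (auto simp: lower_cols_def)
    show "e j i = - e i j" using e1(4)[OF ij] .
    show "e i j * N P 0 j \<in> lower_coeffs D i" "e i j * N P 1 j \<in> lower_coeffs D i" using X[OF ij] by blast+
    show "e i i = 0" using e(2) ij by blast
  qed (rule bi)
qed

text \<open>Entries of a Koszul syzygy lie in the ideal of the row, whose generators have positive
  degree, so their parts of degree zero vanish.\<close>

lemma syzygy_const:
  assumes P: "row_det P \<noteq> 0" and c: "(c0, c1) \<noteq> (0, 0)"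
    and b: "\<And>j. j < q \<Longrightarrow> b j \<in> Sw k a" "(\<Sum>j<q. b j * (Const c0 * N P 0 j + Const c1 * N P 1 j)) = 0"
    and i: "i < q" "b i = Const x"
  shows "x = 0"
proof -
  let ?f = "\<lambda>j. Const c0 * N P 0 j + Const c1 * N P 1 j"
  have "\<exists>e. (\<forall>i<q. \<forall>j<q. e i j \<in> Sw k a \<and> e j i = - e i j) \<and> (\<forall>i<q. e i i = 0) \<and>
     (\<forall>i<q. b i = (\<Sum>j<q. e i j * ?f j))"
    using b(2) unfolding N_comb by (intro M_koszul[OF row_det_point[OF P c]] b(1))
  then obtain e where e: "b i = (\<Sum>j<q. e i j * ?f j)" using i(1) by blast
  have "Const x = hcomp m 0 (Const x)" by (simp add: hcomp_of_homog[OF homog_Const])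
  also have "\<dots> = (\<Sum>j<q. hcomp m 0 (e i j * ?f j))" using e i(2) by (simp add: hcomp_sum)
  also have "\<dots> = 0"
  proof (rule sum.neutral, rule ballI)
    fix j assume "j \<in> {..<q}"
    then have j: "j < q" by simp
    have "homog m (cd j) (?f j)" using N_simps(2)[OF j] by (intro homog_add homog_Const_mult)
    from hcomp_mult_homog'[OF this] show "hcomp m 0 (e i j * ?f j) = 0" using cd_pos[OF j] by simp
  qed
  finally show ?thesis using Const_inject[of x 0] by simp
qed

lemma scalar_closed_Sw: "scalar_closed (Sw k a)"
  by (simp add: scalar_closed_def Sw_intros)

lemma scalar_closed_lower_coeffs: "scalar_closed (lower_coeffs D j)"
  unfolding scalar_closed_def lower_coeffs_def by (auto intro: Sw_intros)

definition deg_cols :: "nat \<Rightarrow> nat set" where "deg_cols i = {j. j < q \<and> cd j = m i}"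

definition deg_cols_list :: "nat \<Rightarrow> nat list" where "deg_cols_list i = filter (\<lambda>j. cd j = m i) [0..<q]"

lemma deg_cols_list: "distinct (deg_cols_list i)" "set (deg_cols_list i) = deg_cols i"
  by (auto simp: deg_cols_list_def deg_cols_def)

text \<open>There are no variables of degree below \<open>m 0\<close>, so a combination of top
  entries with zero linear part is zero outright and gives a syzygy with constant entries.\<close>

lemma injrow_0:
  assumes P: "row_det P \<noteq> 0" shows "injrow 0 (deg_cols 0) (N P 0)"
  unfolding injrow_def
proof (intro allI impI ballI)
  fix c i
  assume z: "lin 0 (\<Sum>j\<in>deg_cols 0. Const (c j) * N P 0 j) = 0" and i: "i \<in> deg_cols 0"
  let ?s = "\<Sum>j\<in>deg_cols 0. Const (c j) * N P 0 j"
  have "?s \<in> Sw k a" using N_simps(1) by (intro Sw_intros) (auto simp: deg_cols_def)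
  moreover have hs: "homog m (m 0) ?s" using N_simps(2)
    by (intro homog_sum homog_Const_mult) (metis (mono_tags, lifting) deg_cols_def mem_Collect_eq)
  ultimately have "lower_poly k a m 0 ?s" using z by (intro lin_eq_0_lower) auto
  moreover have "Low 0 = {}" using m_less_iff[of _ 0] by (auto simp: Low_iff)
  ultimately have "?s \<in> PolyOn {}" by (simp add: lower_poly_iff)
  then have "keys x = {}" if "x \<in> keys ?s" for x using that unfolding PolyOn_iff by blast
  then have x0: "x = 0" if "x \<in> keys ?s" for x using that by simp
  have "homog m 0 ?s" unfolding homog_def by (rule ballI) (drule x0, simp)
  then have "?s = 0" using hs m0 homog_eqI_0[of m "m 0" ?s 0] by simp
  moreover have "(\<Sum>j<q. (if j \<in> deg_cols 0 then Const (c j) else 0) * (Const 1 * N P 0 j + Const 0 * N P 1 j)) = ?s"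
    by (rule sum.mono_neutral_cong_right) (auto simp: deg_cols_def)
  ultimately have "(\<Sum>j<q. (if j \<in> deg_cols 0 then Const (c j) else 0) * (Const 1 * N P 0 j + Const 0 * N P 1 j)) = 0" by simp
  from syzygy_const[OF P _ _ this, of i "c i"] show "c i = 0" using i by (simp add: deg_cols_def Sw_intros)
qed

end

section \<open>The ideal of the generic row and elimination up to denominators in \<mu>\<close>

context weights
begin

lemma coeffs_in_Sw_mult:
  assumes "p \<in> coeffs_in (Sw k a)" "r \<in> coeffs_in (Sw k a)" shows "p * r \<in> coeffs_in (Sw k a)"
  using assms unfolding coeffs_in_def by (auto simp: coeff_mult intro!: Sw_intros)

definition row_ideal :: "nat set \<Rightarrow> (nat \<Rightarrow> 'k::field mpoly) \<Rightarrow> (nat \<Rightarrow> 'k mpoly) \<Rightarrow> 'k mpoly poly set" where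
  "row_ideal J u v = row_module J (\<lambda>_. Sw k a) u v"

lemma row_ideal_add:
  assumes "x \<in> row_ideal J u v" "y \<in> row_ideal J u v" shows "x + y \<in> row_ideal J u v"
proof -
  obtain A B where "x = (\<Sum>j\<in>J. A j * row u v j)" "\<forall>j\<in>J. A j \<in> coeffs_in (Sw k a)"
    "y = (\<Sum>j\<in>J. B j * row u v j)" "\<forall>j\<in>J. B j \<in> coeffs_in (Sw k a)" using assms unfolding row_ideal_def row_module_def by blast
  moreover have "scalar_closed (Sw k a :: 'a mpoly set)" by (simp add: scalar_closed_def Sw_intros)
  ultimately show ?thesis unfolding row_ideal_def row_module_def mem_Collect_eq
    by (intro exI[of _ "\<lambda>j. A j + B j"]) (simp add: distrib_right sum.distrib coeffs_in_add)
qed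

lemma row_ideal_mult:
  assumes "x \<in> row_ideal J u v" "r \<in> coeffs_in (Sw k a)" shows "r * x \<in> row_ideal J u v"
proof -
  obtain A where "x = (\<Sum>j\<in>J. A j * row u v j)" "\<forall>j\<in>J. A j \<in> coeffs_in (Sw k a)" using assms unfolding row_ideal_def row_module_def by blast
  then show ?thesis unfolding row_ideal_def row_module_def mem_Collect_eq
    using assms(2) by (intro exI[of _ "\<lambda>j. r * A j"]) (auto simp: sum_distrib_left mult.assoc coeffs_in_Sw_mult)
qed

lemma row_ideal_0: "0 \<in> row_ideal J u v"
  unfolding row_ideal_def row_module_def mem_Collect_eq
  by (rule exI[of _ "\<lambda>_. 0"]) (simp add: coeffs_in_def Sw_intros)

lemma row_ideal_row:
  assumes "finite J" "j \<in> J" shows "row u v j \<in> row_ideal J u v"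
proof -
  have "(\<Sum>l\<in>J. (if l = j then 1 else 0) * row u v l) = row u v j"
    using assms by (simp add: if_distrib[of "\<lambda>x. x * _"] cong: if_cong)
  then show ?thesis unfolding row_ideal_def row_module_def mem_Collect_eq
    by (intro exI[of _ "\<lambda>l. if l = j then 1 else 0"]) (auto simp: coeffs_in_def Sw_intros coeff_1)
qed

lemma coeffs_in_Sw_cpoly: "cpoly d \<in> coeffs_in (Sw k a)"
  by (simp add: coeffs_in_def Sw_intros)

lemma row_ideal_uminus: "x \<in> row_ideal J u v \<Longrightarrow> - x \<in> row_ideal J u v"
  using row_ideal_mult[OF _ coeffs_in_Sw_cpoly[of "-1"]] by (simp add: cpoly_diff[of 0 1, simplified])

lemma row_ideal_diff: "x \<in> row_ideal J u v \<Longrightarrow> y \<in> row_ideal J u v \<Longrightarrow> x - y \<in> row_ideal J u v"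
  using row_ideal_add[OF _ row_ideal_uminus] by fastforce

lemma row_ideal_sum: "(\<And>t. t \<in> T \<Longrightarrow> f t \<in> row_ideal J u v) \<Longrightarrow> sum f T \<in> row_ideal J u v"
  by (induction T rule: infinite_finite_induct) (auto simp: row_ideal_0 row_ideal_add)

text \<open>The polynomials in \<mu> that become polynomials over F modulo the rows once a nonzero
  polynomial in \<mu> is inverted. Denominators are cleared instead of passing to K(\<mu>).\<close>

definition Elim :: "'k::field mpoly set \<Rightarrow> nat set \<Rightarrow> (nat \<Rightarrow> 'k mpoly) \<Rightarrow> (nat \<Rightarrow> 'k mpoly) \<Rightarrow> 'k mpoly poly set" where
  "Elim F J u v = {f \<in> coeffs_in (Sw k a). \<exists>D f'. D \<noteq> 0 \<and> f' \<in> coeffs_in F \<and> cpoly D * f - f' \<in> row_ideal J u v}"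

definition subring :: "'k::field mpoly set \<Rightarrow> bool" where
  "subring F \<longleftrightarrow> (\<forall>c. Const c \<in> F) \<and> (\<forall>x\<in>F. \<forall>y\<in>F. x + y \<in> F \<and> x * y \<in> F) \<and> F \<subseteq> Sw k a"

lemma subring_scalar_closed: "subring F \<Longrightarrow> scalar_closed F"
  unfolding subring_def scalar_closed_def by (metis Const_simps(1))

lemma subring_coeffs_in_mult:
  assumes F: "subring F" and "p \<in> coeffs_in F" "r \<in> coeffs_in F" shows "p * r \<in> coeffs_in F"
proof -
  have "(\<Sum>i\<le>n. coeff p i * coeff r (n - i)) \<in> F" for n
    by (rule scalar_closed_sum[OF subring_scalar_closed[OF F]]) (use assms in \<open>auto simp: subring_def coeffs_in_def\<close>)
  then show ?thesis unfolding coeffs_in_def by (simp add: coeff_mult)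
qed

lemma Elim_mult:
  assumes F: "subring F" and fg: "f \<in> Elim F J u v" "g \<in> Elim F J u v"
  shows "f * g \<in> Elim F J u v"
proof -
  obtain D f' E g' where f: "f \<in> coeffs_in (Sw k a)" "D \<noteq> 0" "f' \<in> coeffs_in F" "cpoly D * f - f' \<in> row_ideal J u v"
    and g: "g \<in> coeffs_in (Sw k a)" "E \<noteq> 0" "g' \<in> coeffs_in F" "cpoly E * g - g' \<in> row_ideal J u v"
    using fg unfolding Elim_def by blast
  have "f' \<in> coeffs_in (Sw k a)" using f(3) F unfolding coeffs_in_def subring_def by blast
  then have "(cpoly E * g) * (cpoly D * f - f') + f' * (cpoly E * g - g') \<in> row_ideal J u v"
    by (intro row_ideal_add row_ideal_mult f(4) g(4) coeffs_in_Sw_mult coeffs_in_Sw_cpoly g(1))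
  then have "cpoly (D * E) * (f * g) - f' * g' \<in> row_ideal J u v"
    by (simp add: cpoly_mult algebra_simps)
  moreover have "D * E \<noteq> 0" using f g by simp
  moreover have "f * g \<in> coeffs_in (Sw k a)" using f(1) g(1) by (rule coeffs_in_Sw_mult)
  ultimately show ?thesis unfolding Elim_def using subring_coeffs_in_mult[OF F f(3) g(3)] by blast
qed

lemma Elim_add:
  assumes F: "subring F" and fg: "f \<in> Elim F J u v" "g \<in> Elim F J u v"
  shows "f + g \<in> Elim F J u v"
proof -
  obtain D f' E g' where f: "f \<in> coeffs_in (Sw k a)" "D \<noteq> 0" "f' \<in> coeffs_in F" "cpoly D * f - f' \<in> row_ideal J u v"
    and g: "g \<in> coeffs_in (Sw k a)" "E \<noteq> 0" "g' \<in> coeffs_in F" "cpoly E * g - g' \<in> row_ideal J u v"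
    using fg unfolding Elim_def by blast
  have "cpoly E * (cpoly D * f - f') + cpoly D * (cpoly E * g - g') \<in> row_ideal J u v"
    by (intro row_ideal_add row_ideal_mult f(4) g(4) coeffs_in_Sw_cpoly)
  then have "cpoly (D * E) * (f + g) - (cpoly E * f' + cpoly D * g') \<in> row_ideal J u v"
    by (simp add: cpoly_mult algebra_simps)
  moreover have "cpoly E * f' + cpoly D * g' \<in> coeffs_in F"
    using subring_scalar_closed[OF F] f(3) g(3) by (intro coeffs_in_add coeffs_in_cpoly_mult)
  moreover have "f + g \<in> coeffs_in (Sw k a)" using f(1) g(1) by (simp add: coeffs_in_def Sw_intros)
  moreover have "D * E \<noteq> 0" using f g by simp
  ultimately show ?thesis unfolding Elim_def by blast
qed

lemma Elim_base:
  assumes F: "subring F" and "f \<in> coeffs_in F" shows "f \<in> Elim F J u v"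
proof -
  have "f \<in> coeffs_in (Sw k a)" using assms unfolding coeffs_in_def subring_def by blast
  moreover have "cpoly 1 * f - f \<in> row_ideal J u v" by (simp add: row_ideal_0)
  ultimately show ?thesis unfolding Elim_def mem_Collect_eq using assms(2)
    by (intro conjI exI[of _ 1] exI[of _ f]) simp_all
qed

lemma Elim_cpoly: "subring F \<Longrightarrow> cpoly d \<in> Elim F J u v"
  by (rule Elim_base) (auto simp: coeffs_in_def subring_def)

text \<open>Solving a linear congruence for x only multiplies the denominators.\<close>

lemma Elim_solve:
  assumes F: "subring F" and x: "x \<in> coeffs_in (Sw k a)" and D: "D \<noteq> 0" "cpoly D * x - w \<in> row_ideal J u v"
    and w: "w \<in> Elim F J u v"
  shows "x \<in> Elim F J u v"
proof -
  obtain E w' where w': "E \<noteq> 0" "w' \<in> coeffs_in F" "cpoly E * w - w' \<in> row_ideal J u v" using w unfolding Elim_def by blast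
  have "cpoly E * (cpoly D * x - w) + (cpoly E * w - w') \<in> row_ideal J u v"
    by (intro row_ideal_add row_ideal_mult D w' coeffs_in_Sw_cpoly)
  then have "cpoly (E * D) * x - w' \<in> row_ideal J u v" by (simp add: cpoly_mult algebra_simps)
  moreover have "E * D \<noteq> 0" using D w' by simp
  ultimately show ?thesis unfolding Elim_def using x w'(2) by blast
qed

lemma Elim_PolyOn:
  assumes F: "subring F" and p: "p \<in> PolyOn X" and v: "\<And>x. x \<in> X \<Longrightarrow> [:Var x:] \<in> Elim F J u v"
  shows "[:p:] \<in> Elim F J u v"
  using p
proof (induction rule: PolyOn_induct)
  case (Const c)
  show ?case using Elim_cpoly[OF F, of "[:c:]"] by simp
next
  case (add p r)
  then show ?case using Elim_add[OF F, of "[:p:]" J u v "[:r:]"] by simp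
next
  case (mult p r)
  moreover have "[:p:] * [:r:] = [:p * r:]" by simp
  ultimately show ?case using Elim_mult[OF F, of "[:p:]" J u v "[:r:]"] by metis
qed (use v in auto)

end

section \<open>Elimination of variables\<close>

lemma row_module_diff:
  assumes "\<And>j. j \<in> J \<Longrightarrow> scalar_closed (X j)" "x \<in> row_module J X u v" "y \<in> row_module J X u v" shows "x - y \<in> row_module J X u v"
proof -
  obtain A B where "x = (\<Sum>j\<in>J. A j * row u v j)" "\<forall>j\<in>J. A j \<in> coeffs_in (X j)"
    "y = (\<Sum>j\<in>J. B j * row u v j)" "\<forall>j\<in>J. B j \<in> coeffs_in (X j)" using assms(2,3) unfolding row_module_def by blast
  then show ?thesis unfolding row_module_def mem_Collect_eq using assms(1)
    by (intro exI[of _ "\<lambda>j. A j - B j"]) (simp add: left_diff_distrib sum_subtractf coeffs_in_diff)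
qed

lemma row_module_cpoly_mult:
  assumes "\<And>j. j \<in> J \<Longrightarrow> scalar_closed (X j)" "x \<in> row_module J X u v" shows "cpoly d * x \<in> row_module J X u v"
proof -
  obtain A where "x = (\<Sum>j\<in>J. A j * row u v j)" "\<forall>j\<in>J. A j \<in> coeffs_in (X j)" using assms(2) unfolding row_module_def by blast
  then show ?thesis unfolding row_module_def mem_Collect_eq using assms(1)
    by (intro exI[of _ "\<lambda>j. cpoly d * A j"]) (simp add: sum_distrib_left mult.assoc coeffs_in_cpoly_mult)
qed

lemma coeff_mult_linear:
  "coeff (p * [:x, y:]) t = coeff p t * x + (case t of 0 \<Rightarrow> 0 | Suc s \<Rightarrow> coeff p s * (y :: 'a::comm_ring_1))"
  by (cases t) (simp_all add: mult.commute)

lemma Var_power: "Var v ^ n = single (single v n) (1::'k::comm_ring_1)"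
  by (induction n) (simp_all add: Var_def mult_single single_add[symmetric])

text \<open>A variable of degree 1 has exactly one power in each degree; this is the source of the
  rank one in \<open>rank_one\<close>.\<close>

lemma homog_single_variable:
  assumes g: "g \<in> PolyOn {v}" "homog m D g" and v: "m (fst v) = 1"
  shows "\<exists>x. g = Const x * Var v ^ D"
proof -
  have "x = single v D" if x: "x \<in> keys g" for x
  proof -
    have kx: "keys x \<subseteq> {v}" using g(1) x unfolding PolyOn_iff by blast
    have "wdeg m x = lookup x v" using wdeg_superset[OF _ kx, of m] v by simp
    then have "lookup x v = D" using g(2) x unfolding homog_def by simp
    then show ?thesis using kx by (intro poly_mapping_eqI) (auto simp: lookup_single when_def in_keys_iff)
  qed
  then have "keys g \<subseteq> {single v D}" by blast
  then have "g = single (single v D) (lookup g (single v D))"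
    by (intro poly_mapping_eqI) (auto simp: lookup_single when_def in_keys_iff)
  also have "\<dots> = Const (lookup g (single v D)) * Var v ^ D"
    by (simp add: Var_power Const_def mult_single)
  finally show ?thesis by blast
qed

context weights
begin

lemma hcomp_subst:
  assumes g: "g \<in> PolyOn X" and y: "\<And>v. v \<in> X \<Longrightarrow> homog m (m (fst v)) (y v)"
  shows "hcomp m D (subst y g) = subst y (hcomp m D g)"
proof -
  define T where "T = insert D (wdeg m ` keys g)"
  have T: "finite T" "D \<in> T" unfolding T_def by auto
  have gs: "g = (\<Sum>E\<in>T. hcomp m E g)" by (rule sum_hcomp) (auto simp: T_def)
  have "homog m E (subst y (hcomp m E g))" for E
    by (rule homog_subst[OF hcomp_homog hcomp_PolyOn[OF g] y])
  then have "hcomp m D (subst y (hcomp m E g)) = (if D = E then subst y (hcomp m E g) else 0)" for E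
    by (rule hcomp_of_homog)
  moreover have "hcomp m D (subst y g) = (\<Sum>E\<in>T. hcomp m D (subst y (hcomp m E g)))"
    by (subst gs) (simp add: subst_sum hcomp_sum)
  ultimately show ?thesis using T by simp
qed

text \<open>This matches columns with domain vectors, so that counting columns counts scroll
  ends.\<close>

lemma nf_block_dom:
  assumes "nf_block i b cs" shows "map fst cs = chain_dom b"
proof (cases "fst b")
  case None
  then show ?thesis using assms unfolding nf_block_def chain_dom_def
    by (auto intro!: nth_equalityI simp: nth_butlast)
next
  case (Some e)
  then show ?thesis using assms unfolding nf_block_def chain_dom_def
    by (auto intro!: nth_equalityI)
qed

end

section \<open>Families of normal forms and the variables that survive elimination\<close>

definition (in generic_matrix) is_normal_form :: "(nat \<Rightarrow> nat \<Rightarrow> 'k) \<Rightarrow> nat \<Rightarrow> ('k option \<times> 'k mpoly list) list \<Rightarrow> ('k mpoly \<times> 'k mpoly) list list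
    \<Rightarrow> (nat \<Rightarrow> nat \<Rightarrow> 'k) \<Rightarrow> (nat \<Rightarrow> nat \<Rightarrow> 'k) \<Rightarrow> (nat \<Rightarrow> nat \<Rightarrow> 'k) \<Rightarrow> (nat \<Rightarrow> nat \<Rightarrow> 'k) \<Rightarrow> bool" where
  "is_normal_form P i bs css c c' d d' \<longleftrightarrow> list_all2 (nf_block i) bs css \<and>
    length (concat (map snd bs)) = a i \<and>
    (\<forall>y\<in>set (concat (map snd bs)). y \<in> Sw k a \<and> homog m (m i) y) \<and>
    (\<forall>j\<in>{1..a i}. lower_poly k a m i (Var (i, j) - (\<Sum>l\<in>{1..a i}. Const (d' l j) * concat (map snd bs) ! (l - 1)))) \<and>
    (\<forall>l\<in>{1..a i}. \<forall>l'\<in>{1..a i}. (\<Sum>j\<in>{1..a i}. d' l j * d j l') = (if l = l' then 1 else 0)) \<and>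
    map (\<lambda>l. (\<Sum>j\<in>deg_cols i. Const (c j l) * N P 0 j, \<Sum>j\<in>deg_cols i. Const (c j l) * N P 1 j)) (deg_cols_list i) = concat css \<and>
    (\<forall>j\<in>deg_cols i. \<forall>l\<in>deg_cols i. (\<Sum>t\<in>deg_cols i. c j t * c' t l) = (if j = l then 1 else 0)) \<and>
    (\<forall>j\<in>deg_cols i. \<forall>l\<in>deg_cols i. (\<Sum>t\<in>deg_cols i. c' j t * c t l) = (if j = l then 1 else 0))"

lemma (in generic_matrix) normal_form_exists:
  assumes i: "i \<le> k" and inj: "injrow i (deg_cols i) (N P 0)"
  shows "\<exists>bs css c c' d d'. is_normal_form P i bs css c c' d d'"
proof -
  have "N P r j \<in> Sw k a \<and> homog m (m i) (N P r j)" if "j \<in> set (deg_cols_list i)" for j r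
    using N_simps[of j P r] that unfolding deg_cols_list(2) deg_cols_def by auto
  from normal_form[OF alg i deg_cols_list(1)[of i] this this inj[folded deg_cols_list(2)]]
  show ?thesis unfolding is_normal_form_def deg_cols_list(2) .
qed

text \<open>All n normal forms share the row transformation P, because the row ideal mixes columns
  of different degrees.\<close>

locale nf_family = generic_matrix k a m q M cd for k a m q and M :: "nat \<Rightarrow> nat \<Rightarrow> 'k::field mpoly" and cd +
  fixes P :: "nat \<Rightarrow> nat \<Rightarrow> 'k" and n :: nat
    and bs :: "nat \<Rightarrow> ('k option \<times> 'k mpoly list) list" and css :: "nat \<Rightarrow> ('k mpoly \<times> 'k mpoly) list list"
    and c c' d d' :: "nat \<Rightarrow> nat \<Rightarrow> nat \<Rightarrow> 'k"
  assumes P: "row_det P \<noteq> 0" and n: "n \<le> Suc k"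
    and NF: "\<And>i. i < n \<Longrightarrow> is_normal_form P i (bs i) (css i) (c i) (c' i) (d i) (d' i)"
begin

definition chain_polys :: "nat \<Rightarrow> 'k mpoly list" where "chain_polys i = concat (map snd (bs i))"

text \<open>New coordinates in the degrees treated so far and the old variables elsewhere, so that a
  partial family also gives a full coordinate system. The shift by one reflects that variables are
  numbered from 1.\<close>

definition y :: "nat \<times> nat \<Rightarrow> 'k mpoly" where
  "y v = (if fst v < n then chain_polys (fst v) ! (snd v - 1) else Var v)"

lemma NF_blocks: "i < n \<Longrightarrow> list_all2 (nf_block i) (bs i) (css i)"
  using NF unfolding is_normal_form_def by blast

lemma length_chain_polys: "i < n \<Longrightarrow> length (chain_polys i) = a i"
  using NF unfolding is_normal_form_def chain_polys_def by blast

lemma y_chain_polys: "i < n \<Longrightarrow> l < a i \<Longrightarrow> y (i, Suc l) = chain_polys i ! l"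
  by (simp add: y_def)

lemma y_good: "v \<in> Vars k a \<Longrightarrow> y v \<in> Sw k a \<and> homog m (m (fst v)) (y v)"
proof (cases "fst v < n")
  case True
  assume "v \<in> Vars k a"
  then have "snd v - 1 < length (chain_polys (fst v))" using True by (auto simp: length_chain_polys Vars_def)
  then have "chain_polys (fst v) ! (snd v - 1) \<in> set (concat (map snd (bs (fst v))))" unfolding chain_polys_def using nth_mem by blast
  then show ?thesis using NF[OF True] True unfolding is_normal_form_def y_def by auto
next
  case False
  assume "v \<in> Vars k a"
  then show ?thesis using False by (simp add: y_def homog_Var Sw_intros)
qed

lemma ex_sigma: "\<exists>\<sigma>. graded_aut k a m \<sigma> \<and> (\<forall>v\<in>Vars k a. subst \<sigma> (y v) = Var v)"
proof -
  define e where "e i l j = (if i < n then d' i l j else if l = j then 1 else (0::'k))" for i l j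
  define e' where "e' i l j = (if i < n then d i l j else if l = j then 1 else (0::'k))" for i l j
  have low: "lower_poly k a m i (Var (i, j) - (\<Sum>l\<in>{1..a i}. Const (e i l j) * y (i, l)))" if "i \<le> k" "j \<in> {1..a i}" for i j
  proof (cases "i < n")
    case True
    then show ?thesis using NF[OF True] that unfolding is_normal_form_def e_def y_def chain_polys_def by simp
  next
    case False
    then have "(\<Sum>l\<in>{1..a i}. Const (e i l j) * y (i, l)) = Var (i, j)"
      unfolding e_def y_def using that by (simp add: if_distrib[of Const] if_distrib[of "\<lambda>x. x * _"] cong: if_cong)
    then show ?thesis by simp
  qed
  have inv: "(\<Sum>j\<in>{1..a i}. e i l j * e' i j l') = (if l = l' then 1 else 0)" if "i \<le> k" "l \<in> {1..a i}" "l' \<in> {1..a i}" for i l l'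
  proof (cases "i < n")
    case True
    then show ?thesis using NF[OF True] that unfolding is_normal_form_def e_def e'_def by simp
  next
    case False
    then have "(\<Sum>j\<in>{1..a i}. e i l j * e' i j l') = (\<Sum>j\<in>{1..a i}. if j = l then (if l = l' then 1 else 0) else 0)"
      unfolding e_def e'_def by (intro sum.cong) auto
    then show ?thesis using that by simp
  qed
  obtain \<sigma> where "graded_aut k a m \<sigma>" "\<And>v. v \<in> Vars k a \<Longrightarrow> subst \<sigma> (y v) = Var v"
    by (rule triangular_automorphism[of y e e']) (use y_good low inv in auto)
  then show ?thesis by blast
qed

definition \<sigma> where "\<sigma> = (SOME \<sigma>. graded_aut k a m \<sigma> \<and> (\<forall>v\<in>Vars k a. subst \<sigma> (y v) = Var v))"

lemma sigma: "graded_aut k a m \<sigma>" "v \<in> Vars k a \<Longrightarrow> subst \<sigma> (y v) = Var v"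
  using someI_ex[OF ex_sigma] unfolding \<sigma>_def by blast+

lemma y_inj: "inj_on y (Vars k a)"
proof (rule inj_onI)
  fix u v assume uv: "u \<in> Vars k a" "v \<in> Vars k a" "y u = y v"
  then have "(Var u :: 'k mpoly) = Var v" using sigma(2) by metis
  then have "vcoef (Var u :: 'k mpoly) v = 1" by (simp add: vcoef_Var)
  then show "u = v" by (simp add: vcoef_Var split: if_splits)
qed

lemma Vars_Suc: "i < n \<Longrightarrow> l < a i \<Longrightarrow> (i, Suc l) \<in> Vars k a"
  using n by (auto simp: Vars_def)

lemma distinct_chain_polys: assumes i: "i < n" shows "distinct (chain_polys i)"
  unfolding distinct_conv_nth
proof (intro allI impI notI)
  fix s t assume st: "s < length (chain_polys i)" "t < length (chain_polys i)" "s \<noteq> t" "chain_polys i ! s = chain_polys i ! t"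
  then have "y (i, Suc s) = y (i, Suc t)" using i by (simp add: y_chain_polys length_chain_polys)
  then show False using y_inj st(1-3) Vars_Suc[OF i] unfolding inj_on_def by (auto simp: length_chain_polys[OF i])
qed

text \<open>Scroll ends are the coordinates that are not the top entry of any normal form column, so
  no row relation solves for them.\<close>

definition free_vars :: "(nat \<times> nat) set" where
  "free_vars = {v \<in> Vars k a. fst v < n \<and> y v \<in> set (chain_ends (bs (fst v)))}"

definition free_ring :: "'k mpoly set" where "free_ring = subst y ` PolyOn free_vars"

lemma free_vars_subset: "free_vars \<subseteq> Vars k a"
  by (auto simp: free_vars_def)

lemma subring_free_ring: "subring free_ring"
  unfolding subring_def
proof (intro conjI allI ballI)
  show "Const c \<in> free_ring" for c unfolding free_ring_def by (rule image_eqI[of _ _ "Const c"]) auto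
  fix x z assume "x \<in> free_ring" "z \<in> free_ring"
  then obtain p r where pr: "p \<in> PolyOn free_vars" "r \<in> PolyOn free_vars" "x = subst y p" "z = subst y r" unfolding free_ring_def by blast
  show "x + z \<in> free_ring" unfolding free_ring_def by (rule image_eqI[of _ _ "p + r"]) (use pr in \<open>auto simp: subst_add\<close>)
  show "x * z \<in> free_ring" unfolding free_ring_def by (rule image_eqI[of _ _ "p * r"]) (use pr in \<open>auto simp: subst_mult\<close>)
next
  show "free_ring \<subseteq> Sw k a" unfolding free_ring_def Sw_PolyOn
    by (auto intro!: subst_PolyOn y_good[THEN conjunct1, unfolded Sw_PolyOn] simp: free_vars_def)
qed

lemma chain_ne: "i < n \<Longrightarrow> \<forall>b\<in>set (bs i). snd b \<noteq> []"
proof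
  fix b assume "i < n" "b \<in> set (bs i)"
  then obtain t where "t < length (bs i)" "b = bs i ! t" "nf_block i (bs i ! t) (css i ! t)"
    using NF_blocks[of i] unfolding list_all2_conv_all_nth in_set_conv_nth by blast
  then show "snd b \<noteq> []" unfolding nf_block_def by blast
qed

lemma mset_chain_polys: "i < n \<Longrightarrow> mset (chain_polys i) = mset (concat (map chain_dom (bs i))) + mset (chain_ends (bs i))"
  unfolding chain_polys_def by (rule mp.mset_chains) (rule chain_ne)

lemma dom_css: "i < n \<Longrightarrow> map fst (concat (css i)) = concat (map chain_dom (bs i))"
proof -
  assume "i < n"
  from NF_blocks[OF this] show ?thesis
    by (induction rule: list_all2_induct) (simp_all add: nf_block_dom)
qed

lemma css_cols: "i < n \<Longrightarrow> concat (css i) =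
    map (\<lambda>l. (\<Sum>j\<in>deg_cols i. Const (c i j l) * N P 0 j, \<Sum>j\<in>deg_cols i. Const (c i j l) * N P 1 j)) (deg_cols_list i)"
  using NF[of i] unfolding is_normal_form_def by simp

lemma length_dom: "i < n \<Longrightarrow> length (concat (map chain_dom (bs i))) = card (deg_cols i)"
  unfolding dom_css[symmetric] css_cols using deg_cols_list[of i] by (simp add: distinct_card[symmetric])

text \<open>Each coordinate of degree i is either a domain vector, hence the top entry of one
  column, or a scroll end.\<close>

lemma length_ends: "i < n \<Longrightarrow> a i = card (deg_cols i) + length (chain_ends (bs i))"
  using arg_cong[OF mset_chain_polys, of i size] length_chain_polys[of i] length_dom[of i] by simp

lemma N_from_cols:
  assumes i: "i < n" and j: "j \<in> deg_cols i"
  shows "N P r j = (\<Sum>l\<in>deg_cols i. Const (c' i l j) * (\<Sum>t\<in>deg_cols i. Const (c i t l) * N P r t))"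
proof -
  have "(\<Sum>l\<in>deg_cols i. Const (c' i l j) * (\<Sum>t\<in>deg_cols i. Const (c i t l) * N P r t))
      = (\<Sum>l\<in>deg_cols i. \<Sum>t\<in>deg_cols i. Const (c i t l * c' i l j) * N P r t)"
    by (simp add: sum_distrib_left Const_mult mult_ac)
  also have "\<dots> = (\<Sum>t\<in>deg_cols i. \<Sum>l\<in>deg_cols i. Const (c i t l * c' i l j) * N P r t)" by (rule sum.swap)
  also have "\<dots> = (\<Sum>t\<in>deg_cols i. Const (\<Sum>l\<in>deg_cols i. c i t l * c' i l j) * N P r t)"
    by (simp add: sum_distrib_right Const_sum)
  also have "\<dots> = (\<Sum>t\<in>deg_cols i. Const (if t = j then 1 else 0) * N P r t)"
    using NF[OF i] j unfolding is_normal_form_def by (intro sum.cong) auto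
  also have "\<dots> = N P r j"
    using j by (simp add: if_distrib[of Const] if_distrib[of "\<lambda>x. x * _"] deg_cols_def cong: if_cong)
  finally show ?thesis by simp
qed

text \<open>Pass to the coordinates y and set all of them outside \<open>free_vars\<close> to zero.
  This ring homomorphism annihilates the rows at \<mu> = 0 and inverts \<open>subst y\<close> on
  polynomials in \<open>free_vars\<close>.\<close>

definition kill :: "'k mpoly \<Rightarrow> 'k mpoly" where
  "kill p = subst (\<lambda>v. if v \<in> free_vars then Var v else 0) (subst \<sigma> p)"

lemma kill_N0:
  assumes i: "i < n" and j: "j \<in> deg_cols i" shows "kill (N P 0 j) = 0"
proof -
  have dom: "kill x = 0" if x: "x \<in> set (concat (map chain_dom (bs i)))" for x
  proof -
    have "x \<in> set (chain_polys i)" using mset_chain_polys[OF i] x by (metis set_mset_mset set_mset_union UnI1)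
    then obtain l where l: "l < a i" "x = chain_polys i ! l" using length_chain_polys[OF i] by (auto simp: in_set_conv_nth)
    then have x: "x = y (i, Suc l)" "(i, Suc l) \<in> Vars k a" using i by (auto simp: y_chain_polys Vars_Suc)
    have "x \<notin> set (chain_ends (bs i))"
      using distinct_append_iff_mset(1)[OF mset_chain_polys[OF i]] distinct_chain_polys[OF i] that by auto
    then have "(i, Suc l) \<notin> free_vars" using x by (simp add: free_vars_def)
    then show ?thesis unfolding kill_def x(1) sigma(2)[OF x(2)] by simp
  qed
  have "kill (\<Sum>t\<in>deg_cols i. Const (c i t l) * N P 0 t) = 0" if l: "l \<in> deg_cols i" for l
  proof (rule dom)
    have "(\<Sum>t\<in>deg_cols i. Const (c i t l) * N P 0 t) \<in> set (map fst (concat (css i)))"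
      unfolding css_cols[OF i] using l deg_cols_list(2)[of i] by auto
    then show "(\<Sum>t\<in>deg_cols i. Const (c i t l) * N P 0 t) \<in> set (concat (map chain_dom (bs i)))"
      unfolding dom_css[OF i] .
  qed
  then show ?thesis
    by (subst N_from_cols[OF i j]) (simp add: kill_def subst_sum subst_mult)
qed

text \<open>The constant coefficient of h lies in the ideal of the top row, so \<open>kill\<close>
  annihilates it; as \<open>kill\<close> is injective on \<open>free_ring\<close>, it is zero. Then
  h is divisible by \<mu>, torsion-freeness at 0 keeps the quotient in the module, and the induction
  continues.\<close>

lemma row_module_free_ring_zero:
  assumes J: "finite J" "J \<subseteq> (\<Union>i<n. deg_cols i)" and X: "\<And>j. j \<in> J \<Longrightarrow> scalar_closed (X j)" and K: "koszul J X (N P 0) (N P 1)"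
    and h: "h \<in> row_module J X (N P 0) (N P 1)" "h \<in> coeffs_in free_ring"
  shows "h = 0"
  using h
proof (induction h)
  case (pCons x h)
  obtain A where A: "pCons x h = (\<Sum>j\<in>J. A j * row (N P 0) (N P 1) j)"
    using pCons.prems(1) unfolding row_module_def by blast
  have "x = coeff (pCons x h) 0" by simp
  also have "\<dots> = (\<Sum>j\<in>J. coeff (A j) 0 * N P 0 j)"
    unfolding A coeff_sum row_def coeff_mult_linear by simp
  finally have "kill x = (\<Sum>j\<in>J. kill (coeff (A j) 0) * kill (N P 0 j))"
    by (simp add: kill_def subst_sum subst_mult)
  also have "\<dots> = 0"
  proof (rule sum.neutral, rule ballI)
    fix j assume "j \<in> J"
    then obtain i where "i < n" "j \<in> deg_cols i" using J(2) by blast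
    then show "kill (coeff (A j) 0) * kill (N P 0 j) = 0" by (simp add: kill_N0)
  qed
  finally have kx: "kill x = 0" .
  have "x \<in> free_ring" "h \<in> coeffs_in free_ring" using pCons.prems(2) by (auto simp: coeffs_in_pCons)
  then obtain p where p: "p \<in> PolyOn free_vars" "x = subst y p" unfolding free_ring_def by blast
  have "kill x = subst (\<lambda>v. subst (\<lambda>v. if v \<in> free_vars then Var v else 0) (subst \<sigma> (y v))) p"
    unfolding kill_def p(2) subst_subst ..
  also have "\<dots> = subst Var p"
    by (rule subst_cong[OF p(1)]) (use sigma(2) free_vars_subset in auto)
  finally have "p = 0" using kx by simp
  then have x0: "x = 0" using p(2) by simp
  then have "[:- Const 0, 1:] * h = pCons x h" by simp
  then have "h \<in> row_module J X (N P 0) (N P 1)" using row_module_torsion_free[OF J(1) X K, of 0 h] pCons.prems(1) by simp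
  then have "h = 0" using pCons.IH \<open>h \<in> coeffs_in free_ring\<close> by blast
  then show ?case using x0 by simp
qed simp

definition family_cols :: "nat set" where "family_cols = (\<Union>i<n. deg_cols i)"

lemma finite_family_cols: "finite family_cols"
  by (simp add: family_cols_def deg_cols_def)

abbreviation "elim_set \<equiv> Elim free_ring family_cols (N P 0) (N P 1)"
abbreviation "family_ideal \<equiv> row_ideal family_cols (N P 0) (N P 1)"

lemma col_in_family_ideal:
  assumes i: "i < n" and UT: "(U, T) \<in> set (concat (css i))" shows "[:U, - T:] \<in> family_ideal"
proof -
  obtain l where l: "U = (\<Sum>j\<in>deg_cols i. Const (c i j l) * N P 0 j)" "T = (\<Sum>j\<in>deg_cols i. Const (c i j l) * N P 1 j)"
    using UT unfolding css_cols[OF i] by auto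
  have "[:U, - T:] = (\<Sum>j\<in>deg_cols i. cpoly [:c i j l:] * row (N P 0) (N P 1) j)"
    unfolding l row_def
    by (intro poly_eqI) (simp add: coeff_sum coeff_mult_linear coeff_pCons sum_negf mult.commute split: nat.splits)
  moreover have "row (N P 0) (N P 1) j \<in> family_ideal" if "j \<in> deg_cols i" for j
    using that i by (intro row_ideal_row[OF finite_family_cols]) (auto simp: family_cols_def)
  ultimately show ?thesis by (simp only:) (intro row_ideal_sum row_ideal_mult coeffs_in_Sw_cpoly)
qed

lemma const_coeffs_in: "x \<in> Sw k a \<Longrightarrow> [:x:] \<in> coeffs_in (Sw k a)"
  by (simp add: coeffs_in_pCons coeffs_in_0 scalar_closed_Sw)

text \<open>Modulo the row ideal a Jordan column reads (1 - e \<mu>) x_s = \<mu> (x_(s+1) + p_s),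
  and a scroll column reads x_s = \<mu> (x_(s+1) + p). Elimination runs backwards along the chain: 1
  - e \<mu> is never the zero polynomial, and a scroll end lies in \<open>free_ring\<close>.\<close>

lemma Elim_chain:
  assumes i: "i < n" and low: "\<And>v. v \<in> Low i \<Longrightarrow> [:Var v:] \<in> elim_set" and b: "b \<in> set (bs i)"
  shows "\<forall>x\<in>set (snd b). [:x:] \<in> elim_set"
proof -
  note free_ring = subring_free_ring
  obtain cs where cs: "cs \<in> set (css i)" "nf_block i b cs"
    using NF_blocks[OF i] b by (metis in_set_conv_nth list_all2_conv_all_nth)
  then have sub: "set cs \<subseteq> set (concat (css i))" by auto
  have lowp: "[:p:] \<in> elim_set" if "lower_poly k a m i p" for p
    using that by (intro Elim_PolyOn[OF free_ring _ low]) (simp_all add: lower_poly_iff)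
  define L where "L = length (snd b)"
  have inS: "snd b ! s \<in> Sw k a" if "s < L" for s
  proof -
    have "snd b ! s \<in> set (snd b)" using that by (simp add: L_def)
    then have "snd b ! s \<in> set (concat (map snd (bs i)))" using b by auto
    then show ?thesis using NF[OF i] unfolding is_normal_form_def by blast
  qed
  obtain p where p: "\<forall>s. lower_poly k a m i (p s)" and cs_eq: "cs = (case fst b of
      Some e \<Rightarrow> map (\<lambda>s. (snd b ! s, (if s + 1 < length (snd b) then snd b ! (s + 1) else 0) + Const e * snd b ! s + p s)) [0..<length (snd b)]
    | None \<Rightarrow> map (\<lambda>s. (snd b ! s, snd b ! (s + 1) + (if s + 2 < length (snd b) then p (s + 1) else 0))) [0..<length (snd b) - 1])"
    using cs(2) unfolding nf_block_def by blast
  have E0: "[:0:] \<in> elim_set" using Elim_cpoly[OF free_ring, of 0] by simp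
  have main: "\<forall>s. s < L \<longrightarrow> L - Suc s = t \<longrightarrow> [:snd b ! s:] \<in> elim_set" for t
  proof (induction t rule: less_induct)
    case (less t)
    show ?case
    proof (intro allI impI)
      fix s assume s: "s < L" "L - Suc s = t"
      have nxt: "[:snd b ! (s + 1):] \<in> elim_set" if "s + 1 < L"
        using less.IH[of "L - Suc (s + 1)"] s that by simp
      have muE: "[:0, x:] \<in> elim_set" if "[:x:] \<in> elim_set" for x
      proof -
        have "cpoly [:0, 1:] * [:x:] = [:0, x:]" by simp
        then show ?thesis using Elim_mult[OF free_ring Elim_cpoly[OF free_ring, of "[:0, 1:]"] that] by metis
      qed
      show "[:snd b ! s:] \<in> elim_set"
      proof (cases "fst b")
        case (Some e)
        define x where "x = (if s + 1 < L then snd b ! (s + 1) else 0)"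
        have "[:x:] \<in> elim_set" using nxt E0 by (simp add: x_def)
        then have "[:x:] + [:p s:] \<in> elim_set" using lowp p by (intro Elim_add[OF free_ring]) auto
        then have w: "[:0, x + p s:] \<in> elim_set" using muE[of "x + p s"] by simp
        have "(snd b ! s, x + Const e * snd b ! s + p s) \<in> set cs"
          unfolding cs_eq Some using s(1) by (auto simp: x_def L_def)
        then have "[:snd b ! s, - (x + Const e * snd b ! s + p s):] \<in> family_ideal" using sub by (intro col_in_family_ideal[OF i]) blast
        also have "[:snd b ! s, - (x + Const e * snd b ! s + p s):] = cpoly [:1, - e:] * [:snd b ! s:] - [:0, x + p s:]"
          by (simp add: Const_uminus algebra_simps)
        finally show ?thesis
          by (intro Elim_solve[OF free_ring const_coeffs_in[OF inS[OF s(1)]] _ _ w, of "[:1, - e:]"]) simp_all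
      next
        case None
        show ?thesis
        proof (cases "s + 1 < L")
          case True
          define x where "x = snd b ! (s + 1) + (if s + 2 < length (snd b) then p (s + 1) else 0)"
          have "[:snd b ! (s + 1):] + [:if s + 2 < length (snd b) then p (s + 1) else 0:] \<in> elim_set"
            using lowp p E0 by (intro Elim_add[OF free_ring nxt[OF True]]) auto
          then have w: "[:0, x:] \<in> elim_set" using muE[of x] by (simp add: x_def)
          have "(snd b ! s, x) \<in> set cs"
            unfolding cs_eq None using True by (auto simp: x_def L_def)
          then have "[:snd b ! s, - x:] \<in> family_ideal" using sub by (intro col_in_family_ideal[OF i]) blast
          also have "[:snd b ! s, - x:] = cpoly 1 * [:snd b ! s:] - [:0, x:]" by simp
          finally show ?thesis
            by (intro Elim_solve[OF free_ring const_coeffs_in[OF inS[OF s(1)]] _ _ w, of 1]) simp_all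
        next
          case False
          then have "s = length (snd b) - 1" "snd b \<noteq> []" using s(1) by (auto simp: L_def)
          then have sl: "snd b ! s = last (snd b)" by (simp add: last_conv_nth)
          have "snd b ! s \<in> set (snd b)" using s(1) by (simp add: L_def)
          then have "snd b ! s \<in> set (chain_polys i)" using b by (auto simp: chain_polys_def)
          then obtain l where l: "l < a i" "snd b ! s = y (i, Suc l)"
            using length_chain_polys[OF i] y_chain_polys[OF i] unfolding in_set_conv_nth by auto
          have "snd b ! s \<in> set (chain_ends (bs i))" unfolding sl chain_ends_def using b None by auto
          then have "(i, Suc l) \<in> free_vars" using l i Vars_Suc[OF i l(1)] by (simp add: free_vars_def)
          then have "snd b ! s \<in> free_ring" unfolding free_ring_def l(2)
            by (intro image_eqI[of _ _ "Var (i, Suc l)"]) (auto simp: PolyOn_Var)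
          then show ?thesis using subring_scalar_closed[OF free_ring] by (intro Elim_base[OF free_ring]) (simp add: coeffs_in_pCons coeffs_in_0)
        qed
      qed
    qed
  qed
  show ?thesis
  proof
    fix x assume "x \<in> set (snd b)"
    then obtain s where "s < L" "x = snd b ! s" by (auto simp: in_set_conv_nth L_def)
    then show "[:x:] \<in> elim_set" using main[of "L - Suc s"] by blast
  qed
qed

text \<open>A variable is a combination of coordinates of its own degree plus a polynomial in lower
  variables, so the induction is on the degree.\<close>

lemma Elim_Var: "v \<in> Vars k a \<Longrightarrow> fst v < n \<Longrightarrow> [:Var v:] \<in> elim_set"
proof (induction "fst v" arbitrary: v rule: less_induct)
  case less
  note free_ring = subring_free_ring
  obtain i j where ij: "v = (i, j)" "i < n" "i \<le> k" "j \<in> {1..a i}" using less.prems by (cases v) (auto simp: Vars_def)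
  have low: "[:Var u:] \<in> elim_set" if "u \<in> Low i" for u
    using that less.hyps[of u] ij less.prems(2) by (auto simp: Low_iff)
  have "[:x:] \<in> elim_set" if "x \<in> set (chain_polys i)" for x
    using that Elim_chain[OF ij(2) low] unfolding chain_polys_def by auto
  then have yE: "[:chain_polys i ! (l - 1):] \<in> elim_set" if "l \<in> {1..a i}" for l
    using that length_chain_polys[OF ij(2)] by auto
  have E0: "[:0:] \<in> elim_set" using Elim_cpoly[OF free_ring, of 0] by simp
  have tm: "[:Const (d' i l j) * chain_polys i ! (l - 1):] \<in> elim_set" if "l \<in> {1..a i}" for l
  proof -
    have "cpoly [:d' i l j:] * [:chain_polys i ! (l - 1):] = [:Const (d' i l j) * chain_polys i ! (l - 1):]" by simp
    then show ?thesis using Elim_mult[OF free_ring Elim_cpoly[OF free_ring, of "[:d' i l j:]"] yE[OF that]] by metis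
  qed
  have "[:\<Sum>l\<in>T. Const (d' i l j) * chain_polys i ! (l - 1):] \<in> elim_set" if "finite T" "T \<subseteq> {1..a i}" for T
    using that
  proof (induction T rule: finite_induct)
    case (insert l T)
    then show ?case using Elim_add[OF free_ring tm[of l], of "[:\<Sum>l\<in>T. Const (d' i l j) * chain_polys i ! (l - 1):]"] by simp
  qed (use E0 in simp)
  then have "[:\<Sum>l\<in>{1..a i}. Const (d' i l j) * chain_polys i ! (l - 1):] \<in> elim_set" by simp
  moreover have "lower_poly k a m i (Var (i, j) - (\<Sum>l\<in>{1..a i}. Const (d' i l j) * chain_polys i ! (l - 1)))"
    using NF[OF ij(2)] ij(4) unfolding is_normal_form_def chain_polys_def by blast
  then have "[:Var (i, j) - (\<Sum>l\<in>{1..a i}. Const (d' i l j) * chain_polys i ! (l - 1)):] \<in> elim_set"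
    by (intro Elim_PolyOn[OF free_ring _ low]) (simp_all add: lower_poly_iff)
  ultimately have "[:Var (i, j) - (\<Sum>l\<in>{1..a i}. Const (d' i l j) * chain_polys i ! (l - 1)):] + 
      [:\<Sum>l\<in>{1..a i}. Const (d' i l j) * chain_polys i ! (l - 1):] \<in> elim_set" by (intro Elim_add[OF free_ring])
  then show ?case using ij(1) by simp
qed

lemma Elim_coeffs_in:
  assumes "p \<in> coeffs_in (PolyOn {v \<in> Vars k a. fst v < n})" shows "p \<in> elim_set"
  using assms
proof (induction p)
  case 0
  show ?case using Elim_cpoly[OF subring_free_ring, of 0] by simp
next
  case (pCons x p)
  then have xp: "x \<in> PolyOn {v \<in> Vars k a. fst v < n}" "p \<in> elim_set" by (auto simp: coeffs_in_pCons)
  from xp(1) have "[:x:] \<in> elim_set"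
    by (rule Elim_PolyOn[OF subring_free_ring]) (rule Elim_Var, simp_all)
  moreover have "cpoly [:0, 1:] * p \<in> elim_set" using Elim_mult[OF subring_free_ring Elim_cpoly[OF subring_free_ring] xp(2)] .
  ultimately have "[:x:] + cpoly [:0, 1:] * p \<in> elim_set" by (rule Elim_add[OF subring_free_ring])
  then show ?case by simp
qed

end

section \<open>Regularity of the pencils\<close>

lemma subst_power: "subst s (p ^ n) = subst s p ^ n"
  by (induction n) (simp_all add: subst_mult)

context nf_family
begin

lemma lower_cols_eq: "n \<le> k \<Longrightarrow> lower_cols (m n) = family_cols"
proof (intro set_eqI iffI)
  assume n: "n \<le> k"
  fix j
  { assume "j \<in> lower_cols (m n)"
    then have j: "j < q" "cd j < m n" by (auto simp: lower_cols_def)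
    then obtain i where i: "i \<le> k" "cd j = m i" using cd_cases by blast
    then have "i < n" using j n m_less_iff by simp
    then show "j \<in> family_cols" using i j by (auto simp: family_cols_def deg_cols_def) }
  { assume "j \<in> family_cols"
    then obtain i where "i < n" "j < q" "cd j = m i" by (auto simp: family_cols_def deg_cols_def)
    then show "j \<in> lower_cols (m n)" using n m_less by (simp add: lower_cols_def) }
qed

text \<open>Each degree has as many scroll ends as it has variables in excess of columns: one in
  degree 0, none in the other degrees below n.\<close>

lemma free_vars_single:
  assumes n1: "1 \<le> n" and cnt0: "a 0 = card (deg_cols 0) + 1" and cnt: "\<And>i. 1 \<le> i \<Longrightarrow> i < n \<Longrightarrow> a i = card (deg_cols i)"
  shows "\<exists>l0. free_vars \<subseteq> {(0, l0)}"
proof -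
  have "length (chain_ends (bs 0)) = 1" using length_ends[of 0] n1 cnt0 by simp
  then obtain z where z: "chain_ends (bs 0) = [z]" by (metis One_nat_def length_0_conv length_Suc_conv)
  have z': "chain_ends (bs i) = []" if "1 \<le> i" "i < n" for i
    using length_ends[OF that(2)] cnt[OF that] by simp
  have free_vars: "fst v = 0 \<and> y v = z" if "v \<in> free_vars" for v
  proof (cases "fst v = 0")
    case True
    then show ?thesis using that z unfolding free_vars_def by auto
  next
    case False
    then show ?thesis using that z'[of "fst v"] unfolding free_vars_def by auto
  qed
  have "u = v" if "u \<in> free_vars" "v \<in> free_vars" for u v
    using y_inj free_vars[OF that(1)] free_vars[OF that(2)] that free_vars_subset unfolding inj_on_def by auto
  then show ?thesis
    by (cases "free_vars = {}") (metis free_vars empty_subsetI prod.collapse singletonI subsetI ex_in_conv)+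
qed

definition hcomp_poly :: "'k mpoly poly \<Rightarrow> 'k mpoly poly" where
  "hcomp_poly p = map_poly (hcomp m (m n)) p"

lemma coeff_hcomp_poly: "coeff (hcomp_poly p) t = hcomp m (m n) (coeff p t)"
  unfolding hcomp_poly_def by (simp add: coeff_map_poly)

text \<open>The row entries are homogeneous and free of \<mu> up to the linear structure, so taking
  the part of degree \<open>m n\<close> acts on the coefficient of column j in degree
  \<open>m n - cd j\<close>. This carries elimination from the full ideal to the graded
  module.\<close>

lemma hcomp_poly_row_ideal:
  assumes n: "n \<le> k" and x: "x \<in> family_ideal"
  shows "hcomp_poly x \<in> row_module (lower_cols (m n)) (lower_coeffs (m n)) (N P 0) (N P 1)"
proof -
  obtain A where A: "x = (\<Sum>j\<in>family_cols. A j * row (N P 0) (N P 1) j)" "\<forall>j\<in>family_cols. A j \<in> coeffs_in (Sw k a)"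
    using x unfolding row_ideal_def row_module_def by blast
  define B where "B j = map_poly (hcomp m (m n - cd j)) (A j)" for j
  have cB: "coeff (B j) t = hcomp m (m n - cd j) (coeff (A j) t)" for j t
    unfolding B_def by (simp add: coeff_map_poly)
  have "hcomp_poly x = (\<Sum>j\<in>family_cols. B j * row (N P 0) (N P 1) j)"
  proof (rule poly_eqI)
    fix t
    have "hcomp m (m n) (coeff (A j * row (N P 0) (N P 1) j) t) = coeff (B j * row (N P 0) (N P 1) j) t" if "j \<in> family_cols" for j
    proof -
      have "j \<in> lower_cols (m n)" using that lower_cols_eq[OF n] by simp
      then have j: "j < q" "cd j \<le> m n" unfolding lower_cols_def by auto
      have h: "hcomp m (m n) (g * N P r j) = hcomp m (m n - cd j) g * N P r j" for g r
        using hcomp_mult_homog'[OF N_simps(2)[OF j(1)], of "m n" g P r] j(2) by simp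
      show ?thesis unfolding row_def coeff_mult_linear
        by (cases t) (simp_all add: hcomp_diff h cB)
    qed
    then show "coeff (hcomp_poly x) t = coeff (\<Sum>j\<in>family_cols. B j * row (N P 0) (N P 1) j) t"
      unfolding coeff_hcomp_poly A(1) coeff_sum hcomp_sum by (intro sum.cong) auto
  qed
  moreover have "B j \<in> coeffs_in (lower_coeffs (m n) j)" if "j \<in> family_cols" for j
    unfolding coeffs_in_def mem_Collect_eq cB lower_coeffs_def
  proof (intro allI conjI hcomp_homog)
    fix t
    have "coeff (A j) t \<in> Sw k a" using A(2) that by (simp add: coeffs_in_def)
    then show "hcomp m (m n - cd j) (coeff (A j) t) \<in> Sw k a" unfolding Sw_PolyOn by (rule hcomp_PolyOn)
  qed
  ultimately show ?thesis unfolding row_module_def lower_cols_eq[OF n] by blast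
qed

text \<open>Elimination leaves polynomials in at most the single coordinate \<open>y (0, l0)\<close>
  of degree 1, and only its power \<open>m n\<close> lives in degree \<open>m n\<close>. Up to
  denominators this power spans the whole graded piece.\<close>

lemma rank_one:
  assumes n: "n \<le> k" and free_vars: "free_vars \<subseteq> {(0, l0)}"
    and p: "p \<in> coeffs_in (PolyOn (Low n))" "\<And>t. homog m (m n) (coeff p t)"
  shows "\<exists>D \<phi>. D \<noteq> 0 \<and> cpoly D * p - cpoly \<phi> * [:y (0, l0) ^ m n:] \<in> row_module (lower_cols (m n)) (lower_coeffs (m n)) (N P 0) (N P 1)"
proof -
  have "PolyOn (Low n) = (PolyOn {v \<in> Vars k a. fst v < n} :: 'k mpoly set)"
    using Low_iff[OF n] by (intro arg_cong[of _ _ PolyOn]) auto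
  then have "p \<in> elim_set" using p(1) by (intro Elim_coeffs_in) simp
  then obtain D f' where D: "D \<noteq> 0" "f' \<in> coeffs_in free_ring" "cpoly D * p - f' \<in> family_ideal" unfolding Elim_def by blast
  have "coeff (cpoly D * p) t = hcomp m (m n) (coeff (cpoly D * p) t)" for t
  proof -
    have "homog m (m n) (coeff (cpoly D * p) t)" unfolding coeff_mult coeff_cpoly
      by (intro homog_sum homog_Const_mult p(2))
    then show ?thesis by (simp add: hcomp_of_homog)
  qed
  then have hcp: "hcomp_poly (cpoly D * p - f') = cpoly D * p - hcomp_poly f'"
    by (intro poly_eqI) (simp add: coeff_hcomp_poly hcomp_diff)
  have coef: "\<exists>x. hcomp m (m n) f = Const x * y (0, l0) ^ m n" if fF: "f \<in> free_ring" for f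
  proof -
    obtain g where g: "g \<in> PolyOn free_vars" "f = subst y g" using fF unfolding free_ring_def by blast
    have "hcomp m (m n) f = subst y (hcomp m (m n) g)"
      unfolding g(2) by (rule hcomp_subst[OF g(1)]) (use y_good free_vars_subset in blast)
    moreover have "hcomp m (m n) g \<in> PolyOn {(0, l0)}" using hcomp_PolyOn[OF g(1)] PolyOn_mono[OF free_vars] by blast
    from homog_single_variable[OF this hcomp_homog] m0
    obtain x where "hcomp m (m n) g = Const x * Var (0, l0) ^ m n" by auto
    ultimately show ?thesis by (auto simp: subst_mult subst_power)
  qed
  have "\<exists>\<phi>. hcomp_poly f' = cpoly \<phi> * [:y (0, l0) ^ m n:]" using D(2)
  proof (induction f')
    case 0
    then show ?case by (intro exI[of _ 0]) (simp add: hcomp_poly_def)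
  next
    case (pCons f f')
    obtain x where x: "hcomp m (m n) f = Const x * y (0, l0) ^ m n" using coef pCons.prems by (auto simp: coeffs_in_pCons)
    obtain \<phi> where \<phi>: "hcomp_poly f' = cpoly \<phi> * [:y (0, l0) ^ m n:]" using pCons by (auto simp: coeffs_in_pCons)
    have "hcomp_poly (pCons f f') = pCons (hcomp m (m n) f) (hcomp_poly f')"
      by (intro poly_eqI) (simp add: coeff_hcomp_poly coeff_pCons split: nat.splits)
    then have "hcomp_poly (pCons f f') = cpoly (pCons x \<phi>) * [:y (0, l0) ^ m n:]"
      unfolding x \<phi> by (simp add: mult.commute)
    then show ?case by blast
  qed
  then obtain \<phi> where "hcomp_poly f' = cpoly \<phi> * [:y (0, l0) ^ m n:]" by blast
  then show ?thesis using hcomp_poly_row_ideal[OF n D(3)] D(1) unfolding hcp by auto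
qed

text \<open>Moving both sides together gives a syzygy of the whole generalized row with constant
  entries at the columns of degree \<open>m n\<close>, against \<open>syzygy_const\<close>.\<close>

lemma not_in_lower_ideal:
  assumes n: "n \<le> k" and st: "(s, t) \<noteq> (0, 0)" and b: "\<And>j. j \<in> lower_cols (m n) \<Longrightarrow> b j \<in> Sw k a"
    and eq: "(\<Sum>j\<in>deg_cols n. Const (x j) * (Const s * N P 0 j + Const t * N P 1 j))
      = (\<Sum>j\<in>lower_cols (m n). b j * (Const s * N P 0 j + Const t * N P 1 j))" and i: "i \<in> deg_cols n"
  shows "x i = 0"
proof -
  let ?f = "\<lambda>j. Const s * N P 0 j + Const t * N P 1 j"
  define e where "e j = (if j \<in> deg_cols n then Const (x j) else if j \<in> lower_cols (m n) then - b j else 0)" for j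
  have dis: "deg_cols n \<inter> lower_cols (m n) = {}" by (auto simp: deg_cols_def lower_cols_def)
  have "(\<Sum>j<q. e j * ?f j) = (\<Sum>j\<in>deg_cols n \<union> lower_cols (m n). e j * ?f j)"
    by (rule sum.mono_neutral_right) (auto simp: e_def deg_cols_def lower_cols_def)
  also have "\<dots> = (\<Sum>j\<in>deg_cols n. e j * ?f j) + (\<Sum>j\<in>lower_cols (m n). e j * ?f j)"
    using dis by (intro sum.union_disjoint) (auto simp: deg_cols_def lower_cols_def)
  also have "(\<Sum>j\<in>deg_cols n. e j * ?f j) = (\<Sum>j\<in>deg_cols n. Const (x j) * ?f j)" by (simp add: e_def)
  also have "(\<Sum>j\<in>lower_cols (m n). e j * ?f j) = - (\<Sum>j\<in>lower_cols (m n). b j * ?f j)"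
    unfolding sum_negf[symmetric] using dis by (intro sum.cong refl) (auto simp: e_def)
  finally have z: "(\<Sum>j<q. e j * ?f j) = 0" using eq by simp
  have "e j \<in> Sw k a" for j using b by (auto simp: e_def intro!: Sw_intros)
  from syzygy_const[OF P st this z, of i "x i"] show ?thesis using i by (simp add: e_def deg_cols_def)
qed

text \<open>A primitive relation \<open>v(\<mu>)\<close> among the linear parts of the columns of degree \<open>m n\<close> gives \<open>h(\<mu>)\<close> in the lower
  variables. The degree \<open>m n\<close> part of the lower quotient ring is a rank one \<open>K[\<mu>]\<close>-module that \<open>h\<close> generates,
  as \<open>h\<close> vanishes in no fibre; comparing degrees in \<open>\<mu>\<close> with a fixed element at \<open>\<mu> = \<infinity>\<close> is contradictory.\<close>

lemma regular_pencil:
  assumes n1: "1 \<le> n" "n \<le> k" and cnt0: "a 0 = card (deg_cols 0) + 1" and cnt: "\<And>i. 1 \<le> i \<Longrightarrow> i < n \<Longrightarrow> a i = card (deg_cols i)"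
    and rel: "\<And>l. l \<in> {1..a n} \<Longrightarrow> (\<Sum>j\<in>deg_cols n. v j * [:vcoef (N P 0 j) (n, l), - vcoef (N P 1 j) (n, l):]) = 0"
    and prim: "\<And>\<epsilon>. \<exists>j\<in>deg_cols n. poly (v j) \<epsilon> \<noteq> 0"
  shows False
proof -
  let ?L = "row_module (lower_cols (m n)) (lower_coeffs (m n)) (N P 0) (N P 1)"
  let ?f = "\<lambda>s t j. Const s * N P 0 j + Const t * N P 1 j"
  have finJ: "finite (deg_cols n)" "finite (lower_cols (m n))" by (auto simp: deg_cols_def lower_cols_def)
  have ks: "scalar_closed (lower_coeffs (m n) j)" for j by (rule scalar_closed_lower_coeffs)
  note K = koszul_N_graded[OF P, of "m n"]
  note clo = row_module_diff[OF ks] row_module_cpoly_mult[OF ks]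
  define h where "h = (\<Sum>j\<in>deg_cols n. cpoly (v j) * row (N P 0) (N P 1) j)"
  have coeff_h: "coeff h t = (\<Sum>j\<in>deg_cols n. Const (coeff (v j) t) * N P 0 j + (case t of 0 \<Rightarrow> 0 | Suc s \<Rightarrow> Const (coeff (v j) s) * - N P 1 j))" for t
    unfolding h_def row_def coeff_sum coeff_mult_linear coeff_cpoly by (simp split: nat.splits)
  have hS: "coeff h t \<in> Sw k a" "homog m (m n) (coeff h t)" for t
  proof -
    have *: "N P r j \<in> Sw k a" "homog m (m n) (N P r j)" if "j \<in> deg_cols n" for r j
      using N_simps[of j P r] that by (auto simp: deg_cols_def)
    show "coeff h t \<in> Sw k a" unfolding coeff_h
      by (cases t) (auto intro!: Sw_intros * simp del: mult_minus_right)
    show "homog m (m n) (coeff h t)" unfolding coeff_h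
      by (intro homog_sum homog_add homog_Const_mult *, assumption, cases t) (auto intro!: homog_Const_mult homog_uminus *)
  qed
  have hlow: "lower_poly k a m n (coeff h t)" for t
  proof (rule lin_eq_0_lower[OF hS _ n1(2)])
    have "vcoef (coeff h t) (n, l) = 0" if "l \<in> {1..a n}" for l
    proof -
      have "vcoef (coeff h t) (n, l) = coeff (\<Sum>j\<in>deg_cols n. v j * [:vcoef (N P 0 j) (n, l), - vcoef (N P 1 j) (n, l):]) t"
        unfolding coeff_h coeff_sum coeff_mult_linear vcoef_sum by (cases t) simp_all
      then show ?thesis using rel[OF that] by simp
    qed
    then show "lin n (coeff h t) = 0" unfolding lin_def by simp
  qed
  have poly_h: "poly h (Const \<epsilon>) = (\<Sum>j\<in>deg_cols n. Const (poly (v j) \<epsilon>) * ?f 1 (- \<epsilon>) j)" for \<epsilon>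
    unfolding h_def by (simp only: poly_sum poly_mult poly_cpoly poly_row)
  have hlow': "h \<in> coeffs_in (PolyOn (Low n))" using hlow unfolding coeffs_in_def lower_poly_iff by blast
  have evalL: "\<exists>b. (\<forall>j\<in>lower_cols (m n). b j \<in> Sw k a) \<and> poly x (Const \<epsilon>) = (\<Sum>j\<in>lower_cols (m n). b j * ?f 1 (- \<epsilon>) j)"
    if xL: "x \<in> ?L" for x \<epsilon>
  proof -
    obtain A where A: "x = (\<Sum>j\<in>lower_cols (m n). A j * row (N P 0) (N P 1) j)" "\<forall>j\<in>lower_cols (m n). A j \<in> coeffs_in (lower_coeffs (m n) j)"
      using xL unfolding row_module_def by blast
    have "poly (A j) (Const \<epsilon>) \<in> Sw k a" if "j \<in> lower_cols (m n)" for j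
      using coeffs_in_poly[OF ks bspec[OF A(2) that], of \<epsilon>] by (simp add: lower_coeffs_def)
    moreover have "poly x (Const \<epsilon>) = (\<Sum>j\<in>lower_cols (m n). poly (A j) (Const \<epsilon>) * ?f 1 (- \<epsilon>) j)"
      unfolding A(1) by (simp only: poly_sum poly_mult poly_row)
    ultimately show ?thesis by (intro exI[of _ "\<lambda>j. poly (A j) (Const \<epsilon>)"] conjI ballI)
  qed
  \<comment> \<open>Primitivity supplies an entry of v that is nonzero at \<epsilon>, so by
    \<open>not_in_lower_ideal\<close> the value of h is nonzero modulo the lower columns in every
    finite fibre.\<close>
  have notL: "x = 0" if zL: "z \<in> ?L" "poly z (Const \<epsilon>) = Const x * poly h (Const \<epsilon>)" for x z \<epsilon>
  proof -
    obtain b where b: "\<forall>j\<in>lower_cols (m n). b j \<in> Sw k a" "poly z (Const \<epsilon>) = (\<Sum>j\<in>lower_cols (m n). b j * ?f 1 (- \<epsilon>) j)"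
      using evalL[OF zL(1)] by blast
    obtain i where i: "i \<in> deg_cols n" "poly (v i) \<epsilon> \<noteq> 0" using prim by blast
    have "(\<Sum>j\<in>deg_cols n. Const (x * poly (v j) \<epsilon>) * ?f 1 (- \<epsilon>) j) = Const x * poly h (Const \<epsilon>)"
      unfolding poly_h sum_distrib_left by (intro sum.cong refl) (simp only: Const_mult mult.assoc)
    also have "\<dots> = (\<Sum>j\<in>lower_cols (m n). b j * ?f 1 (- \<epsilon>) j)" using zL(2) b(2) by simp
    finally have "x * poly (v i) \<epsilon> = 0"
      by (intro not_in_lower_ideal[OF n1(2) _ _ _ i(1), of 1 "- \<epsilon>" b "\<lambda>j. x * poly (v j) \<epsilon>"]) (use b(1) in auto)
    then show ?thesis using i(2) by simp
  qed
  obtain l0 where l0: "free_vars \<subseteq> {(0, l0)}" using free_vars_single[OF n1(1) cnt0 cnt] by blast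
  define Z where "Z = [:y (0, l0) ^ m n:]"
  \<comment> \<open>The comparison element is the value of h at \<mu> = 0: it is constant in \<mu>
    and nonzero in the fibre over 0.\<close>
  define f where "f = coeff h 0"
  have f0: "f = poly h (Const 0)" by (simp add: f_def poly_0_coeff_0)
  obtain D1 \<phi>1 where 1: "D1 \<noteq> 0" "cpoly D1 * [:f:] - cpoly \<phi>1 * Z \<in> ?L"
  proof -
    have "[:f:] \<in> coeffs_in (PolyOn (Low n))" using hlow[of 0] unfolding f_def by (simp add: coeffs_in_pCons lower_poly_iff) (simp add: coeffs_in_def)
    moreover have "homog m (m n) (coeff [:f:] t)" for t
      using hS(2)[of 0] unfolding f_def by (cases t) simp_all
    ultimately show ?thesis using that rank_one[OF n1(2) l0, of "[:f:]"] unfolding Z_def by blast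
  qed
  obtain D2 \<phi>2 where 2: "D2 \<noteq> 0" "cpoly D2 * h - cpoly \<phi>2 * Z \<in> ?L"
    unfolding Z_def using rank_one[OF n1(2) l0 hlow' hS(2)] by blast
  have "\<phi>2 \<noteq> 0"
  proof
    assume "\<phi>2 = 0"
    then have "cpoly D2 * h \<in> ?L" using 2 by simp
    then have "h \<in> ?L" using row_module_torsion_free'[OF alg finJ(2) ks K 2(1)] by blast
    from notL[OF this, of 0 1] show False by simp
  qed
  then have D0: "\<phi>2 * D1 \<noteq> 0" using 1 by simp
  \<comment> \<open>Elements of a module of rank one are proportional: cancelling Z gives \<alpha> f
    = \<beta> h modulo the lower module, with \<alpha> nonzero.\<close>
  have "cpoly \<phi>2 * (cpoly D1 * [:f:] - cpoly \<phi>1 * Z) - cpoly \<phi>1 * (cpoly D2 * h - cpoly \<phi>2 * Z) \<in> ?L"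
    by (intro clo 1 2)
  also have "cpoly \<phi>2 * (cpoly D1 * [:f:] - cpoly \<phi>1 * Z) - cpoly \<phi>1 * (cpoly D2 * h - cpoly \<phi>2 * Z)
      = cpoly (\<phi>2 * D1) * [:f:] - cpoly (\<phi>1 * D2) * h"
    unfolding cpoly_mult right_diff_distrib by (simp only: mult_ac) simp
  finally have "\<exists>e0 \<alpha> \<beta>. \<alpha> \<noteq> 0 \<and> cpoly \<alpha> * [:f:] - cpoly \<beta> * h \<in> ?L \<and> degree \<alpha> = e0" using D0 by blast
  then obtain e0 where e0: "\<exists>\<alpha> \<beta>. \<alpha> \<noteq> 0 \<and> cpoly \<alpha> * [:f:] - cpoly \<beta> * h \<in> ?L \<and> degree \<alpha> = e0"
    and min: "\<And>e0'. e0' < e0 \<Longrightarrow> \<not> (\<exists>\<alpha> \<beta>. \<alpha> \<noteq> 0 \<and> cpoly \<alpha> * [:f:] - cpoly \<beta> * h \<in> ?L \<and> degree \<alpha> = e0')"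
    by (subst (asm) exists_least_iff) blast
  from e0 obtain \<alpha> \<beta> where ab: "\<alpha> \<noteq> 0" "cpoly \<alpha> * [:f:] - cpoly \<beta> * h \<in> ?L" "degree \<alpha> = e0" by blast
  \<comment> \<open>Over a root of \<alpha> only a multiple of h is left, and h is nonzero in that
    fibre, so \<beta> has the same root. Torsion-freeness removes the common factor, against
    minimality of the degree. Hence \<alpha> is constant and f is a multiple of h.\<close>
  have "e0 = 0"
  proof (rule ccontr)
    assume "e0 \<noteq> 0"
    then have "1 \<le> degree \<alpha>" using ab(3) by simp
    then obtain \<epsilon> where e: "poly \<alpha> \<epsilon> = 0" using alg unfolding alg_closed_field_def by blast
    have "poly (cpoly \<alpha> * [:f:] - cpoly \<beta> * h) (Const \<epsilon>) = Const (- poly \<beta> \<epsilon>) * poly h (Const \<epsilon>)"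
      by (simp add: poly_cpoly e Const_uminus)
    from notL[OF ab(2) this] have "poly \<beta> \<epsilon> = 0" by simp
    then obtain \<beta>' where b': "\<beta> = [:- \<epsilon>, 1:] * \<beta>'" unfolding poly_eq_0_iff_dvd by (rule dvdE)
    obtain \<alpha>' where a': "\<alpha> = [:- \<epsilon>, 1:] * \<alpha>'" using e unfolding poly_eq_0_iff_dvd by (rule dvdE)
    note ab' = a' b'
    have eq: "cpoly \<alpha> * [:f:] - cpoly \<beta> * h = [:- Const \<epsilon>, 1:] * (cpoly \<alpha>' * [:f:] - cpoly \<beta>' * h)"
      unfolding ab' cpoly_mult by (simp only: cpoly_simps Const_uminus Const_simps right_diff_distrib mult.assoc)
    have "cpoly \<alpha>' * [:f:] - cpoly \<beta>' * h \<in> ?L"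
      by (rule row_module_torsion_free[OF finJ(2) ks K, of \<epsilon>], subst eq[symmetric], rule ab(2))
    moreover have "\<alpha>' \<noteq> 0" using ab(1) ab' by auto
    moreover have "degree \<alpha>' < e0" using ab(3) ab'(1) \<open>\<alpha>' \<noteq> 0\<close> by (simp add: degree_mult_eq del: mult_pCons_left)
    ultimately show False using min by blast
  qed
  then obtain x where x: "\<alpha> = [:x:]" using ab(3) by (metis degree_eq_zeroE)
  then have x0: "x \<noteq> 0" using ab(1) by auto
  define \<gamma> where "\<gamma> = smult (inverse x) \<beta>"
  have "cpoly [:inverse x:] * (cpoly \<alpha> * [:f:] - cpoly \<beta> * h) \<in> ?L" by (intro clo ab)
  also have "cpoly [:inverse x:] * (cpoly \<alpha> * [:f:] - cpoly \<beta> * h) = [:f:] - cpoly \<gamma> * h"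
  proof -
    have "cpoly [:inverse x:] * cpoly \<alpha> = 1" "cpoly [:inverse x:] * cpoly \<beta> = cpoly \<gamma>"
      unfolding cpoly_mult[symmetric] using x x0 by (simp_all add: \<gamma>_def)
    then show ?thesis by (simp only: right_diff_distrib mult.assoc[symmetric] mult_1_left)
  qed
  finally have main: "[:f:] - cpoly \<gamma> * h \<in> ?L" .
  have g0: "\<gamma> \<noteq> 0"
  proof
    assume "\<gamma> = 0"
    then have "[:f:] \<in> ?L" using main by simp
    from notL[OF this, of 0 1] show False by (simp add: f0)
  qed
  \<comment> \<open>The degree of h in \<mu> is at most \<eta> + 1, with \<eta> from v and one from
    the row. The coefficient there is, up to sign, the value of h at infinity, and some
    \<open>v i\<close> contributes to it with a nonzero constant.\<close>
  define \<eta> where "\<eta> = Max ((\<lambda>j. degree (v j)) ` deg_cols n)"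
  have Jne: "deg_cols n \<noteq> {}" using prim by blast
  have deg_v: "degree (v j) \<le> \<eta>" if "j \<in> deg_cols n" for j unfolding \<eta>_def using that finJ by simp
  have "\<exists>i\<in>deg_cols n. coeff (v i) \<eta> \<noteq> 0"
  proof (cases "\<eta> = 0")
    case True
    obtain i where i: "i \<in> deg_cols n" "poly (v i) 0 \<noteq> 0" using prim by blast
    then show ?thesis using True by (auto simp: poly_0_coeff_0)
  next
    case False
    have "\<eta> \<in> (\<lambda>j. degree (v j)) ` deg_cols n" unfolding \<eta>_def using finJ Jne by (intro Max_in) auto
    then obtain i where i: "i \<in> deg_cols n" "degree (v i) = \<eta>" by auto
    then have "v i \<noteq> 0" using False by auto
    then show ?thesis using i leading_coeff_neq_0 by metis
  qed
  then obtain i where i: "i \<in> deg_cols n" "coeff (v i) \<eta> \<noteq> 0" by blast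
  define H where "H = (\<Sum>j\<in>deg_cols n. Const (coeff (v j) \<eta>) * N P 1 j)"
  have top_h: "coeff h (Suc \<eta>) = - H"
    unfolding coeff_h H_def using deg_v by (simp add: coeff_eq_0 sum_negf le_imp_less_Suc)
  have deg_h: "degree h \<le> Suc \<eta>"
  proof (rule degree_le, intro allI impI)
    fix t assume t: "Suc \<eta> < t"
    then obtain s where s: "t = Suc s" "\<eta> < s" by (cases t) auto
    show "coeff h t = 0" unfolding coeff_h s(1)
      by (rule sum.neutral) (use deg_v s in \<open>force simp: coeff_eq_0\<close>)
  qed
  \<comment> \<open>As f is constant in \<mu>, the coefficient of f - \<gamma> h at T + 1 is the
    leading coefficient of \<gamma> times H. The degree bound expresses it through the bottom
    entries of the lower columns, which \<open>not_in_lower_ideal\<close> forbids.\<close>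
  define T where "T = degree \<gamma> + \<eta>"
  have dg: "degree (cpoly \<gamma> * h) \<le> Suc T"
    using degree_mult_le[of "cpoly \<gamma>" h] deg_h unfolding T_def by simp
  have degb: "degree ([:f:] - cpoly \<gamma> * h) \<le> Suc T" using dg by (intro degree_diff_le) simp_all
  obtain A where
    A: "[:f:] - cpoly \<gamma> * h = (\<Sum>j\<in>lower_cols (m n). A j * row (N P 0) (N P 1) j)"
      "\<And>j. j \<in> lower_cols (m n) \<Longrightarrow> A j \<in> coeffs_in (lower_coeffs (m n) j)" "\<And>j. j \<in> lower_cols (m n) \<Longrightarrow> degree (A j) \<le> T"
    by (rule row_module_degree_bound[OF finJ(2) ks K main degb]) (rule that)
  have "coeff (cpoly \<gamma> * h) (Suc T) = Const (coeff \<gamma> (degree \<gamma>)) * coeff h (Suc \<eta>)"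
  proof -
    have "coeff (cpoly \<gamma> * h) (degree \<gamma> + Suc \<eta>) = (\<Sum>i\<le>degree \<gamma> + Suc \<eta>. if i = degree \<gamma> then coeff (cpoly \<gamma>) i * coeff h (degree \<gamma> + Suc \<eta> - i) else 0)"
      unfolding coeff_mult
    proof (intro sum.cong refl)
      fix i assume "i \<in> {..degree \<gamma> + Suc \<eta>}"
      then consider "i = degree \<gamma>" | "degree \<gamma> < i" | "Suc \<eta> < degree \<gamma> + Suc \<eta> - i" by fastforce
      then show "coeff (cpoly \<gamma>) i * coeff h (degree \<gamma> + Suc \<eta> - i) = (if i = degree \<gamma> then coeff (cpoly \<gamma>) i * coeff h (degree \<gamma> + Suc \<eta> - i) else 0)"
      proof cases
        case 2
        then show ?thesis by (simp add: coeff_eq_0)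
      next
        case 3
        then have "coeff h (degree \<gamma> + Suc \<eta> - i) = 0" using deg_h by (intro coeff_eq_0) linarith
        moreover have "i \<noteq> degree \<gamma>" using 3 by auto
        ultimately show ?thesis by simp
      qed simp
    qed
    then show ?thesis by (simp add: T_def)
  qed
  then have "coeff ([:f:] - cpoly \<gamma> * h) (Suc T) = Const (coeff \<gamma> (degree \<gamma>)) * H" by (simp add: top_h)
  also have "Const (coeff \<gamma> (degree \<gamma>)) * H = (\<Sum>j\<in>deg_cols n. Const (coeff \<gamma> (degree \<gamma>) * coeff (v j) \<eta>) * ?f 0 1 j)"
    by (simp add: H_def sum_distrib_left Const_mult mult.assoc)
  finally have "(\<Sum>j\<in>deg_cols n. Const (coeff \<gamma> (degree \<gamma>) * coeff (v j) \<eta>) * ?f 0 1 j) = coeff ([:f:] - cpoly \<gamma> * h) (Suc T)" ..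
  also have "\<dots> = (\<Sum>j\<in>lower_cols (m n). - coeff (A j) T * ?f 0 1 j)"
    unfolding A(1) coeff_sum row_def coeff_mult_linear using A(3)
    by (intro sum.cong refl) (simp add: coeff_eq_0 le_imp_less_Suc)
  finally have eq: "(\<Sum>j\<in>deg_cols n. Const (coeff \<gamma> (degree \<gamma>) * coeff (v j) \<eta>) * ?f 0 1 j) = (\<Sum>j\<in>lower_cols (m n). - coeff (A j) T * ?f 0 1 j)" .
  have "- coeff (A j) T \<in> Sw k a" if "j \<in> lower_cols (m n)" for j
    using A(2)[OF that] unfolding coeffs_in_def lower_coeffs_def by (auto intro: Sw_intros)
  from not_in_lower_ideal[OF n1(2) _ this eq i(1)] have "coeff \<gamma> (degree \<gamma>) * coeff (v i) \<eta> = 0" by simp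
  then show False using i(2) g0 by simp
qed

end

section \<open>Primality of the ideal of minors\<close>

text \<open>The terms (i, j) and (j, i) combine to a 2 x 2 minor. With x and y as the two rows, a
  Koszul syzygy of one row, paired with the other row, becomes an element of the ideal of
  minors.\<close>

lemma antisym_sum_pairs:
  fixes e :: "nat \<Rightarrow> nat \<Rightarrow> 'a::comm_ring_1"
  assumes "\<And>i j. i < q \<Longrightarrow> j < q \<Longrightarrow> e j i = - e i j" "\<And>i. i < q \<Longrightarrow> e i i = 0"
  shows "(\<Sum>i<q. \<Sum>j<q. e i j * y j * x i) = (\<Sum>(i, j)\<in>{(i, j). i < j \<and> j < q}. e i j * (x i * y j - x j * y i))"
  using assms
proof (induction q)
  case (Suc q)
  let ?P = "\<lambda>q. {(i, j). i < j \<and> j < (q::nat)}"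
  have fin: "finite (?P q)" by (rule finite_subset[of _ "{..<q} \<times> {..<q}"]) auto
  have P: "?P (Suc q) = ?P q \<union> (\<lambda>i. (i, q)) ` {..<q}" by (auto simp: less_Suc_eq)
  have "(\<Sum>(i, j)\<in>?P (Suc q). e i j * (x i * y j - x j * y i))
      = (\<Sum>(i, j)\<in>?P q. e i j * (x i * y j - x j * y i)) + (\<Sum>i<q. e i q * (x i * y q - x q * y i))"
  proof -
    have "?P q \<inter> (\<lambda>i. (i, q)) ` {..<q} = {}" by auto
    then have u: "(\<Sum>t\<in>?P q \<union> (\<lambda>i. (i, q)) ` {..<q}. h t) = (\<Sum>t\<in>?P q. h t) + (\<Sum>t\<in>(\<lambda>i. (i, q)) ` {..<q}. h t)" for h :: "_ \<Rightarrow> 'a"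
      by (rule sum.union_disjoint[OF fin finite_imageI[OF finite_lessThan]])
    have "(\<Sum>(i, j)\<in>(\<lambda>i. (i, q)) ` {..<q}. e i j * (x i * y j - x j * y i)) = (\<Sum>i<q. e i q * (x i * y q - x q * y i))"
      by (subst sum.reindex) (simp_all add: inj_on_def)
    then show ?thesis unfolding P u by simp
  qed
  also have "(\<Sum>(i, j)\<in>?P q. e i j * (x i * y j - x j * y i)) = (\<Sum>i<q. \<Sum>j<q. e i j * y j * x i)"
    by (rule Suc.IH[symmetric], rule Suc.prems(1), simp_all only: less_SucI, rule Suc.prems(2), simp only: less_SucI)
  also have "(\<Sum>i<q. e i q * (x i * y q - x q * y i)) = (\<Sum>i<q. e i q * y q * x i) + (\<Sum>j<q. e q j * y j * x q)"
    unfolding sum.distrib[symmetric]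
  proof (rule sum.cong[OF refl])
    fix i assume "i \<in> {..<q}"
    then have "e q i = - e i q" using Suc.prems(1)[of i q] by simp
    then show "e i q * (x i * y q - x q * y i) = e i q * y q * x i + e q i * y i * x q" by (simp add: algebra_simps)
  qed
  finally show ?case using Suc.prems(2)[of q] by (simp add: sum.distrib)
qed simp

text \<open>For nonconstant D a root of D - 1 will do; algebraic closure takes the place of
  infinitely many scalars.\<close>

lemma exists_nonroot:
  assumes alg: "alg_closed_field TYPE('k::field)" and D: "(D :: 'k poly) \<noteq> 0"
  shows "\<exists>\<epsilon>. poly D \<epsilon> \<noteq> 0"
proof (cases "degree D = 0")
  case True
  then obtain c where "D = [:c:]" by (metis degree_eq_zeroE)
  then show ?thesis using D by (intro exI[of _ 0]) auto
next
  case False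
  have "degree (D - 1) = degree D" using False degree_add_eq_left[of "- 1" D] by simp
  then obtain \<epsilon> where "poly (D - 1) \<epsilon> = 0" using alg False unfolding alg_closed_field_def
    by (metis One_nat_def Suc_leI gr0I)
  then show ?thesis by (intro exI[of _ \<epsilon>]) simp
qed

context generic_matrix
begin

lemma NF_family_exists:
  assumes "\<And>i. i < n \<Longrightarrow> i \<le> k \<and> injrow i (deg_cols i) (N P 0)" "row_det P \<noteq> 0" "n \<le> Suc k"
  shows "\<exists>bs css c c' d d'. nf_family k a m q M cd P n bs css c c' d d'"
proof -
  have "\<forall>i. \<exists>t. i < n \<longrightarrow> (\<lambda>(bs, css, c, c', d, d'). is_normal_form P i bs css c c' d d') t"
    using normal_form_exists assms(1) by (simp add: split_paired_Ex)
  from choice[OF this] obtain f where f: "\<forall>i. i < n \<longrightarrow> (\<lambda>(bs, css, c, c', d, d'). is_normal_form P i bs css c c' d d') (f i)" by blast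
  have "nf_family k a m q M cd P n (\<lambda>i. fst (f i)) (\<lambda>i. fst (snd (f i))) (\<lambda>i. fst (snd (snd (f i))))
    (\<lambda>i. fst (snd (snd (snd (f i))))) (\<lambda>i. fst (snd (snd (snd (snd (f i)))))) (\<lambda>i. snd (snd (snd (snd (snd (f i))))))"
    by unfold_locales (use assms(2,3) f in \<open>auto simp: case_prod_beta\<close>)
  then show ?thesis by blast
qed

lemma injrow_iff:
  "i \<le> k \<Longrightarrow> injrow i J w \<longleftrightarrow> (\<forall>c. (\<forall>l\<in>{1..a i}. (\<Sum>j\<in>J. c j * vcoef (w j) (i, l)) = 0) \<longrightarrow> (\<forall>j\<in>J. c j = 0))"
proof -
  assume i: "i \<le> k"
  have "lin i (\<Sum>j\<in>J. Const (c j) * w j) = 0 \<longleftrightarrow> (\<forall>l\<in>{1..a i}. (\<Sum>j\<in>J. c j * vcoef (w j) (i, l)) = 0)" for c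
  proof
    assume "lin i (\<Sum>j\<in>J. Const (c j) * w j) = 0"
    then have "vcoef (lin i (\<Sum>j\<in>J. Const (c j) * w j)) (i, l) = 0" for l by simp
    moreover have "vcoef (lin i (\<Sum>j\<in>J. Const (c j) * w j)) (i, l) = (\<Sum>j\<in>J. c j * vcoef (w j) (i, l))" if "l \<in> {1..a i}" for l
      using i that by (simp add: vcoef_lin Vars_iff vcoef_sum)
    ultimately show "\<forall>l\<in>{1..a i}. (\<Sum>j\<in>J. c j * vcoef (w j) (i, l)) = 0" by simp
  next
    assume "\<forall>l\<in>{1..a i}. (\<Sum>j\<in>J. c j * vcoef (w j) (i, l)) = 0"
    then show "lin i (\<Sum>j\<in>J. Const (c j) * w j) = 0" unfolding lin_def vcoef_sum by (intro sum.neutral) simp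
  qed
  then show ?thesis unfolding injrow_def by blast
qed

lemma pencil_cases:
  assumes i: "i \<le> k"
  obtains (rel) v where "\<And>l. l \<in> {1..a i} \<Longrightarrow> (\<Sum>j\<in>deg_cols i. v j * [:vcoef (N P 0 j) (i, l), - vcoef (N P 1 j) (i, l):]) = 0"
      "\<And>\<epsilon>. \<exists>j\<in>deg_cols i. poly (v j) \<epsilon> \<noteq> 0"
  | (inj) D where "D \<noteq> 0" "\<And>\<epsilon>. poly D \<epsilon> \<noteq> 0 \<Longrightarrow> injrow i (deg_cols i) (\<lambda>j. N P 0 j - Const \<epsilon> * N P 1 j)"
proof -
  let ?L = "\<lambda>j l. [:vcoef (N P 0 j) (i, l), - vcoef (N P 1 j) (i, l):]"
  have fin: "finite (deg_cols i)" by (simp add: deg_cols_def)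
  show ?thesis
  proof (rule pencil_dichotomy[OF fin, of "{1..a i}" ?L])
    fix v assume "\<And>l. l \<in> {1..a i} \<Longrightarrow> (\<Sum>j\<in>deg_cols i. v j * ?L j l) = 0" "\<And>\<epsilon>. \<exists>j\<in>deg_cols i. poly (v j) \<epsilon> \<noteq> 0"
    then show thesis by (rule rel)
  next
    fix D assume D: "D \<noteq> 0" "\<And>\<epsilon> t. poly D \<epsilon> \<noteq> 0 \<Longrightarrow> \<forall>l\<in>{1..a i}. (\<Sum>j\<in>deg_cols i. t j * poly (?L j l) \<epsilon>) = 0 \<Longrightarrow> \<forall>j\<in>deg_cols i. t j = 0"
    have "poly (?L j l) \<epsilon> = vcoef (N P 0 j - Const \<epsilon> * N P 1 j) (i, l)" for j l \<epsilon> by simp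
    then have "injrow i (deg_cols i) (\<lambda>j. N P 0 j - Const \<epsilon> * N P 1 j)" if "poly D \<epsilon> \<noteq> 0" for \<epsilon>
      unfolding injrow_iff[OF i] using D(2)[OF that] by presburger
    then show thesis using D(1) by (intro inj)
  qed
qed

text \<open>In degree n a primitive relation is excluded by \<open>regular_pencil\<close>, applied
  to the normal forms available for the present P. Then, in each degree up to n, injectivity can
  fail only at roots of a nonzero polynomial, and a common non-root \<epsilon> gives the new top row
  for all these degrees.\<close>

lemma generic_row:
  assumes cnt0: "a 0 = card (deg_cols 0) + 1" and cnt: "\<And>i. 1 \<le> i \<Longrightarrow> i < k \<Longrightarrow> a i = card (deg_cols i)"
  shows "n \<le> Suc k \<Longrightarrow> \<exists>P. row_det P \<noteq> 0 \<and> (\<forall>i<n. injrow i (deg_cols i) (N P 0))"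
proof (induction n)
  case 0
  have "row_det (\<lambda>r s. if r = s then 1 else 0) \<noteq> 0" by (simp add: row_det_def)
  then show ?case by blast
next
  case (Suc n)
  then obtain P where P: "row_det P \<noteq> 0" "\<forall>i<n. injrow i (deg_cols i) (N P 0)" by auto
  show ?case
  proof (cases "n = 0")
    case True
    then show ?thesis using P(1) injrow_0[OF P(1)] by auto
  next
    case False
    have nk: "n \<le> k" using Suc.prems by simp
    have "\<exists>D. D \<noteq> 0 \<and> (\<forall>\<epsilon>. poly D \<epsilon> \<noteq> 0 \<longrightarrow> injrow i (deg_cols i) (\<lambda>j. N P 0 j - Const \<epsilon> * N P 1 j))" if i: "i < Suc n" for i
    proof -
      have ik: "i \<le> k" using i nk by simp
      show ?thesis
      proof (cases rule: pencil_cases[OF ik, of P])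
        case (1 v)
        have False
        proof (cases "i = n")
          case True
          obtain bs css c c' d d' where "nf_family k a m q M cd P n bs css c c' d d'"
            using NF_family_exists[of n P] P nk by auto
          then interpret nf_family k a m q M cd P n bs css c c' d d' .
          show False
          proof (rule regular_pencil[OF _ nk cnt0])
            show "1 \<le> n" using \<open>n \<noteq> 0\<close> by simp
            show "a i = card (deg_cols i)" if "1 \<le> i" "i < n" for i using cnt[OF that(1)] that(2) nk by simp
          qed (use 1 True in \<open>simp_all only:\<close>)
        next
          \<comment> \<open>In a smaller degree P already gives injectivity at \<mu> = 0, where a
            primitive relation does not vanish.\<close>
          case False
          then have inj: "injrow i (deg_cols i) (N P 0)" using P(2) i by simp
          have "(\<Sum>j\<in>deg_cols i. poly (v j) 0 * vcoef (N P 0 j) (i, l)) = 0" if "l \<in> {1..a i}" for l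
            using arg_cong[OF 1(1)[OF that], of "\<lambda>p. poly p 0"] by (simp add: poly_sum mult.commute)
          then have "\<forall>j\<in>deg_cols i. poly (v j) 0 = 0"
            using inj[unfolded injrow_iff[OF ik], THEN spec[of _ "\<lambda>j. poly (v j) 0"]] by simp
          then show False using 1(2)[of 0] by blast
        qed
        then show ?thesis ..
      qed blast
    qed
    then have "\<forall>i\<in>{..n}. \<exists>D. D \<noteq> 0 \<and> (\<forall>\<epsilon>. poly D \<epsilon> \<noteq> 0 \<longrightarrow> injrow i (deg_cols i) (\<lambda>j. N P 0 j - Const \<epsilon> * N P 1 j))" by simp
    from bchoice[OF this] obtain D where D: "\<forall>i\<in>{..n}. D i \<noteq> 0 \<and> (\<forall>\<epsilon>. poly (D i) \<epsilon> \<noteq> 0 \<longrightarrow> injrow i (deg_cols i) (\<lambda>j. N P 0 j - Const \<epsilon> * N P 1 j))" by blast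
    have "(\<Prod>i\<in>{..n}. D i) \<noteq> 0" using D by simp
    then obtain \<epsilon> where "poly (\<Prod>i\<in>{..n}. D i) \<epsilon> \<noteq> 0" using exists_nonroot[OF alg] by blast
    then have e: "\<forall>i\<in>{..n}. poly (D i) \<epsilon> \<noteq> 0" by (simp add: poly_prod)
    \<comment> \<open>A shear of the rows moves the point \<mu> = \<epsilon> to \<mu> = 0 and keeps
      the determinant.\<close>
    define P' where "P' r s = (if r = 0 then P 0 s - \<epsilon> * P 1 s else P r s)" for r s :: nat
    have "row_det P' = row_det P" by (simp add: row_det_def P'_def algebra_simps)
    moreover have "N P' 0 = (\<lambda>j. N P 0 j - Const \<epsilon> * N P 1 j)"
      by (rule ext) (simp add: N_def P'_def Const_diff Const_mult algebra_simps)
    ultimately show ?thesis using P(1) D e by (intro exI[of _ P']) auto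
  qed
qed

section \<open>Minors as the \<mu>-free elements of the row ideal\<close>

definition minor :: "nat \<times> nat \<Rightarrow> 'k mpoly" where
  "minor = (\<lambda>(j, l). M 0 j * M 1 l - M 0 l * M 1 j)"

lemma I2_image: "I2 k a q M = gen_ideal (Sw k a) (minor ` {(j, l). j < l \<and> l < q})"
  unfolding I2_def minor_def by (rule arg_cong[of _ _ "gen_ideal (Sw k a)"]) auto

lemma finite_pairs: "finite {(j, l). j < l \<and> l < (q::nat)}"
  by (rule finite_subset[of _ "{..<q} \<times> {..<q}"]) auto

lemma minor_N: "N P 0 j * N P 1 l - N P 0 l * N P 1 j = Const (row_det P) * minor (j, l)"
  unfolding N_def minor_def row_det_def by (simp add: Const_diff Const_mult algebra_simps)

text \<open>With r_j the generic row, N_1l r_j - N_1j r_l is free of \<mu> and equals a minor of N,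
  which is \<open>row_det P\<close> times the minor of M.\<close>

lemma I2_to_row_ideal:
  assumes P: "row_det P \<noteq> 0" and f: "f \<in> I2 k a q M"
  shows "[:f:] \<in> row_ideal {..<q} (N P 0) (N P 1)"
proof -
  obtain b where b: "\<forall>t\<in>{(j, l). j < l \<and> l < q}. b t \<in> Sw k a" "f = (\<Sum>t\<in>{(j, l). j < l \<and> l < q}. b t * minor t)"
    using f unfolding I2_image gen_ideal_Sw_image[OF finite_pairs] by blast
  have "[:b t * minor t:] \<in> row_ideal {..<q} (N P 0) (N P 1)" if t: "t \<in> {(j, l). j < l \<and> l < q}" for t
  proof -
    obtain j l where jl: "t = (j, l)" "j < q" "l < q" using t by auto
    define x where "x r j = [:Const (inverse (row_det P)) * b t * N P r j:]" for r j
    have xC: "x r i \<in> coeffs_in (Sw k a)" if "i < q" for r i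
      unfolding x_def using N_simps(1)[OF that] b(1) t by (auto simp: coeffs_in_pCons coeffs_in_0 scalar_closed_Sw intro!: Sw_intros)
    have "x 1 l * row (N P 0) (N P 1) j - x 1 j * row (N P 0) (N P 1) l \<in> row_ideal {..<q} (N P 0) (N P 1)"
      using jl by (intro row_ideal_diff row_ideal_mult row_ideal_row xC) auto
    also have "x 1 l * row (N P 0) (N P 1) j - x 1 j * row (N P 0) (N P 1) l
        = [:Const (inverse (row_det P)) * b t * (N P 0 j * N P 1 l - N P 0 l * N P 1 j):]"
      unfolding x_def row_def by (simp add: algebra_simps)
    also have "\<dots> = [:(Const (inverse (row_det P)) * Const (row_det P)) * (b t * minor t):]"
      unfolding minor_N jl(1) by (simp only: mult_ac)
    also have "\<dots> = [:b t * minor t:]" unfolding Const_mult[symmetric] using P by simp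
    finally show ?thesis .
  qed
  then have "(\<Sum>t\<in>{(j, l). j < l \<and> l < q}. [:b t * minor t:]) \<in> row_ideal {..<q} (N P 0) (N P 1)" by (rule row_ideal_sum)
  moreover have "(\<Sum>t\<in>T. [:g t:]) = [:\<Sum>t\<in>T. g t:]" for g :: "nat \<times> nat \<Rightarrow> 'k mpoly" and T
    by (induction T rule: infinite_finite_induct) simp_all
  ultimately show ?thesis unfolding b(2) by simp
qed

text \<open>The degree bound at infinity makes the coefficients b_j constant in \<mu>. The
  \<mu>-coefficient then says that b is a syzygy of the bottom row, hence Koszul, and pairing it
  with the top row gives minors.\<close>

lemma row_ideal_to_I2:
  assumes P: "row_det P \<noteq> 0" and f: "[:f:] \<in> row_ideal {..<q} (N P 0) (N P 1)"
  shows "f \<in> I2 k a q M"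
proof -
  note K = koszul_N[OF P]
  \<comment> \<open>The bound is taken as 1 rather than 0, since
    \<open>row_module_degree_bound\<close> turns \<open>Suc n\<close> into n.\<close>
  have deg: "degree [:f:] \<le> Suc 0" by simp
  obtain A where A: "[:f:] = (\<Sum>j<q. A j * row (N P 0) (N P 1) j)" "\<And>j. j \<in> {..<q} \<Longrightarrow> A j \<in> coeffs_in (Sw k a)"
    "\<And>j. j \<in> {..<q} \<Longrightarrow> degree (A j) \<le> 0"
    by (rule row_module_degree_bound[OF finite_lessThan scalar_closed_Sw K f[unfolded row_ideal_def] deg]) (rule that)
  define b where "b j = coeff (A j) 0" for j
  have Ab: "A j = [:b j:]" if "j < q" for j using A(3)[of j] that unfolding b_def by (metis degree_0_id lessThan_iff le_zero_eq)
  have bS: "b j \<in> Sw k a" if "j \<in> {..<q}" for j using A(2)[OF that] unfolding b_def coeffs_in_def by blast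
  have eq: "[:f:] = (\<Sum>j<q. [:b j * N P 0 j, - (b j * N P 1 j):])"
    unfolding A(1) by (intro sum.cong refl) (simp add: Ab row_def)
  have f0: "f = (\<Sum>j<q. b j * N P 0 j)" using arg_cong[OF eq, of "\<lambda>p. coeff p 0"] by (simp add: coeff_sum)
  have "(\<Sum>j<q. - (b j * N P 1 j)) = 0" using arg_cong[OF eq, of "\<lambda>p. coeff p 1"] by (simp add: coeff_sum)
  then have z: "(\<Sum>j<q. b j * (Const 0 * N P 0 j + Const 1 * N P 1 j)) = 0" by (simp add: sum_negf)
  have "\<exists>e. (\<forall>i<q. \<forall>j<q. e i j \<in> Sw k a \<and> e j i = - e i j) \<and> (\<forall>i<q. e i i = 0) \<and>
     (\<forall>i<q. b i = (\<Sum>j<q. e i j * (Const 0 * N P 0 j + Const 1 * N P 1 j)))"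
    using z unfolding N_comb by (intro M_koszul[OF row_det_point[OF P]]) (use bS in auto)
  then obtain e where e: "\<forall>i<q. \<forall>j<q. e i j \<in> Sw k a \<and> e j i = - e i j" "\<forall>i<q. e i i = 0"
    "\<forall>i<q. b i = (\<Sum>j<q. e i j * (Const 0 * N P 0 j + Const 1 * N P 1 j))" by (elim exE conjE) (rule that)
  have "f = (\<Sum>i<q. \<Sum>j<q. e i j * N P 1 j * N P 0 i)"
    unfolding f0 using e(3) by (intro sum.cong refl) (simp add: sum_distrib_right)
  also have "\<dots> = (\<Sum>(i, j)\<in>{(i, j). i < j \<and> j < q}. e i j * (N P 0 i * N P 1 j - N P 0 j * N P 1 i))"
    by (rule antisym_sum_pairs) (use e(1,2) in blast)+
  also have "\<dots> = (\<Sum>t\<in>{(i, j). i < j \<and> j < q}. (Const (row_det P) * e (fst t) (snd t)) * minor t)"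
    unfolding minor_N by (intro sum.cong refl) (auto simp: mult_ac)
  finally have "f = (\<Sum>t\<in>{(i, j). i < j \<and> j < q}. (Const (row_det P) * e (fst t) (snd t)) * minor t)" .
  moreover have "Const (row_det P) * e (fst t) (snd t) \<in> Sw k a" if "t \<in> {(i, j). i < j \<and> j < q}" for t
  proof -
    have "fst t < q" "snd t < q" using that by auto
    then show ?thesis using e(1) by (intro Sw_intros) blast
  qed
  ultimately show ?thesis unfolding I2_image gen_ideal_Sw_image[OF finite_pairs]
    by (intro exI[of _ "\<lambda>t. Const (row_det P) * e (fst t) (snd t)"]) blast
qed

lemma one_notin_I2: "1 \<notin> I2 k a q M"
proof
  assume "1 \<in> I2 k a q M"
  then obtain b where b: "1 = (\<Sum>t\<in>{(j, l). j < l \<and> l < q}. b t * minor t)"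
    unfolding I2_image gen_ideal_Sw_image[OF finite_pairs] by blast
  have "hcomp m 0 (b t * minor t) = 0" if t: "t \<in> {(j, l). j < l \<and> l < q}" for t
  proof -
    obtain j l where jl: "t = (j, l)" "j < q" "l < q" using t by auto
    have "homog m (cd j + cd l) (minor t)" unfolding jl(1) minor_def
      using homog_mult[OF M_simps(3)[OF jl(2)] M_simps(4)[OF jl(3)]] homog_mult[OF M_simps(3)[OF jl(3)] M_simps(4)[OF jl(2)]]
      by (simp add: homog_diff add.commute)
    from hcomp_mult_homog'[OF this] show ?thesis using cd_pos[OF jl(2)] by simp
  qed
  then have "hcomp m 0 (1 :: 'k mpoly) = 0" by (subst b) (simp add: hcomp_sum)
  moreover have "hcomp m 0 (1 :: 'k mpoly) = 1" using hcomp_of_homog[OF homog_Const, of m 0 "1 :: 'k"] by simp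
  ultimately show False by simp
qed

end

context nf_family
begin

text \<open>Up to denominators in \<mu> both factors are congruent to polynomials over
  \<open>free_ring\<close>, which form a domain meeting the row ideal only in 0. A factor congruent
  to 0 lies in the row ideal by torsion-freeness and, being free of \<mu>, in the ideal of
  minors.\<close>

lemma I2_prime:
  assumes n: "n = Suc k" shows "prime_ideal_in (Sw k a) (I2 k a q M)"
  unfolding prime_ideal_in_def
proof (intro conjI one_notin_I2 ballI impI)
  have family_cols: "family_cols = {..<q}" 
  proof (intro set_eqI iffI)
    fix j assume "j \<in> {..<q}"
    then have j: "j < q" by simp
    then obtain i where "i \<le> k" "cd j = m i" using cd_cases by blast
    then show "j \<in> family_cols" using j n unfolding family_cols_def deg_cols_def by auto
  qed (auto simp: family_cols_def deg_cols_def)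
  have ksF: "scalar_closed (Sw k a)" by (rule scalar_closed_Sw)
  note K = koszul_N[OF P]
  have V: "{v \<in> Vars k a. fst v < n} = Vars k a" using n by (auto simp: Vars_def)
  have main: "h \<in> I2 k a q M" if D: "D \<noteq> 0" and h: "cpoly D * [:h:] - 0 \<in> family_ideal" for D h
  proof -
    have "[:h:] \<in> family_ideal" using row_module_torsion_free'[OF alg finite_lessThan ksF K D] h unfolding family_cols row_ideal_def by simp
    then show ?thesis using row_ideal_to_I2[OF P] unfolding family_cols by blast
  qed
  fix f g assume f: "f \<in> Sw k a" and g: "g \<in> Sw k a" and fg: "f * g \<in> I2 k a q M"
  have el: "[:p:] \<in> elim_set" if "p \<in> Sw k a" for p
    by (rule Elim_coeffs_in) (use const_coeffs_in[OF that] in \<open>simp add: V Sw_PolyOn\<close>)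
  obtain D f' where D: "D \<noteq> 0" "f' \<in> coeffs_in free_ring" "cpoly D * [:f:] - f' \<in> family_ideal" using el[OF f] unfolding Elim_def by blast
  obtain E g' where E: "E \<noteq> 0" "g' \<in> coeffs_in free_ring" "cpoly E * [:g:] - g' \<in> family_ideal" using el[OF g] unfolding Elim_def by blast
  have f'S: "f' \<in> coeffs_in (Sw k a)" using D(2) subring_free_ring unfolding coeffs_in_def subring_def by blast
  have "[:f * g:] \<in> family_ideal" using I2_to_row_ideal[OF P fg] unfolding family_cols .
  \<comment> \<open>With u = D f and w = E g this is u w - (w (u - f') + f' (w - g')), which equals
    f' g'.\<close>
  then have "cpoly (D * E) * [:f * g:] - (cpoly E * [:g:] * (cpoly D * [:f:] - f') + f' * (cpoly E * [:g:] - g')) \<in> family_ideal"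
    by (intro row_ideal_diff row_ideal_add row_ideal_mult D(3) E(3) f'S coeffs_in_Sw_cpoly coeffs_in_Sw_mult const_coeffs_in g)
  also have "cpoly (D * E) * [:f * g:] - (cpoly E * [:g:] * (cpoly D * [:f:] - f') + f' * (cpoly E * [:g:] - g')) = f' * g'"
  proof -
    have "[:f * g:] = [:f:] * [:g:]" by simp
    then have "cpoly (D * E) * [:f * g:] = (cpoly D * [:f:]) * (cpoly E * [:g:])" unfolding cpoly_mult by (simp only: mult_ac)
    moreover have "u * w - (w * (u - f') + f' * (w - g')) = f' * g'" for u w :: "'k mpoly poly" by (simp add: algebra_simps)
    ultimately show ?thesis by metis
  qed
  finally have "f' * g' \<in> family_ideal" .
  then have "f' * g' = 0"
    using row_module_free_ring_zero[OF finite_family_cols _ ksF, of "f' * g'"] K subring_coeffs_in_mult[OF subring_free_ring D(2) E(2)]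
    unfolding row_ideal_def family_cols[symmetric] by (simp add: family_cols_def)
  \<comment> \<open>The lexicographic order on index pairs orders the monomials linearly, so the
    polynomial ring has no zero divisors.\<close>
  then have "f' = 0 \<or> g' = 0" by simp
  then show "f \<in> I2 k a q M \<or> g \<in> I2 k a q M" using main[OF D(1)] main[OF E(1)] D(3) E(3) by blast
qed

end

section \<open>Change of coordinates\<close>

lemma concat_eq_map:
  assumes "concat yss = map f xs" shows "\<exists>xss. concat xss = xs \<and> map (map f) xss = yss"
  using assms
proof (induction yss arbitrary: xs)
  case (Cons ys yss)
  then obtain us vs where "xs = us @ vs" "map f us = ys" "map f vs = concat yss"
    by (metis append_eq_map_conv concat.simps(2))
  moreover from this(3) obtain xss where "concat xss = vs" "map (map f) xss = yss" using Cons.IH[of vs] by auto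
  ultimately show ?case by (intro exI[of _ "us # xss"]) simp
qed simp

lemma count_map: "count (mset (map f xs)) x = length (filter (\<lambda>j. f j = x) xs)"
  by (induction xs) auto

context weights
begin

lemma lower_poly_0_eq: "lower_poly k a m 0 p \<Longrightarrow> p = 0"
proof -
  assume p: "lower_poly k a m 0 p"
  have "Low 0 = {}" using m_less_iff[of _ 0] by (auto simp: Low_iff)
  then have "x = 0" if "x \<in> keys p" for x using p that unfolding lower_poly_iff PolyOn_iff by auto
  then have "homog m 0 p" unfolding homog_def by (intro ballI) force
  then show "p = 0" using p m0 homog_eqI_0[of m "m 0" p 0] by (simp add: lower_poly_iff)
qed

end

context nf_family
begin

definition idx :: "nat \<Rightarrow> nat" where "idx l = (SOME i. i \<le> k \<and> cd l = m i)"

lemma idx: "l < q \<Longrightarrow> idx l \<le> k \<and> cd l = m (idx l)"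
  unfolding idx_def using someI_ex[OF cd_cases[of l]] by simp

lemma deg_cols_idx: "i \<le> k \<Longrightarrow> l \<in> deg_cols i \<Longrightarrow> idx l = i"
proof -
  assume i: "i \<le> k" and "l \<in> deg_cols i"
  then have l: "l < q" "cd l = m i" by (auto simp: deg_cols_def)
  show ?thesis
    by (rule m_inj[OF conjunct1[OF idx[OF l(1)]] i], rule trans[OF conjunct2[OF idx[OF l(1)], symmetric] l(2)])
qed

definition M' :: "nat \<Rightarrow> nat \<Rightarrow> 'k mpoly" where
  "M' r l = subst \<sigma> (\<Sum>j\<in>deg_cols (idx l). Const (c (idx l) j l) * N P r j)"

lemma sum_deg_cols:
  assumes l: "l < q"
  shows "(\<Sum>t<q. if cd t = cd l then f t else 0) = (\<Sum>t\<in>deg_cols (idx l). f t)"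
proof -
  have "deg_cols (idx l) = {t \<in> {..<q}. cd t = cd l}" using idx[OF l] by (auto simp: deg_cols_def)
  then show ?thesis by (simp only: sum.inter_filter[OF finite_lessThan])
qed

text \<open>The column operation is block diagonal along the degrees, with constant blocks
  \<open>c i\<close> and inverse blocks \<open>c' i\<close>. Entries joining different degrees are
  zero and hence homogeneous of every degree, so the column degrees stay \<open>cd\<close>.\<close>

lemma change_of_coords_M':
  assumes n: "n = Suc k" shows "change_of_coords k a m q M cd M' cd"
proof -
  define G where "G g j l = (if cd j = cd l then Const (g (idx l) j l) else (0 :: 'k mpoly))" for g :: "nat \<Rightarrow> nat \<Rightarrow> nat \<Rightarrow> 'k" and j l
  have GS: "G g j l \<in> Sw k a \<and> (if cd j \<le> cd l then homog m (cd l - cd j) (G g j l) else G g j l = 0)" for g j l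
    by (auto simp: G_def intro!: Sw_intros)
  have inv: "(\<Sum>t<q. G g j t * G g' t l) = (if j = l then 1 else 0)"
    if j: "j < q" and l: "l < q" and gg: "\<And>i j l. i < n \<Longrightarrow> j \<in> deg_cols i \<Longrightarrow> l \<in> deg_cols i \<Longrightarrow> (\<Sum>t\<in>deg_cols i. g i j t * g' i t l) = (if j = l then 1 else 0)"
    for g g' j l
  proof (cases "cd j = cd l")
    case True
    have i: "idx l < n" "j \<in> deg_cols (idx l)" "l \<in> deg_cols (idx l)" using idx[OF l] True j l n by (auto simp: deg_cols_def)
    have "(\<Sum>t<q. G g j t * G g' t l) = (\<Sum>t<q. if cd t = cd l then G g j t * G g' t l else 0)"
      by (intro sum.cong refl) (simp add: G_def)
    also have "\<dots> = (\<Sum>t\<in>deg_cols (idx l). G g j t * G g' t l)" by (rule sum_deg_cols[OF l])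
    also have "\<dots> = (\<Sum>t\<in>deg_cols (idx l). Const (g (idx l) j t * g' (idx l) t l))"
    proof (intro sum.cong refl)
      fix t assume t: "t \<in> deg_cols (idx l)"
      then have "idx t = idx l" "cd t = cd l" using deg_cols_idx[of "idx l" t] idx[OF l] by (auto simp: deg_cols_def)
      then show "G g j t * G g' t l = Const (g (idx l) j t * g' (idx l) t l)"
        using True by (simp add: G_def Const_mult)
    qed
    also have "\<dots> = Const (if j = l then 1 else 0)" unfolding Const_sum[symmetric] gg[OF i] ..
    finally show ?thesis by simp
  next
    case False
    then have "(\<Sum>t<q. G g j t * G g' t l) = 0" by (intro sum.neutral) (auto simp: G_def)
    then show ?thesis using False by auto
  qed
  have cc: "(\<Sum>t\<in>deg_cols i. c i j t * c' i t l) = (if j = l then 1 else 0)" "(\<Sum>t\<in>deg_cols i. c' i j t * c i t l) = (if j = l then 1 else 0)"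
    if "i < n" "j \<in> deg_cols i" "l \<in> deg_cols i" for i j l
    using NF[OF that(1)] that(2,3) unfolding is_normal_form_def by blast+
  have M': "M' r l = (\<Sum>j<q. (\<Sum>s<2. Const (P r s) * subst \<sigma> (M s j)) * G c j l)" if l: "l < q" for r l
  proof -
    have "(\<Sum>j<q. (\<Sum>s<2. Const (P r s) * subst \<sigma> (M s j)) * G c j l)
        = (\<Sum>j<q. if cd j = cd l then Const (c (idx l) j l) * subst \<sigma> (N P r j) else 0)"
      by (intro sum.cong refl) (simp add: G_def N_def subst_add subst_mult numeral_2_eq_2 mult.commute)
    also have "\<dots> = M' r l" unfolding sum_deg_cols[OF l] M'_def by (simp add: subst_sum subst_mult)
    finally show ?thesis by simp
  qed
  show ?thesis unfolding change_of_coords_def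
    by (rule exI[of _ \<sigma>], rule exI[of _ P], rule exI[of _ "G c"], rule exI[of _ "G c'"])
      (use sigma(1) P GS inv[of _ _ c c', OF _ _ cc(1)] inv[of _ _ c' c, OF _ _ cc(2)] M' in \<open>simp add: row_det_def\<close>)
qed

lemma deg_part_M':
  assumes n: "n = Suc k" and i: "i \<le> k"
  shows "deg_part q M' cd (m i) = map (map_prod (subst \<sigma>) (subst \<sigma>)) (concat (css i))"
proof -
  have "i < n" using n i by simp
  have "map (\<lambda>j. (M' 0 j, M' 1 j)) (deg_cols_list i) = map (\<lambda>l. map_prod (subst \<sigma>) (subst \<sigma>)
      (\<Sum>j\<in>deg_cols i. Const (c i j l) * N P 0 j, \<Sum>j\<in>deg_cols i. Const (c i j l) * N P 1 j)) (deg_cols_list i)"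
    using deg_cols_idx[OF i] deg_cols_list(2)[of i] by (intro map_cong refl) (simp add: M'_def)
  then show ?thesis unfolding deg_part_def css_cols[OF \<open>i < n\<close>] deg_cols_list_def by (simp add: comp_def)
qed

definition kind :: "'k option \<times> 'k mpoly list \<Rightarrow> block_kind" where
  "kind b = (case fst b of None \<Rightarrow> Scroll | Some e \<Rightarrow> Jordan)"

lemma sigma_good: "v \<in> Vars k a \<Longrightarrow> \<sigma> v \<in> Sw k a \<and> homog m (m (fst v)) (\<sigma> v)"
  using sigma(1) unfolding graded_aut_def by blast

text \<open>\<open>subst \<sigma>\<close> sends each form of the chain to its variable and lower
  polynomials to lower polynomials, so the shape of the block is kept.\<close>

lemma is_block_sigma:
  assumes blk: "nf_block i b cs" and js: "distinct js" "\<forall>j\<in>set js. (i, j) \<in> Vars k a" "map (\<lambda>l. y (i, l)) js = snd b"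
  shows "is_block k a m i (kind b) js (map (map_prod (subst \<sigma>) (subst \<sigma>)) cs)"
proof -
  obtain p where p: "\<forall>s. lower_poly k a m i (p s)" and ne: "snd b \<noteq> []" and cs: "cs = (case fst b of
      Some e \<Rightarrow> map (\<lambda>s. (snd b ! s, (if s + 1 < length (snd b) then snd b ! (s + 1) else 0) + Const e * snd b ! s + p s)) [0..<length (snd b)]
    | None \<Rightarrow> map (\<lambda>s. (snd b ! s, snd b ! (s + 1) + (if s + 2 < length (snd b) then p (s + 1) else 0))) [0..<length (snd b) - 1])"
    using blk unfolding nf_block_def by blast
  have len: "length (snd b) = length js" using arg_cong[OF js(3), of length] by simp
  have nth: "subst \<sigma> (snd b ! s) = Var (i, js ! s)" if "s < length js" for s
  proof -
    have "(i, js ! s) \<in> Vars k a" using js(2) that by simp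
    moreover have "snd b ! s = y (i, js ! s)" using that by (simp flip: js(3))
    ultimately show ?thesis using sigma(2) by simp
  qed
  have p': "lower_poly k a m i (subst \<sigma> (p s))" for s
    by (rule lower_poly_subst[OF sigma_good]) (use p in blast)+
  have "js \<noteq> []" using ne len by auto
  show ?thesis
  proof (cases "fst b")
    case None
    have "map (map_prod (subst \<sigma>) (subst \<sigma>)) cs = map (\<lambda>s. (Var (i, js ! s),
        Var (i, js ! (s + 1)) + (if s + 2 < length js then subst \<sigma> (p (s + 1)) else 0))) [0..<length js - 1]"
      unfolding cs None by (simp add: len nth subst_add)
    then show ?thesis unfolding is_block_def kind_def None using js(1,2) \<open>js \<noteq> []\<close>
      by (simp del: map_eq_conv) (rule exI[of _ "\<lambda>s. subst \<sigma> (p s)"], simp add: p')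
  next
    case (Some e)
    have "map (map_prod (subst \<sigma>) (subst \<sigma>)) cs = map (\<lambda>s. (Var (i, js ! s),
        (if s + 1 < length js then Var (i, js ! (s + 1)) else 0) + Const e * Var (i, js ! s) + subst \<sigma> (p s))) [0..<length js]"
      unfolding cs Some by (simp add: len nth subst_add subst_mult)
    then show ?thesis unfolding is_block_def kind_def Some using js(1,2) \<open>js \<noteq> []\<close>
      by (simp del: map_eq_conv) (rule exI[of _ "\<lambda>s. subst \<sigma> (p s)"], rule conjI, rule allI, rule p', rule exI[of _ e], rule refl)
  qed
qed

text \<open>The chains partition the list of coordinates of degree i. Cutting
  \<open>[1..<Suc (a i)]\<close> at the same places gives index lists that are disjoint across
  blocks.\<close>

lemma ex_indices:
  assumes i: "i < n"
  shows "\<exists>jss. length jss = length (bs i) \<and> concat jss = [1..<Suc (a i)] \<and>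
    (\<forall>t<length (bs i). is_block k a m i (kind (bs i ! t)) (jss ! t) (map (map_prod (subst \<sigma>) (subst \<sigma>)) (css i ! t)))"
proof -
  have "concat (map snd (bs i)) = map (\<lambda>l. y (i, l)) [1..<Suc (a i)]"
    using y_chain_polys[OF i] length_chain_polys[OF i] unfolding chain_polys_def[symmetric]
    by (intro nth_equalityI) (simp_all add: nth_upt del: upt_Suc)
  from concat_eq_map[OF this] obtain jss where jss: "concat jss = [1..<Suc (a i)]"
    "map (map (\<lambda>l. y (i, l))) jss = map snd (bs i)" by blast
  have len: "length jss = length (bs i)" using arg_cong[OF jss(2), of length] by simp
  have "is_block k a m i (kind (bs i ! t)) (jss ! t) (map (map_prod (subst \<sigma>) (subst \<sigma>)) (css i ! t))"
    if t: "t < length (bs i)" for t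
  proof (rule is_block_sigma)
    show "nf_block i (bs i ! t) (css i ! t)" using NF_blocks[OF i] t by (simp add: list_all2_conv_all_nth)
    have mem: "jss ! t \<in> set jss" using t len by simp
    have "distinct (concat jss)" unfolding jss(1) by simp
    then show "distinct (jss ! t)" using mem unfolding distinct_concat_iff by blast
    have "set (jss ! t) \<subseteq> set (concat jss)" using mem by auto
    then show "\<forall>j\<in>set (jss ! t). (i, j) \<in> Vars k a" unfolding jss(1) using i n by (auto simp: Vars_def)
    show "map (\<lambda>l. y (i, l)) (jss ! t) = snd (bs i ! t)"
      using arg_cong[OF jss(2), of "\<lambda>xs. xs ! t"] t len by simp
  qed
  then show ?thesis using len jss(1) by blast
qed

lemma made_up_of_M':
  assumes n: "n = Suc k" and i: "i \<le> k" and K: "\<And>b. b \<in> set (bs i) \<Longrightarrow> kind b \<in> K"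
  shows "made_up_of k a m i K (deg_part q M' cd (m i))"
proof -
  let ?s = "map (map_prod (subst \<sigma>) (subst \<sigma>))"
  have "i < n" using n i by simp
  then obtain jss where jss: "length jss = length (bs i)" "concat jss = [1..<Suc (a i)]"
    "\<forall>t<length (bs i). is_block k a m i (kind (bs i ! t)) (jss ! t) (?s (css i ! t))" using ex_indices by blast
  have lcss: "length (css i) = length (bs i)" using NF_blocks[OF \<open>i < n\<close>] list_all2_lengthD by fastforce
  define B where "B = map (\<lambda>t. (kind (bs i ! t), jss ! t, ?s (css i ! t))) [0..<length (bs i)]"
  have 1: "map (\<lambda>b. fst (snd b)) B = jss" unfolding B_def using jss(1) by (intro nth_equalityI) simp_all
  have 2: "map (\<lambda>b. snd (snd b)) B = map ?s (css i)" unfolding B_def using lcss by (intro nth_equalityI) simp_all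
  have "kind b \<noteq> Nilpotent" for b by (simp add: kind_def split: option.splits)
  then have 3: "filter (\<lambda>b. fst b = Nilpotent) B = []" unfolding B_def by (auto simp: filter_empty_conv)
  have 4: "\<forall>(kd, js, cols)\<in>set B. kd \<in> K \<and> is_block k a m i kd js cols" unfolding B_def using jss(3) K by auto
  have 5: "deg_part q M' cd (m i) = concat (map (\<lambda>b. snd (snd b)) B)"
    unfolding deg_part_M'[OF n i] 2 map_concat ..
  show ?thesis unfolding made_up_of_def
    by (rule exI[of _ B]) (use 1 3 4 5 jss(2) in simp)
qed

text \<open>Lower polynomials vanish in degree 0, so the last column of a Jordan chain is (U, e U),
  and the generalized row with coefficients (-e, 1) would have a nontrivial constant syzygy.\<close>

lemma no_Jordan_0:
  assumes n: "0 < n" and b: "b \<in> set (bs 0)" shows "fst b = None"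
proof (rule ccontr)
  assume "fst b \<noteq> None"
  then obtain e where e: "fst b = Some e" by blast
  obtain t where "t < length (bs 0)" "bs 0 ! t = b" using b unfolding in_set_conv_nth by blast
  then have "css 0 ! t \<in> set (css 0)" "nf_block 0 b (css 0 ! t)"
    using NF_blocks[OF n] unfolding list_all2_conv_all_nth by auto
  then obtain cs where cs: "cs \<in> set (css 0)" "nf_block 0 b cs" by blast
  obtain p where p: "\<forall>s. lower_poly k a m 0 (p s)" and ne: "snd b \<noteq> []" and cs_eq: "cs =
      map (\<lambda>s. (snd b ! s, (if s + 1 < length (snd b) then snd b ! (s + 1) else 0) + Const e * snd b ! s + p s)) [0..<length (snd b)]"
    using cs(2) e unfolding nf_block_def by auto
  define U where "U = snd b ! (length (snd b) - 1)"
  have "p (length (snd b) - 1) = 0" using p lower_poly_0_eq by blast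
  then have "(U, Const e * U) \<in> set cs" unfolding cs_eq U_def using ne by (auto intro!: image_eqI[of _ _ "length (snd b) - 1"])
  then have "(U, Const e * U) \<in> set (concat (css 0))" using cs(1) by auto
  then obtain l where l: "l \<in> deg_cols 0" "U = (\<Sum>j\<in>deg_cols 0. Const (c 0 j l) * N P 0 j)" "Const e * U = (\<Sum>j\<in>deg_cols 0. Const (c 0 j l) * N P 1 j)"
    unfolding css_cols[OF n] using deg_cols_list(2)[of 0] by auto
  have "(\<Sum>j<q. (if j \<in> deg_cols 0 then Const (c 0 j l) else 0) * (Const (- e) * N P 0 j + Const 1 * N P 1 j))
      = (\<Sum>j\<in>deg_cols 0. Const (c 0 j l) * (Const (- e) * N P 0 j + Const 1 * N P 1 j))"
    by (rule sum.mono_neutral_cong_right) (auto simp: deg_cols_def)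
  also have "\<dots> = (\<Sum>j\<in>deg_cols 0. Const (- e) * (Const (c 0 j l) * N P 0 j)) + (\<Sum>j\<in>deg_cols 0. Const (c 0 j l) * N P 1 j)"
    unfolding sum.distrib[symmetric] by (intro sum.cong refl) (simp add: algebra_simps)
  also have "\<dots> = Const (- e) * U + Const e * U" unfolding l(3) by (simp add: l(2) sum_distrib_left)
  also have "\<dots> = 0" by (simp add: Const_uminus)
  finally have z: "(\<Sum>j<q. (if j \<in> deg_cols 0 then Const (c 0 j l) else 0) * (Const (- e) * N P 0 j + Const 1 * N P 1 j)) = 0" .
  have "c 0 j l = 0" if "j \<in> deg_cols 0" for j
    using syzygy_const[OF P _ _ z, of j "c 0 j l"] that by (simp add: deg_cols_def Sw_intros)
  then have "(\<Sum>t\<in>deg_cols 0. c' 0 l t * c 0 t l) = 0" by simp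
  moreover have "(\<Sum>t\<in>deg_cols 0. c' 0 l t * c 0 t l) = 1" using NF[OF n] l(1) unfolding is_normal_form_def by simp
  ultimately show False by simp
qed

text \<open>All chains are scrolls, so their number is the number of ends, which is
  \<open>a 0\<close> minus the number of columns, that is one.\<close>

lemma scroll_0:
  assumes n: "n = Suc k" and cnt0: "a 0 = card (deg_cols 0) + 1"
  shows "\<exists>js. is_block k a m 0 Scroll js (deg_part q M' cd (m 0))"
proof -
  have n0: "0 < n" using n by simp
  have "filter (\<lambda>b. fst b = None) (bs 0) = bs 0" using no_Jordan_0[OF n0] by (simp add: filter_id_conv)
  then have "length (chain_ends (bs 0)) = length (bs 0)" unfolding chain_ends_def by simp
  then have "length (bs 0) = 1" using length_ends[OF n0] cnt0 by simp
  then obtain b where b: "bs 0 = [b]" by (metis One_nat_def length_0_conv length_Suc_conv)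
  then obtain cs where cs: "css 0 = [cs]" using NF_blocks[OF n0] by (auto simp: list_all2_Cons1)
  obtain jss where "is_block k a m 0 (kind (bs 0 ! 0)) (jss ! 0) (map (map_prod (subst \<sigma>) (subst \<sigma>)) (css 0 ! 0))"
    using ex_indices[OF n0] b by auto
  moreover have "kind b = Scroll" using no_Jordan_0[OF n0, of b] b by (simp add: kind_def)
  ultimately show ?thesis unfolding deg_part_M'[OF n le0] by (auto simp: b cs)
qed

end

theorem theorem4p14:
  fixes k :: nat and a m :: "nat \<Rightarrow> nat" and r q :: nat
    and M :: "nat \<Rightarrow> nat \<Rightarrow> 'k::field mpoly" and cd :: "nat \<Rightarrow> nat"
  assumes alg_closed: "alg_closed_field TYPE('k)"
    and k_pos: "1 \<le> k"
    and m0: "m 0 = 1"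
    and m_mono: "\<And>i. 1 \<le> i \<Longrightarrow> i \<le> k \<Longrightarrow> m (i - 1) < m i"
    and a0: "1 \<le> a 0"
    and hom: "homog_matrix k a m q M cd"
    and gen: "one_generic k a m q M cd"
    and prof: "profile q cd = replicate_mset (a 0 - 1) 1
                 + (\<Sum>i \<in> {1..<k}. replicate_mset (a i) (m i)) + replicate_mset r (m k)"
  shows "(\<exists>M' cd'. change_of_coords k a m q M cd M' cd' \<and>
            (\<exists>js. is_block k a m 0 Scroll js (deg_part q M' cd' (m 0))) \<and>
            (\<forall>i \<in> {1..<k}. made_up_of k a m i {Jordan, Nilpotent} (deg_part q M' cd' (m i))) \<and>
            made_up_of k a m k {Jordan, Scroll, Nilpotent} (deg_part q M' cd' (m k)))
         \<and> prime_ideal_in (Sw k a) (I2 k a q M)"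
proof -
  interpret weights k a m by unfold_locales (fact m0, rule m_mono)
  have cnt_sum: "count (\<Sum>i\<in>I. replicate_mset (a i) (m i)) x = (\<Sum>i\<in>I. if m i = x then a i else 0)" for I x
    by (simp add: count_sum eq_commute[of x])
  interpret generic_matrix k a m q M cd
  proof unfold_locales
    show "alg_closed_field TYPE('k)" "homog_matrix k a m q M cd" by fact+
    show "pseudo_1_generic k a q M" using gen by (simp add: one_generic_def)
    fix j assume "j < q"
    then have "cd j \<in># profile q cd" unfolding profile_def by auto
    then have "cd j = m 0 \<or> (\<exists>i\<in>{1..<k}. cd j = m i) \<or> cd j = m k"
      unfolding prof by (auto simp: m0 in_replicate_mset set_mset_sum split: if_splits)
    then show "\<exists>i\<le>k. cd j = m i" by (metis atLeastLessThan_iff le0 le_refl less_imp_le)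
  qed
  have card_Jc: "card (deg_cols i) = count (profile q cd) (m i)" for i
  proof -
    have "card (deg_cols i) = length (deg_cols_list i)" using distinct_card[OF deg_cols_list(1)[of i]] deg_cols_list(2)[of i] by simp
    then show ?thesis unfolding profile_def count_map deg_cols_list_def .
  qed
  have cnt0: "a 0 = card (deg_cols 0) + 1"
  proof -
    have "(\<Sum>i\<in>{1..<k}. if m i = m 0 then a i else 0) = 0"
    proof (rule sum.neutral, rule ballI)
      fix i assume "i \<in> {1..<k}"
      then have "m i \<noteq> m 0" using m_less[of 0 i] by simp
      then show "(if m i = m 0 then a i else 0) = 0" by simp
    qed
    moreover have "m k \<noteq> m 0" using m_less[of 0 k] k_pos by simp
    ultimately show ?thesis using a0 unfolding card_Jc prof by (simp add: cnt_sum m0)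
  qed
  have cnt: "a i = card (deg_cols i)" if i: "1 \<le> i" "i < k" for i
  proof -
    have "(\<Sum>j\<in>{1..<k}. if m j = m i then a j else 0) = (\<Sum>j\<in>{1..<k}. if j = i then a j else 0)"
    proof (rule sum.cong[OF refl])
      fix j assume "j \<in> {1..<k}"
      then have "m j = m i \<longleftrightarrow> j = i" using m_inj[of j i] i by auto
      then show "(if m j = m i then a j else 0) = (if j = i then a j else 0)" by simp
    qed
    moreover have "m k \<noteq> m i" "m i \<noteq> 1" using m_less[of i k] m_less[of 0 i] m0 i by auto
    ultimately show ?thesis using i unfolding card_Jc prof by (simp add: cnt_sum)
  qed
  obtain P where P: "row_det P \<noteq> 0" "\<forall>i<Suc k. injrow i (deg_cols i) (N P 0)"
    using generic_row[OF cnt0 cnt, of "Suc k"] by blast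
  obtain bs css c c' d d' where "nf_family k a m q M cd P (Suc k) bs css c c' d d'"
    using NF_family_exists[of "Suc k" P] P by (auto simp: less_Suc_eq_le)
  then interpret nf_family k a m q M cd P "Suc k" bs css c c' d d' .
  have "made_up_of k a m i {Jordan, Nilpotent} (deg_part q M' cd (m i))" if i: "i \<in> {1..<k}" for i
  proof (rule made_up_of_M'[OF refl])
    \<comment> \<open>This degree has as many columns as variables, which leaves no scroll
      end.\<close>
    have "chain_ends (bs i) = []" using length_ends[of i] cnt[of i] i by simp
    then show "kind b \<in> {Jordan, Nilpotent}" if "b \<in> set (bs i)" for b
      using that unfolding chain_ends_def kind_def by (auto simp: filter_empty_conv)
  qed (use i in simp)
  moreover have "made_up_of k a m k {Jordan, Scroll, Nilpotent} (deg_part q M' cd (m k))"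
    by (rule made_up_of_M'[OF refl]) (auto simp: kind_def split: option.splits)
  ultimately show ?thesis
    using change_of_coords_M'[OF refl] scroll_0[OF refl cnt0] I2_prime[OF refl] by blast
qed

end
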